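(* Let $X$ be a Banach space with an unconditional basis. Assume that $X$ is not perfectly decomposable or that $X$ is not nearly ergodic. Then $X$ has the Schroeder-Bernstein Property restricted to spaces with UFDD.
   Context: Banach spaces are real; $X\sim Y$ means that $X$ and $Y$ are isomorphic (linearly homeomorphic). Write $X\overset{c}{\sim}Y$ if $X$ is isomorphic to a complemented subspace of $Y$ and $Y$ is isomorphic to a complemented subspace of $X$. Here $\mathbb N=\{1,2,3,\dots\}$ and $2^\omega$ is the Cantor space of $0$-$1$ sequences. A Schauder decomposition $X=\sum_{n\in\mathbb N}E_n$ of a Banach space $X$ is a sequence $(E_n)_{n\in\mathbb N}$ of closed subspaces such that every $x\in X$ can be written in a unique way as $x=\sum_{n\in\mathbb N}x_n$ with $x_n\in E_n$ for all $n$. It is unconditional if there is a constant $C$ such that for all $x=\sum_n x_n$ and all $I\subset\mathbb N$, $\|\sum_{n\in I}x_n\|\le C\|x\|$. A UFDD is an unconditional Schauder decomposition with all $E_n$ finite-dimensional. A Banach space $X$ has the Schroeder-Bernstein Property restricted to spaces with UFDD if $X$ has a UFDD and, whenever a Banach space $Y$ with a UFDD satisfies $Y\overset{c}{\sim}X$, it follows that $Y\sim X$. For a separable Banach space $X$, the set of closed subspaces of $X$ is equipped with the Effros-Borel structure, i.e. the $\sigma$-algebra generated by the sets $\{F : F\cap U\neq\emptyset\}$, $U\subset X$ open. A decomposition of $X$ is a pair $(A_0,A_1)$ of closed subspaces of $X$ with $X=A_0\oplus A_1$. A separable Banach space $X$ is perfectly decomposable if there is a Borel set $\{(A^0_\alpha,A^1_\alpha):\alpha\in2^\omega\}$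 of decompositions of $X$ such that for all $\alpha\neq\beta$ in $2^\omega$ and all $(\epsilon,\gamma)\in\{0,1\}^2$, $A_\alpha^\epsilon\not\sim A_\beta^\gamma$. $E_0$ is the equivalence relation on $2^\omega$ defined by $\alpha E_0\beta$ iff there is $m$ such that $\alpha(n)=\beta(n)$ for all $n\ge m$. Two Banach spaces are nearly isomorphic if some finite-codimensional (closed) subspace of one is isomorphic to some finite-codimensional (closed) subspace of the other. A separable Banach space $X$ is nearly ergodic if $E_0$ is Borel reducible to near isomorphism between subspaces of $X$, i.e. there is a Borel map $f$ from $2^\omega$ to the set of closed subspaces of $X$ such that for all $\alpha,\beta$: $\alpha E_0\beta$ if and only if $f(\alpha)$ and $f(\beta)$ are nearly isomorphic. *)

theory Defs
  imports "HOL-Analysis.Analysis"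
begin

text \<open>
  Isomorphism, decompositions and the Effros-Borel structure all concern subspaces, so a Banach
  space is represented throughout as a closed linear subspace of a type of class
  \<^class>\<open>banach\<close>; a type of this class is itself the case \<^term>\<open>UNIV\<close>.
\<close>

definition closed_subspace :: "'a::real_normed_vector set \<Rightarrow> 'a set \<Rightarrow> bool" where
  "closed_subspace F X \<longleftrightarrow> subspace F \<and> closed F \<and> F \<subseteq> X"

subsection \<open>Isomorphism and complementation\<close>

definition isomorphic_spaces ::
    "'a::real_normed_vector set \<Rightarrow> 'b::real_normed_vector set \<Rightarrow> bool" where
  "isomorphic_spaces X Y \<longleftrightarrow>
     (\<exists>f g. (\<forall>x\<in>X. \<forall>y\<in>X. f (x + y) = f x + f y) \<and>
            (\<forall>c. \<forall>x\<in>X. f (c *\<^sub>R x) = c *\<^sub>R f x) \<and>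
            homeomorphism X Y f g)"

definition space_decomposition ::
    "'a::real_normed_vector set \<Rightarrow> 'a set \<Rightarrow> 'a set \<Rightarrow> bool" where
  "space_decomposition X A B \<longleftrightarrow>
     closed_subspace A X \<and> closed_subspace B X \<and>
     A \<inter> B = {0} \<and> X = {a + b | a b. a \<in> A \<and> b \<in> B}"

definition complemented_in :: "'a::real_normed_vector set \<Rightarrow> 'a set \<Rightarrow> bool" where
  "complemented_in A X \<longleftrightarrow> (\<exists>B. space_decomposition X A B)"

definition complementably_equivalent ::
    "'a::real_normed_vector set \<Rightarrow> 'b::real_normed_vector set \<Rightarrow> bool" where
  "complementably_equivalent X Y \<longleftrightarrow>
     (\<exists>A. complemented_in A Y \<and> isomorphic_spaces X A) \<and>
     (\<exists>B. complemented_in B X \<and> isomorphic_spaces Y B)"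

subsection \<open>Unconditional decompositions and bases\<close>

definition finite_dimensional :: "'a::real_vector set \<Rightarrow> bool" where
  "finite_dimensional E \<longleftrightarrow> (\<exists>B. finite B \<and> E = span B)"

definition schauder_decomposition ::
    "'a::real_normed_vector set \<Rightarrow> (nat \<Rightarrow> 'a set) \<Rightarrow> bool" where
  "schauder_decomposition X E \<longleftrightarrow>
     (\<forall>n. closed_subspace (E n) X) \<and>
     (\<forall>x\<in>X. \<exists>!y. (\<forall>n. y n \<in> E n) \<and> y sums x)"

text \<open>
  The estimate for the sum over an index set \<open>I\<close> implicitly asserts that the subseries converges.
  This has to be said explicitly because \<^const>\<open>suminf\<close> is total.
\<close>

definition subseries_bounded_by :: "real \<Rightarrow> (nat \<Rightarrow> 'a::real_normed_vector) \<Rightarrow> bool" where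
  "subseries_bounded_by c y \<longleftrightarrow>
     (\<forall>I. summable (\<lambda>n. if n \<in> I then y n else 0) \<and>
          norm (\<Sum>n. if n \<in> I then y n else 0) \<le> c)"

definition unconditional_decomposition ::
    "'a::real_normed_vector set \<Rightarrow> (nat \<Rightarrow> 'a set) \<Rightarrow> bool" where
  "unconditional_decomposition X E \<longleftrightarrow>
     schauder_decomposition X E \<and>
     (\<exists>C. \<forall>x\<in>X. \<forall>y. (\<forall>n. y n \<in> E n) \<and> y sums x \<longrightarrow> subseries_bounded_by (C * norm x) y)"

definition has_UFDD :: "'a::real_normed_vector set \<Rightarrow> bool" where
  "has_UFDD X \<longleftrightarrow>
     (\<exists>E. unconditional_decomposition X E \<and> (\<forall>n. finite_dimensional (E n)))"

definition schauder_basis ::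
    "'a::real_normed_vector set \<Rightarrow> (nat \<Rightarrow> 'a) \<Rightarrow> bool" where
  "schauder_basis X e \<longleftrightarrow>
     range e \<subseteq> X \<and> (\<forall>x\<in>X. \<exists>!a. (\<lambda>n. a n *\<^sub>R e n) sums x)"

definition unconditional_basis ::
    "'a::real_normed_vector set \<Rightarrow> (nat \<Rightarrow> 'a) \<Rightarrow> bool" where
  "unconditional_basis X e \<longleftrightarrow>
     schauder_basis X e \<and>
     (\<exists>C. \<forall>x\<in>X. \<forall>a. (\<lambda>n. a n *\<^sub>R e n) sums x \<longrightarrow>
        subseries_bounded_by (C * norm x) (\<lambda>n. a n *\<^sub>R e n))"

subsection \<open>The Schroeder-Bernstein Property restricted to spaces with UFDD\<close>

text \<open>
  HOL cannot quantify over types inside a formula. The test space ranges over all closed subspaces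
  of the ambient type \<open>'b\<close>, which is an explicit parameter; leaving \<open>'b\<close> schematic in a theorem
  lets the test space be any Banach space.
\<close>

definition schroeder_bernstein_UFDD ::
    "'b::banach itself \<Rightarrow> 'a::banach set \<Rightarrow> bool" where
  "schroeder_bernstein_UFDD _ X \<longleftrightarrow>
     has_UFDD X \<and>
     (\<forall>Y :: 'b set. closed_subspace Y UNIV \<and> has_UFDD Y \<and> complementably_equivalent Y X
        \<longrightarrow> isomorphic_spaces Y X)"

subsection \<open>Effros-Borel structure, perfect decomposability, near ergodicity\<close>

definition effros :: "'a::real_normed_vector set \<Rightarrow> 'a set measure" where
  "effros X = sigma {F. closed_subspace F X}
     {{F. closed_subspace F X \<and> F \<inter> U \<noteq> {}} | U. openin (top_of_set X) U}"

lemma space_effros: "space (effros X) = {F. closed_subspace F X}"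
  unfolding effros_def by (rule space_measure_of) auto

lemma sets_effros:
  "sets (effros X) = sigma_sets {F. closed_subspace F X}
     {{F. closed_subspace F X \<and> F \<inter> U \<noteq> {}} | U. openin (top_of_set X) U}"
  unfolding effros_def by (rule sets_measure_of) auto

text \<open>
  The Cantor space is \<^typ>\<open>nat \<Rightarrow> bool\<close>, whose library topology is the product of discrete
  topologies, with \<open>False\<close> for 0 and \<open>True\<close> for 1.
  Separability is not part of the two definitions below; they are meant for separable \<open>X\<close>.
\<close>

definition perfectly_decomposable :: "'a::real_normed_vector set \<Rightarrow> bool" where
  "perfectly_decomposable X \<longleftrightarrow>
     (\<exists>A :: (nat \<Rightarrow> bool) \<Rightarrow> bool \<Rightarrow> 'a set.
        (\<forall>\<alpha>. space_decomposition X (A \<alpha> False) (A \<alpha> True)) \<and>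
        range (\<lambda>\<alpha>. (A \<alpha> False, A \<alpha> True)) \<in> sets (effros X \<Otimes>\<^sub>M effros X) \<and>
        (\<forall>\<alpha> \<beta>. \<alpha> \<noteq> \<beta> \<longrightarrow> (\<forall>\<epsilon> \<gamma>. \<not> isomorphic_spaces (A \<alpha> \<epsilon>) (A \<beta> \<gamma>))))"

definition E0 :: "(nat \<Rightarrow> bool) \<Rightarrow> (nat \<Rightarrow> bool) \<Rightarrow> bool" where
  "E0 \<alpha> \<beta> \<longleftrightarrow> (\<exists>m. \<forall>n\<ge>m. \<alpha> n = \<beta> n)"

definition finite_codimensional_in :: "'a::real_normed_vector set \<Rightarrow> 'a set \<Rightarrow> bool" where
  "finite_codimensional_in F X \<longleftrightarrow>
     closed_subspace F X \<and> (\<exists>B. finite B \<and> X = span (F \<union> B))"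

definition nearly_isomorphic ::
    "'a::real_normed_vector set \<Rightarrow> 'b::real_normed_vector set \<Rightarrow> bool" where
  "nearly_isomorphic X Y \<longleftrightarrow>
     (\<exists>F G. finite_codimensional_in F X \<and> finite_codimensional_in G Y \<and> isomorphic_spaces F G)"

definition nearly_ergodic :: "'a::real_normed_vector set \<Rightarrow> bool" where
  "nearly_ergodic X \<longleftrightarrow>
     (\<exists>f \<in> borel \<rightarrow>\<^sub>M effros X. \<forall>\<alpha> \<beta>. E0 \<alpha> \<beta> \<longleftrightarrow> nearly_isomorphic (f \<alpha>) (f \<beta>))"

end

theory Submission
  imports Defs
begin

text \<open>
  Let \<open>Z = \<Sum>n. F\<^sub>n\<close> be complemented in \<open>X\<close> with complement \<open>A\<close>, and let \<open>Z\<^sub>I = \<Sum>n\<in>I. F\<^sub>n\<close>. The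
  relations between subsets \<open>I\<close> and \<open>J\<close> of the natural numbers saying that \<open>Z\<^sub>I\<close> and \<open>Z\<^sub>J\<close> are nearly
  isomorphic, or that one of \<open>Z\<^sub>I\<close> and its complement \<open>Z\<^bsub>-I\<^esub> \<oplus> A\<close> is isomorphic to one of \<open>Z\<^sub>J\<close> and its
  complement, are countable unions of analytic relations. If the first is meager, \<open>E\<^sub>0\<close> reduces to it and
  \<open>X\<close> is nearly ergodic; if the second is meager, \<open>X\<close> is perfectly decomposable. Otherwise an analytic
  piece is comeager in an open set, so for some finite patterns on disjoint intervals all \<open>Z\<^sub>I \<oplus> D\<close>
  with \<open>I\<close> matching infinitely many patterns are isomorphic, where \<open>D\<close> is \<open>A\<close> or finite-dimensional.
  Adding to such an \<open>I\<close> a set that avoids infinitely many patterns does not change the isomorphism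
  type, and it follows that \<open>X \<oplus> Z \<sim> X\<close> up to finite-dimensional summands.

  Applied to the basis of \<open>X\<close>, this gives that \<open>X\<close> is isomorphic to its hyperplanes and to its square.
  Applied to a copy of \<open>Y\<close> in \<open>X\<close>, it gives \<open>X \<oplus> Y \<sim> X\<close>. If \<open>Y \<sim> X \<oplus> B\<close>, then
  \<open>Y \<sim> X \<oplus> X \<oplus> B \<sim> X \<oplus> Y \<sim> X\<close>.
\<close>

subsection \<open>Category in sequence spaces\<close>

text \<open>The two hypotheses call for different relations. A reduction of \<open>E0\<close> has to
  tolerate finite changes of the index set, as near isomorphism does. Perfect decomposability asks
  for pairwise non-isomorphic halves; there distinct sequences are first made
  \<open>E0\<close>-inequivalent by repeating every bit infinitely often. The obstacle is that
  isomorphism is only analytic: nonmeagerness yields comeagerness in a cylinder through the Baire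
  property alone. The right-hand set is then frozen on the pattern, so all matching left-hand sets
  lead to one and the same space. A pattern leaves no freedom below its first block, so only sums of
  summands with large index are absorbed. The finite-dimensional rest is taken care of by the
  isomorphism of the space with its hyperplanes, which is therefore proved first, by cancelling
  lines. Both hypotheses concern subspaces of the given space only. This is why the copy of the
  second space inside it is decomposed, together with its complement.\<close>

text \<open>
  The topology is the product of discrete topologies, whose basic open sets are the cylinders.
\<close>

definition cylinder :: "'a list \<Rightarrow> (nat \<Rightarrow> 'a) set" where
  "cylinder s = {x. map x [0..<length s] = s}"

definition nowhere_dense_seqs :: "(nat \<Rightarrow> 'a) set \<Rightarrow> bool" where
  "nowhere_dense_seqs S \<longleftrightarrow> (\<forall>s. \<exists>t. cylinder (s @ t) \<inter> S = {})"

definition meager_seqs :: "(nat \<Rightarrow> 'a) set \<Rightarrow> bool" where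
  "meager_seqs S \<longleftrightarrow> (\<exists>N :: nat \<Rightarrow> (nat \<Rightarrow> 'a) set. (\<forall>n. nowhere_dense_seqs (N n)) \<and> S \<subseteq> (\<Union>n. N n))"

lemma mem_cylinder: "x \<in> cylinder s \<longleftrightarrow> (\<forall>i<length s. x i = s ! i)"
  unfolding cylinder_def mem_Collect_eq by (subst list_eq_iff_nth_eq) simp

lemma cylinder_append_subset: "cylinder (s @ t) \<subseteq> cylinder s"
  by (auto simp: mem_cylinder nth_append)

lemma cylinder_nonempty: "cylinder s \<noteq> {}"
proof -
  have "(\<lambda>i. s ! i) \<in> cylinder s" by (simp add: mem_cylinder)
  then show ?thesis by blast
qed

lemma cylinder_split:
  assumes "x \<in> cylinder s" "length s \<le> n"
  shows "map x [0..<n] = s @ map x [length s..<n]"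
proof -
  have "map x [0..<n] = map x [0..<length s] @ map x [length s..<n]"
    using assms(2) upt_add_eq_append[of 0 "length s" "n - length s"] by simp
  then show ?thesis using assms(1) by (simp add: cylinder_def)
qed

lemma nowhere_dense_meager: "nowhere_dense_seqs S \<Longrightarrow> meager_seqs S"
  unfolding meager_seqs_def by (rule exI[of _ "\<lambda>_. S"]) auto

lemma meager_subset: "meager_seqs T \<Longrightarrow> S \<subseteq> T \<Longrightarrow> meager_seqs S"
  unfolding meager_seqs_def by blast

lemma meager_UN_nat:
  assumes "\<And>n::nat. meager_seqs (S n)"
  shows "meager_seqs (\<Union>n. S n)"
proof -
  have "\<forall>n. \<exists>N :: nat \<Rightarrow> _. (\<forall>k. nowhere_dense_seqs (N k)) \<and> S n \<subseteq> (\<Union>k. N k)"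
    using assms unfolding meager_seqs_def by blast
  then obtain N :: "nat \<Rightarrow> nat \<Rightarrow> _"
    where N: "\<And>n k. nowhere_dense_seqs (N n k)" "\<And>n. S n \<subseteq> (\<Union>k. N n k)"
    by metis
  have "(\<Union>n. S n) \<subseteq> (\<Union>m. case prod_decode m of (n, k) \<Rightarrow> N n k)"
  proof
    fix x assume "x \<in> (\<Union>n. S n)"
    then obtain n k where "x \<in> N n k" using N(2) by blast
    then show "x \<in> (\<Union>m. case prod_decode m of (n, k) \<Rightarrow> N n k)"
      by (intro UN_I[of "prod_encode (n, k)"]) auto
  qed
  then show ?thesis unfolding meager_seqs_def
    using N(1) by (intro exI[of _ "\<lambda>m. case prod_decode m of (n, k) \<Rightarrow> N n k"]) (auto split: prod.split)
qed

lemma meager_UN: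
  fixes S :: "'i::countable \<Rightarrow> (nat \<Rightarrow> 'a) set"
  assumes "\<And>i. meager_seqs (S i)"
  shows "meager_seqs (\<Union>i. S i)"
proof -
  have "(\<Union>i. S i) \<subseteq> (\<Union>n. S (from_nat n))"
  proof
    fix x assume "x \<in> (\<Union>i. S i)"
    then obtain i where "x \<in> S i" by blast
    then have "x \<in> S (from_nat (to_nat i))" by simp
    then show "x \<in> (\<Union>n. S (from_nat n))" by blast
  qed
  then show ?thesis by (meson meager_subset meager_UN_nat assms)
qed

lemma meager_Un: "meager_seqs S \<Longrightarrow> meager_seqs T \<Longrightarrow> meager_seqs (S \<union> T)"
  using meager_UN[of "\<lambda>b. if b then S else T"] by (simp add: UNIV_bool Un_commute)

text \<open>Over a countable alphabet this is the largest open set in which \<open>S\<close> is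
  meager. Its complement is a closed hull that covers \<open>S\<close> up to a meager set.\<close>

definition meager_part :: "(nat \<Rightarrow> 'a) set \<Rightarrow> (nat \<Rightarrow> 'a) set" where
  "meager_part S = \<Union>{cylinder s | s. meager_seqs (S \<inter> cylinder s)}"

text \<open>There are only countably many words, so the union over all cylinders in which
  \<open>S\<close> is meager is a countable one.\<close>

lemma meager_Int_meager_part:
  fixes S :: "(nat \<Rightarrow> 'a::countable) set"
  shows "meager_seqs (S \<inter> meager_part S)"
proof -
  have "meager_seqs (\<Union>s. if meager_seqs (S \<inter> cylinder s) then S \<inter> cylinder s else {})"
    by (rule meager_UN) (auto simp: nowhere_dense_seqs_def intro: nowhere_dense_meager)
  moreover have "S \<inter> meager_part S \<subseteq> (\<Union>s. if meager_seqs (S \<inter> cylinder s) then S \<inter> cylinder s else {})"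
    by (auto simp: meager_part_def)
  ultimately show ?thesis by (rule meager_subset)
qed

text \<open>A closed set without interior is nowhere dense, here relative to a cylinder: a point of
  the open set \<open>meager_part S\<close> brings a whole cylinder with it.\<close>

lemma nowhere_dense_if_no_cylinder:
  assumes "\<And>t. \<not> cylinder (s @ t) \<subseteq> - meager_part S"
  shows "nowhere_dense_seqs (cylinder s - meager_part S)"
  unfolding nowhere_dense_seqs_def
proof
  fix u
  show "\<exists>t. cylinder (u @ t) \<inter> (cylinder s - meager_part S) = {}"
  proof (cases "cylinder u \<inter> cylinder s = {}")
    case True
    then show ?thesis by (intro exI[of _ "[]"]) auto
  next
    case False
    then obtain x where x: "x \<in> cylinder u" "x \<in> cylinder s" by blast
    define n where "n = max (length u) (length s)"
    have "map x [0..<n] = s @ map x [length s..<n]" "map x [0..<n] = u @ map x [length u..<n]"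
      using x by (auto simp: n_def intro!: cylinder_split)
    with assms[of "map x [length s..<n]"]
    obtain y where y: "y \<in> cylinder (map x [0..<n])" "y \<in> meager_part S"
      by auto
    then obtain r where r: "y \<in> cylinder r" "meager_seqs (S \<inter> cylinder r)"
      by (auto simp: meager_part_def)
    define k where "k = max n (length r)"
    have "y \<in> cylinder u" using y(1) \<open>map x [0..<n] = u @ map x [length u..<n]\<close> cylinder_append_subset by fastforce
    then have 1: "map y [0..<k] = u @ map y [length u..<k]"
      by (rule cylinder_split) (auto simp: k_def n_def)
    have 2: "map y [0..<k] = r @ map y [length r..<k]"
      using r(1) by (rule cylinder_split) (auto simp: k_def)
    have "cylinder (u @ map y [length u..<k]) \<subseteq> cylinder r"
      using 1 2 cylinder_append_subset by metis
    also have "\<dots> \<subseteq> meager_part S" using r(2) by (auto simp: meager_part_def)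
    finally show ?thesis by blast
  qed
qed

lemma nowhere_dense_compl_meager_part:
  assumes "\<And>t. \<not> cylinder t \<subseteq> - meager_part S"
  shows "nowhere_dense_seqs (- meager_part S)"
proof -
  have "cylinder [] = (UNIV :: (nat \<Rightarrow> 'a) set)" by (auto simp: mem_cylinder)
  then show ?thesis
    using nowhere_dense_if_no_cylinder[of "[]" S] assms by (simp add: Compl_eq_Diff_UNIV)
qed

text \<open>The hull of a union is covered by the hulls of the pieces, up to a meager set. The
  boundary of the hull of \<open>A\<close> is nowhere dense. Inside its interior \<open>W\<close>,
  \<open>A\<close> is nonmeager in every cylinder, so some \<open>B n\<close> is nonmeager
  throughout a smaller one.\<close>

lemma meager_compl_meager_part_Diff:
  fixes A :: "(nat \<Rightarrow> 'a::countable) set" and B :: "nat \<Rightarrow> (nat \<Rightarrow> 'a) set"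
  assumes sub: "A \<subseteq> (\<Union>n. B n)"
  shows "meager_seqs (- meager_part A - (\<Union>n. - meager_part (B n)))"
proof -
  define W where "W = \<Union>{cylinder s | s. cylinder s \<subseteq> - meager_part A}"
  have bd: "nowhere_dense_seqs (- meager_part A - W)"
    unfolding nowhere_dense_seqs_def
  proof
    fix s
    show "\<exists>t. cylinder (s @ t) \<inter> (- meager_part A - W) = {}"
    proof (cases "cylinder s \<subseteq> - meager_part A")
      case True
      then show ?thesis by (intro exI[of _ "[]"]) (auto simp: W_def)
    next
      case False
      then obtain y r where y: "y \<in> cylinder s" "y \<in> cylinder r" "meager_seqs (A \<inter> cylinder r)"
        by (auto simp: meager_part_def)
      define k where "k = max (length s) (length r)"
      have 1: "map y [0..<k] = s @ map y [length s..<k]"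
        using y(1) by (rule cylinder_split) (auto simp: k_def)
      have 2: "map y [0..<k] = r @ map y [length r..<k]"
        using y(2) by (rule cylinder_split) (auto simp: k_def)
      have "cylinder (s @ map y [length s..<k]) \<subseteq> cylinder r"
        using 1 2 cylinder_append_subset by metis
      also have "\<dots> \<subseteq> meager_part A" using y(3) by (auto simp: meager_part_def)
      finally show ?thesis by blast
    qed
  qed
  have int: "nowhere_dense_seqs (W - (\<Union>n. - meager_part (B n)))"
    unfolding nowhere_dense_seqs_def
  proof
    fix s
    show "\<exists>t. cylinder (s @ t) \<inter> (W - (\<Union>n. - meager_part (B n))) = {}"
    proof (cases "cylinder s \<inter> W = {}")
      case True
      then show ?thesis by (intro exI[of _ "[]"]) auto
    next
      case False
      then obtain y r where y: "y \<in> cylinder s" "y \<in> cylinder r" "cylinder r \<subseteq> - meager_part A"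
        by (auto simp: W_def)
      define k where "k = max (length s) (length r)"
      define v where "v = map y [length s..<k]"
      have 1: "map y [0..<k] = s @ v"
        unfolding v_def using y(1) by (rule cylinder_split) (auto simp: k_def)
      have 2: "map y [0..<k] = r @ map y [length r..<k]"
        using y(2) by (rule cylinder_split) (auto simp: k_def)
      have sub_r: "cylinder (s @ v) \<subseteq> - meager_part A"
        using 1 2 cylinder_append_subset y(3) by (metis order_trans)
      have "\<exists>n t. cylinder ((s @ v) @ t) \<subseteq> - meager_part (B n)"
      proof (rule ccontr)
        assume "\<not> ?thesis"
        then have "\<And>n. nowhere_dense_seqs (cylinder (s @ v) - meager_part (B n))"
          by (intro nowhere_dense_if_no_cylinder) blast
        then have "meager_seqs (\<Union>n. (cylinder (s @ v) - meager_part (B n)) \<union> (B n \<inter> meager_part (B n)))"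
          by (intro meager_UN meager_Un meager_Int_meager_part nowhere_dense_meager)
        moreover have "A \<inter> cylinder (s @ v)
            \<subseteq> (\<Union>n. (cylinder (s @ v) - meager_part (B n)) \<union> (B n \<inter> meager_part (B n)))"
          using sub by blast
        ultimately have "meager_seqs (A \<inter> cylinder (s @ v))" by (rule meager_subset)
        then have "cylinder (s @ v) \<subseteq> meager_part A" by (auto simp: meager_part_def)
        with sub_r cylinder_nonempty[of "s @ v"] show False by blast
      qed
      then obtain n t where "cylinder (s @ (v @ t)) \<subseteq> - meager_part (B n)" by auto
      then show ?thesis by (intro exI[of _ "v @ t"]) blast
    qed
  qed
  have "meager_seqs ((- meager_part A - W) \<union> (W - (\<Union>n. - meager_part (B n))))"
    using bd int by (intro meager_Un nowhere_dense_meager)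
  then show ?thesis by (rule meager_subset) blast
qed

text \<open>
  This is the Baire property of analytic sets. A witness \<open>w\<close> is known through countably many
  natural-number labels, which play the role of a point of the Baire space. The closed sets
  \<open>- meager_part (A s)\<close> are compared along the tree of label sequences \<open>s\<close>.
\<close>

lemma nonmeager_labelled_relation:
  fixes W :: "(nat \<Rightarrow> 'a::countable) \<Rightarrow> 'w \<Rightarrow> bool" and lab :: "nat \<Rightarrow> 'w \<Rightarrow> nat"
  assumes closed: "\<And>x xs ws v. (\<And>n. W (xs n) (ws n)) \<Longrightarrow> (\<And>n i. i < n \<Longrightarrow> xs n i = x i) \<Longrightarrow>
      (\<And>n i. i < n \<Longrightarrow> lab i (ws n) = v i) \<Longrightarrow> \<exists>w. W x w"
    and nonmeager: "\<not> meager_seqs {x. \<exists>w. W x w}"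
  shows "\<exists>s. meager_seqs {x \<in> cylinder s. \<nexists>w. W x w}"
proof -
  \<comment> \<open>The sets \<open>A r\<close> form the Souslin scheme of the projection:
    \<open>r\<close> prescribes the first labels of a witness.\<close>
  define A where "A r = {x. \<exists>w. W x w \<and> (\<forall>i<length r. lab i w = r ! i)}" for r
  have A_sub: "A r \<subseteq> (\<Union>n. A (r @ [n]))" for r
  proof
    fix x assume "x \<in> A r"
    then obtain w where w: "W x w" "\<forall>i<length r. lab i w = r ! i" by (auto simp: A_def)
    then have "x \<in> A (r @ [lab (length r) w])"
      by (auto simp: A_def nth_append less_Suc_eq intro!: exI[of _ w])
    then show "x \<in> (\<Union>n. A (r @ [n]))" by blast
  qed
  define D where "D r = - meager_part (A r)" for r
  define Bad where "Bad = (\<Union>r. D r - (\<Union>n. D (r @ [n])))"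
  have Bad: "meager_seqs Bad"
    unfolding Bad_def D_def by (intro meager_UN meager_compl_meager_part_Diff A_sub)
  have good: "\<exists>w. W x w" if "x \<in> D []" "x \<notin> Bad" for x
  proof -
    have step: "\<exists>n. x \<in> D (r @ [n])" if "x \<in> D r" for r
      using that \<open>x \<notin> Bad\<close> by (auto simp: Bad_def)
    define br where "br = rec_nat [] (\<lambda>_ r. r @ [SOME n. x \<in> D (r @ [n])])"
    have br_Suc: "br (Suc n) = br n @ [SOME k. x \<in> D (br n @ [k])]" and br0: "br 0 = []" for n
      by (simp_all add: br_def)
    have brD: "x \<in> D (br n)" for n
      by (induction n) (auto simp: br0 br_Suc \<open>x \<in> D []\<close> intro: someI_ex[OF step])
    have len: "length (br n) = n" for n by (induction n) (auto simp: br0 br_Suc)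
    define v where "v i = br (Suc i) ! i" for i
    have nth: "br n ! i = v i" if "i < n" for n i
      using that
    proof (induction n)
      case (Suc n)
      then show ?case using len by (cases "i = n") (auto simp: br_Suc nth_append v_def)
    qed simp
    \<comment> \<open>A point of the hull of \<open>A (br n)\<close> has members of that set in each
      of its neighbourhoods. They converge to \<open>x\<close>, and the labels of their witnesses
      stabilise to the branch \<open>v\<close>, which is what \<open>closed\<close> asks
      for.\<close>
    have "\<exists>y w. W y w \<and> (\<forall>i<n. y i = x i) \<and> (\<forall>i<n. lab i w = v i)" for n
    proof -
      have "\<not> meager_seqs (A (br n) \<inter> cylinder (map x [0..<n]))"
      proof
        assume "meager_seqs (A (br n) \<inter> cylinder (map x [0..<n]))"
        moreover have "x \<in> cylinder (map x [0..<n])" by (simp add: mem_cylinder)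
        ultimately have "x \<in> meager_part (A (br n))" by (auto simp: meager_part_def)
        with brD[of n] show False by (simp add: D_def)
      qed
      then have "A (br n) \<inter> cylinder (map x [0..<n]) \<noteq> {}"
        using nowhere_dense_meager[of "{}"] by (auto simp: nowhere_dense_seqs_def)
      then obtain y w where "W y w" "\<forall>i<n. y i = x i" "\<forall>i<n. lab i w = br n ! i"
        by (auto simp: A_def mem_cylinder len)
      then show ?thesis using nth by (metis (no_types))
    qed
    then obtain ys ws where "\<And>n. W (ys n) (ws n)" "\<And>n i. i < n \<Longrightarrow> ys n i = x i"
      "\<And>n i. i < n \<Longrightarrow> lab i (ws n) = v i" by metis
    then show ?thesis by (rule closed)
  qed
  have "\<exists>s. cylinder s \<subseteq> D []"
  proof (rule ccontr)
    assume "\<not> ?thesis"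
    then have "nowhere_dense_seqs (D [])" unfolding D_def by (intro nowhere_dense_compl_meager_part) blast
    then have "meager_seqs (D [] \<union> (A [] \<inter> meager_part (A [])))"
      by (intro meager_Un meager_Int_meager_part nowhere_dense_meager)
    moreover have "{x. \<exists>w. W x w} \<subseteq> D [] \<union> (A [] \<inter> meager_part (A []))"
      by (auto simp: A_def D_def)
    ultimately show False using nonmeager meager_subset by blast
  qed
  then obtain s where "cylinder s \<subseteq> D []" by blast
  then have "{x \<in> cylinder s. \<nexists>w. W x w} \<subseteq> Bad" using good by blast
  then show ?thesis using Bad meager_subset by blast
qed

section \<open>Meager sets and block patterns\<close>

lemma common_extension_avoiding:
  assumes "finite F" "\<And>p. p \<in> F \<Longrightarrow> nowhere_dense_seqs (snd p)"
  shows "\<exists>t. \<forall>p\<in>F. cylinder (fst p @ t) \<inter> snd p = {}"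
  using assms
proof (induction F)
  case (insert p F)
  then obtain t where t: "\<forall>p\<in>F. cylinder (fst p @ t) \<inter> snd p = {}" by auto
  obtain u where u: "cylinder ((fst p @ t) @ u) \<inter> snd p = {}"
    using insert.prems[of p] unfolding nowhere_dense_seqs_def by blast
  have "cylinder (fst q @ (t @ u)) \<inter> snd q = {}" if "q \<in> F" for q
    using t that cylinder_append_subset[of "fst q @ t" u] by fastforce
  with u show ?case by (intro exI[of _ "t @ u"]) auto
qed simp

text \<open>The combinatorial description of meager sets over a finite alphabet. Block
  \<open>n\<close> contains an extension that avoids the first \<open>n\<close> nowhere dense sets
  after every prefix of length \<open>l n\<close>, so it works whatever the point does
  earlier.\<close>

lemma meager_avoided_by_pattern:
  fixes M :: "(nat \<Rightarrow> 'a::finite) set"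
  assumes "meager_seqs M"
  shows "\<exists>a l. strict_mono (l :: nat \<Rightarrow> nat) \<and>
    (\<forall>x. (\<exists>\<^sub>\<infinity>n. \<forall>i\<in>{l n..<l (Suc n)}. x i = a i) \<longrightarrow> x \<notin> M)"
proof -
  obtain N :: "nat \<Rightarrow> _" where N: "\<And>n. nowhere_dense_seqs (N n)" "M \<subseteq> (\<Union>n. N n)"
    using assms unfolding meager_seqs_def by blast
  \<comment> \<open>A finite alphabet has finitely many words of length \<open>m\<close>, so one
    extension can serve them all.\<close>
  have "\<exists>t. \<forall>s k. length s = m \<and> k < n \<longrightarrow> cylinder (s @ t) \<inter> N k = {}" for m n
  proof -
    have "finite ({s :: 'a list. length s = m} \<times> N ` {..<n})"
      using finite_lists_length_eq[of "UNIV :: 'a set" m] by simp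
    from common_extension_avoiding[OF this] obtain t
      where "\<forall>p\<in>{s :: 'a list. length s = m} \<times> N ` {..<n}. cylinder (fst p @ t) \<inter> snd p = {}"
      using N(1) by fastforce
    then show ?thesis by fastforce
  qed
  then obtain t where t: "\<And>m n s k. length s = m \<Longrightarrow> k < n \<Longrightarrow> cylinder (s @ t m n) \<inter> N k = {}"
    by metis
  \<comment> \<open>The extension may be empty; the padding letter makes \<open>l\<close> strictly
    increasing.\<close>
  define c where "c = rec_nat [] (\<lambda>n s. (s @ t (length s) n) @ [undefined])"
  have c_Suc: "c (Suc n) = (c n @ t (length (c n)) n) @ [undefined]" for n by (simp add: c_def)
  define l where "l n = length (c n)" for n
  define a where "a i = c (Suc i) ! i" for i
  have l_Suc: "l (Suc n) = l n + length (t (l n) n) + 1" for n by (simp add: l_def c_Suc)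
  have sm: "strict_mono l" by (rule strict_monoI_Suc) (simp add: l_Suc)
  have ext: "\<exists>u. c (n + k) = c n @ u" for n k
    by (induction k) (auto simp: c_Suc)
  have a_nth: "c n ! i = a i" if "i < l n" for i n
  proof -
    have "i < l (Suc i)" using sm by (metis strict_mono_imp_increasing lessI less_le_trans)
    obtain u v where "c (max n (Suc i)) = c n @ u" "c (max n (Suc i)) = c (Suc i) @ v"
      using ext[of n "max n (Suc i) - n"] ext[of "Suc i" "max n (Suc i) - Suc i"] by auto
    then have "c n @ u = c (Suc i) @ v" by simp
    then have "(c n @ u) ! i = (c (Suc i) @ v) ! i" by simp
    then show ?thesis using that \<open>i < l (Suc i)\<close> by (simp add: nth_append l_def a_def)
  qed
  have "x \<notin> M" if x: "\<exists>\<^sub>\<infinity>n. \<forall>i\<in>{l n..<l (Suc n)}. x i = a i" for x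
  proof
    assume "x \<in> M"
    then obtain k where k: "x \<in> N k" using N(2) by blast
    obtain n where n: "n > k" "\<forall>i\<in>{l n..<l (Suc n)}. x i = a i"
      using x by (auto simp: INFM_nat)
    have "x \<in> cylinder (map x [0..<l n] @ t (l n) n)"
      unfolding mem_cylinder
    proof (intro allI impI)
      fix i assume i: "i < length (map x [0..<l n] @ t (l n) n)"
      show "x i = (map x [0..<l n] @ t (l n) n) ! i"
      proof (cases "i < l n")
        case False
        with i have "i < l (Suc n)" by (simp add: l_Suc)
        then have "x i = c (Suc n) ! i" using n(2) False a_nth by simp
        also have "\<dots> = t (l n) n ! (i - l n)"
        proof -
          have "i - l n < length (t (l n) n)" using False i by simp
          then show ?thesis using False by (simp add: c_Suc nth_append l_def)
        qed
        finally show ?thesis using False by (simp add: nth_append)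
      qed (simp add: nth_append)
    qed
    with t[of "map x [0..<l n]" "l n" k n] n(1) k show False by auto
  qed
  with sm show ?thesis by blast
qed

subsection \<open>Isomorphisms of subspaces\<close>

notation isomorphic_spaces (infix "\<simeq>" 50)

definition bdd_linear_on ::
    "'a::real_normed_vector set \<Rightarrow> 'b::real_normed_vector set \<Rightarrow> ('a \<Rightarrow> 'b) \<Rightarrow> bool" where
  "bdd_linear_on U V f \<longleftrightarrow> f ` U \<subseteq> V \<and> (\<forall>x\<in>U. \<forall>y\<in>U. f (x + y) = f x + f y) \<and>
     (\<forall>c. \<forall>x\<in>U. f (c *\<^sub>R x) = c *\<^sub>R f x) \<and> (\<exists>K. \<forall>x\<in>U. norm (f x) \<le> K * norm x)"

lemma bdd_linear_onD:
  assumes "bdd_linear_on U V f"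
  shows "x \<in> U \<Longrightarrow> f x \<in> V" "x \<in> U \<Longrightarrow> y \<in> U \<Longrightarrow> f (x + y) = f x + f y"
    "x \<in> U \<Longrightarrow> f (c *\<^sub>R x) = c *\<^sub>R f x"
  using assms by (auto simp: bdd_linear_on_def)

lemma bdd_linear_on_bound:
  assumes "bdd_linear_on U V f"
  obtains K where "K > 0" "\<And>x. x \<in> U \<Longrightarrow> norm (f x) \<le> K * norm x"
proof -
  obtain K where K: "\<forall>x\<in>U. norm (f x) \<le> K * norm x" using assms by (auto simp: bdd_linear_on_def)
  have "norm (f x) \<le> (\<bar>K\<bar> + 1) * norm x" if "x \<in> U" for x
  proof -
    have "K * norm x \<le> (\<bar>K\<bar> + 1) * norm x" by (rule mult_right_mono) auto
    with K that show ?thesis by force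
  qed
  then show thesis using that[of "\<bar>K\<bar> + 1"] by auto
qed

lemma bdd_linear_onI:
  assumes "\<And>x. x \<in> U \<Longrightarrow> f x \<in> V" "\<And>x y. x \<in> U \<Longrightarrow> y \<in> U \<Longrightarrow> f (x + y) = f x + f y"
    "\<And>c x. x \<in> U \<Longrightarrow> f (c *\<^sub>R x) = c *\<^sub>R f x" "\<And>x. x \<in> U \<Longrightarrow> norm (f x) \<le> K * norm x"
  shows "bdd_linear_on U V f"
  using assms unfolding bdd_linear_on_def by blast

lemma bdd_linear_on_diff:
  assumes "bdd_linear_on U V f" "subspace U" "x \<in> U" "y \<in> U"
  shows "f (x - y) = f x - f y"
proof -
  have "f (x + (-1) *\<^sub>R y) = f x + (-1) *\<^sub>R f y"
    using assms bdd_linear_onD[OF assms(1)] by (metis subspace_scale)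
  then show ?thesis by simp
qed

lemma bdd_linear_on_zero: "bdd_linear_on U V f \<Longrightarrow> subspace U \<Longrightarrow> f 0 = 0"
  using bdd_linear_on_diff[of U V f 0 0] by (simp add: subspace_0)

lemma bdd_linear_on_compose:
  assumes f: "bdd_linear_on U V f" and g: "bdd_linear_on V W g"
  shows "bdd_linear_on U W (\<lambda>x. g (f x))"
proof -
  obtain K where K: "K > 0" "\<And>x. x \<in> U \<Longrightarrow> norm (f x) \<le> K * norm x"
    using bdd_linear_on_bound[OF f] by blast
  obtain L where L: "L > 0" "\<And>x. x \<in> V \<Longrightarrow> norm (g x) \<le> L * norm x"
    using bdd_linear_on_bound[OF g] by blast
  have "norm (g (f x)) \<le> (L * K) * norm x" if "x \<in> U" for x
  proof -
    have "norm (g (f x)) \<le> L * norm (f x)" using L bdd_linear_onD(1)[OF f that] by blast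
    also have "\<dots> \<le> L * (K * norm x)" using K that L(1) by simp
    finally show ?thesis by (simp add: mult.assoc)
  qed
  then show ?thesis
    by (intro bdd_linear_onI) (auto simp: bdd_linear_onD[OF f] bdd_linear_onD[OF g])
qed

lemma bdd_linear_on_mono: "bdd_linear_on U V f \<Longrightarrow> U' \<subseteq> U \<Longrightarrow> f ` U' \<subseteq> V' \<Longrightarrow> bdd_linear_on U' V' f"
  unfolding bdd_linear_on_def by (meson subsetD)

lemma bdd_linear_on_continuous:
  assumes f: "bdd_linear_on U V f" and U: "subspace U"
  shows "continuous_on U f"
proof -
  obtain K where K: "K > 0" "\<And>x. x \<in> U \<Longrightarrow> norm (f x) \<le> K * norm x"
    using bdd_linear_on_bound[OF f] by blast
  have "dist (f x) (f y) \<le> K * dist x y" if "x \<in> U" "y \<in> U" for x y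
    using K(2)[of "x - y"] that U bdd_linear_on_diff[OF f U that]
    by (simp add: dist_norm subspace_diff)
  then have "K-lipschitz_on U f" using K(1) by (intro lipschitz_onI) auto
  then show ?thesis by (rule lipschitz_on_continuous_on)
qed

lemma bdd_linear_on_if_continuous:
  assumes lin: "\<And>x y. x \<in> U \<Longrightarrow> y \<in> U \<Longrightarrow> f (x + y) = f x + f y"
      "\<And>c x. x \<in> U \<Longrightarrow> f (c *\<^sub>R x) = c *\<^sub>R f x"
    and V: "\<And>x. x \<in> U \<Longrightarrow> f x \<in> V" and U: "subspace U" and cont: "continuous_on U f"
  shows "bdd_linear_on U V f"
proof -
  have 0: "0 \<in> U" "f 0 = 0" using U lin(2)[of 0 0] by (auto simp: subspace_0)
  obtain d where d: "d > 0" "\<And>x. x \<in> U \<Longrightarrow> norm x < d \<Longrightarrow> norm (f x) < 1"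
    using cont 0 unfolding continuous_on_iff by (metis dist_0_norm dist_commute zero_less_one)
  have "norm (f x) \<le> (2 / d) * norm x" if x: "x \<in> U" for x
  proof (cases "x = 0")
    case False
    define c where "c = d / 2 / norm x"
    have c: "c > 0" using False d(1) by (simp add: c_def)
    have "norm (c *\<^sub>R x) < d" using d(1) False by (simp add: c_def)
    then have "norm (f (c *\<^sub>R x)) < 1" using U x d(2) subspace_scale by blast
    then have "c * norm (f x) < 1" using x c by (simp add: lin(2))
    then have "norm (f x) < 1 / c" using c by (simp add: field_simps)
    also have "1 / c = (2 / d) * norm x" using d(1) False by (simp add: c_def)
    finally show ?thesis by simp
  qed (use 0 in simp)
  then show ?thesis using lin V by (intro bdd_linear_onI[where K = "2 / d"])
qed

lemma isomorphic_spacesI: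
  assumes "bdd_linear_on U V f" "bdd_linear_on V U g" "subspace U" "subspace V"
    "\<And>x. x \<in> U \<Longrightarrow> g (f x) = x" "\<And>y. y \<in> V \<Longrightarrow> f (g y) = y"
  shows "U \<simeq> V"
proof -
  have "homeomorphism U V f g"
    using assms bdd_linear_on_continuous[OF assms(1,3)] bdd_linear_on_continuous[OF assms(2,4)]
    by (intro homeomorphismI) (auto dest: bdd_linear_onD(1))
  then show ?thesis
    using bdd_linear_onD[OF assms(1)] unfolding isomorphic_spaces_def by blast
qed

text \<open>The definition requires linearity of \<open>f\<close> alone and nothing of
  \<open>V\<close>. Since \<open>V\<close> is the image of \<open>U\<close>, the inverse is linear
  and \<open>V\<close> is a subspace; continuity at 0 then gives the bounds.\<close>

lemma isomorphic_spacesE: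
  assumes "U \<simeq> V" "subspace U"
  obtains f g where "bdd_linear_on U V f" "bdd_linear_on V U g" "subspace V"
    "\<And>x. x \<in> U \<Longrightarrow> g (f x) = x" "\<And>y. y \<in> V \<Longrightarrow> f (g y) = y"
proof -
  obtain f g where f: "\<And>x y. x \<in> U \<Longrightarrow> y \<in> U \<Longrightarrow> f (x + y) = f x + f y"
      "\<And>c x. x \<in> U \<Longrightarrow> f (c *\<^sub>R x) = c *\<^sub>R f x" and h: "homeomorphism U V f g"
    using assms unfolding isomorphic_spaces_def by blast
  have hD: "f ` U = V" "g ` V = U" "\<And>x. x \<in> U \<Longrightarrow> g (f x) = x" "\<And>y. y \<in> V \<Longrightarrow> f (g y) = y"
    "continuous_on U f" "continuous_on V g"
    using h by (auto simp: homeomorphism_def)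
  have gU: "g y \<in> U" if "y \<in> V" for y using that hD by blast
  have g: "g (x + y) = g x + g y" "x + y \<in> V" if "x \<in> V" "y \<in> V" for x y
  proof -
    have *: "g x + g y \<in> U" using that gU assms(2) by (simp add: subspace_add)
    have "f (g x + g y) = x + y" using that gU f hD by simp
    with hD(3)[OF *] imageI[OF *, of f] show "g (x + y) = g x + g y" "x + y \<in> V"
      by (simp_all add: hD(1))
  qed
  have gs: "g (c *\<^sub>R y) = c *\<^sub>R g y" "c *\<^sub>R y \<in> V" if "y \<in> V" for y c
  proof -
    have *: "c *\<^sub>R g y \<in> U" using that gU assms(2) by (simp add: subspace_scale)
    have "f (c *\<^sub>R g y) = c *\<^sub>R y" using that gU f hD by simp
    with hD(3)[OF *] imageI[OF *, of f] show "g (c *\<^sub>R y) = c *\<^sub>R g y" "c *\<^sub>R y \<in> V"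
      by (simp_all add: hD(1))
  qed
  have "f 0 \<in> V" "f 0 = 0" using hD(1) subspace_0[OF assms(2)] f(2)[of 0 0] by auto
  then have "0 \<in> V" by simp
  then have V: "subspace V" using g(2) gs(2) by (auto simp: subspace_def)
  have "bdd_linear_on U V f" using f hD assms(2) by (intro bdd_linear_on_if_continuous) auto
  moreover have "bdd_linear_on V U g" using g gs gU hD V by (intro bdd_linear_on_if_continuous) auto
  ultimately show thesis using that V hD by blast
qed

lemma bdd_linear_on_image_subspace:
  assumes T: "bdd_linear_on Y X T" and Y: "subspace Y" and E: "subspace E" "E \<subseteq> Y"
  shows "subspace (T ` E)"
proof (rule subspaceI)
  note TD = bdd_linear_onD[OF T]
  show "0 \<in> T ` E" using bdd_linear_on_zero[OF T Y] subspace_0[OF E(1)] by (metis image_eqI)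
  show "x + y \<in> T ` E" if xy: "x \<in> T ` E" "y \<in> T ` E" for x y
  proof -
    obtain u v where uv: "x = T u" "u \<in> E" "y = T v" "v \<in> E" using xy by blast
    then have "u \<in> Y" "v \<in> Y" using E(2) by auto
    with uv have "x + y = T (u + v)" using TD(2)[of u v] by simp
    moreover have "u + v \<in> E" using uv E(1) by (simp add: subspace_add)
    ultimately show ?thesis by blast
  qed
  show "c *\<^sub>R x \<in> T ` E" if x: "x \<in> T ` E" for x c
  proof -
    obtain u where u: "x = T u" "u \<in> E" using x by blast
    then have "c *\<^sub>R x = T (c *\<^sub>R u)" using E(2) TD(3)[of u c] by auto
    moreover have "c *\<^sub>R u \<in> E" using u E(1) by (simp add: subspace_scale)
    ultimately show ?thesis by blast
  qed
qed

lemma isomorphic_refl: "U \<simeq> U"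
  unfolding isomorphic_spaces_def by (intro exI[of _ "\<lambda>x. x"]) (auto intro!: homeomorphismI continuous_intros)

lemma isomorphic_sym: "U \<simeq> V \<Longrightarrow> subspace U \<Longrightarrow> V \<simeq> U"
  by (erule isomorphic_spacesE) (auto intro: isomorphic_spacesI)

lemma isomorphic_trans [trans]:
  assumes "U \<simeq> V" "V \<simeq> W"
  shows "U \<simeq> W"
proof -
  obtain f g where f: "\<forall>x\<in>U. \<forall>y\<in>U. f (x + y) = f x + f y" "\<forall>c. \<forall>x\<in>U. f (c *\<^sub>R x) = c *\<^sub>R f x"
    "homeomorphism U V f g" using assms(1) unfolding isomorphic_spaces_def by blast
  obtain f' g' where f': "\<forall>x\<in>V. \<forall>y\<in>V. f' (x + y) = f' x + f' y" "\<forall>c. \<forall>x\<in>V. f' (c *\<^sub>R x) = c *\<^sub>R f' x"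
    "homeomorphism V W f' g'" using assms(2) unfolding isomorphic_spaces_def by blast
  have "f x \<in> V" if "x \<in> U" for x using f(3) that by (auto simp: homeomorphism_def)
  then show ?thesis unfolding isomorphic_spaces_def
    using f f' homeomorphism_compose[OF f(3) f'(3)]
    by (intro exI[of _ "f' \<circ> f"] exI[of _ "g \<circ> g'"]) auto
qed

lemma isomorphic_subspace: "U \<simeq> V \<Longrightarrow> subspace U \<Longrightarrow> subspace V"
  by (erule isomorphic_spacesE)

lemma isomorphic_Times:
  assumes "U \<simeq> V" "U' \<simeq> V'"
  shows "U \<times> U' \<simeq> V \<times> V'"
proof -
  obtain f g where f: "\<forall>x\<in>U. \<forall>y\<in>U. f (x + y) = f x + f y" "\<forall>c. \<forall>x\<in>U. f (c *\<^sub>R x) = c *\<^sub>R f x"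
    "homeomorphism U V f g" using assms(1) unfolding isomorphic_spaces_def by blast
  obtain f' g' where f': "\<forall>x\<in>U'. \<forall>y\<in>U'. f' (x + y) = f' x + f' y"
    "\<forall>c. \<forall>x\<in>U'. f' (c *\<^sub>R x) = c *\<^sub>R f' x"
    "homeomorphism U' V' f' g'" using assms(2) unfolding isomorphic_spaces_def by blast
  have c: "continuous_on U f" "continuous_on V g" "continuous_on U' f'" "continuous_on V' g'"
    using f(3) f'(3) by (auto simp: homeomorphism_def)
  have 1: "continuous_on (U \<times> U') (\<lambda>p. (f (fst p), f' (snd p)))"
    by (intro continuous_on_Pair continuous_on_compose2[OF c(1)] continuous_on_compose2[OF c(3)]
        continuous_intros) auto
  have 2: "continuous_on (V \<times> V') (\<lambda>p. (g (fst p), g' (snd p)))"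
    by (intro continuous_on_Pair continuous_on_compose2[OF c(2)] continuous_on_compose2[OF c(4)]
        continuous_intros) auto
  have "homeomorphism (U \<times> U') (V \<times> V') (\<lambda>p. (f (fst p), f' (snd p))) (\<lambda>p. (g (fst p), g' (snd p)))"
    using f(3) f'(3) by (intro homeomorphismI 1 2) (auto simp: homeomorphism_def)
  then show ?thesis unfolding isomorphic_spaces_def
    using f f' by (intro exI[of _ "\<lambda>p. (f (fst p), f' (snd p))"] exI) auto
qed

lemma isomorphic_Times_commute: "U \<times> V \<simeq> V \<times> U"
  unfolding isomorphic_spaces_def
  by (intro exI[of _ "\<lambda>p. (snd p, fst p)"] conjI homeomorphismI) (auto intro!: continuous_intros)

lemma isomorphic_Times_assoc: "(U \<times> V) \<times> W \<simeq> U \<times> (V \<times> W)"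
  unfolding isomorphic_spaces_def
  by (intro exI[of _ "\<lambda>p. (fst (fst p), (snd (fst p), snd p))"] exI[of _ "\<lambda>p. ((fst p, fst (snd p)), snd (snd p))"]
      conjI homeomorphismI) (auto intro!: continuous_intros)

lemma isomorphic_Times_assoc': "U \<times> (V \<times> W) \<simeq> (U \<times> V) \<times> W"
  unfolding isomorphic_spaces_def
  by (intro exI[of _ "\<lambda>p. (fst (fst p), (snd (fst p), snd p))"] exI[of _ "\<lambda>p. ((fst p, fst (snd p)), snd (snd p))"]
      conjI homeomorphismI) (auto intro!: continuous_intros)

lemma isomorphic_Times_zero: "U \<times> {0} \<simeq> U"
  unfolding isomorphic_spaces_def
  by (intro exI[of _ "\<lambda>p. fst p"] exI[of _ "\<lambda>x. (x, 0)"] conjI homeomorphismI) (auto intro!: continuous_intros)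

lemma isomorphic_zero: "{0::'a::real_normed_vector} \<simeq> {0::'b::real_normed_vector}"
  unfolding isomorphic_spaces_def
  by (intro exI[of _ "\<lambda>p. 0"] conjI homeomorphismI) (auto intro!: continuous_intros)

lemma isomorphic_Times_right_commute: "(U \<times> V) \<times> W \<simeq> (U \<times> W) \<times> V"
proof -
  have "(U \<times> V) \<times> W \<simeq> U \<times> (V \<times> W)" by (rule isomorphic_Times_assoc)
  also have "\<dots> \<simeq> U \<times> (W \<times> V)"
    by (intro isomorphic_Times isomorphic_refl isomorphic_Times_commute)
  also have "\<dots> \<simeq> (U \<times> W) \<times> V" by (rule isomorphic_Times_assoc')
  finally show ?thesis .
qed

text \<open>Closedness is no homeomorphism invariant, but completeness passes along because the
  inverse operator is Lipschitz and so preserves Cauchy sequences.\<close>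

lemma isomorphic_complete:
  assumes "U \<simeq> V" "subspace U" "complete U"
  shows "complete V"
proof -
  obtain f g where fg: "bdd_linear_on U V f" "bdd_linear_on V U g" "subspace V"
    "\<And>x. x \<in> U \<Longrightarrow> g (f x) = x" "\<And>y. y \<in> V \<Longrightarrow> f (g y) = y"
    using isomorphic_spacesE[OF assms(1,2)] by blast
  obtain K where K: "K > 0" "\<And>x. x \<in> V \<Longrightarrow> norm (g x) \<le> K * norm x"
    using bdd_linear_on_bound[OF fg(2)] by blast
  show ?thesis unfolding complete_def
  proof (intro allI impI, elim conjE)
    fix s :: "nat \<Rightarrow> 'b" assume s: "\<forall>n. s n \<in> V" "Cauchy s"
    have bd: "dist (g (s m)) (g (s n)) \<le> K * dist (s m) (s n)" for m n
      using K(2)[of "s m - s n"] s fg(3) bdd_linear_on_diff[OF fg(2,3), of "s m" "s n"]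
      by (simp add: dist_norm subspace_diff)
    have "Cauchy (\<lambda>n. g (s n))"
      unfolding Cauchy_def
    proof (intro allI impI)
      fix e :: real assume "e > 0"
      then have "e / K > 0" using K(1) by simp
      then obtain N where N: "\<And>m n. m \<ge> N \<Longrightarrow> n \<ge> N \<Longrightarrow> dist (s m) (s n) < e / K"
        using s(2) unfolding Cauchy_def by metis
      have "dist (g (s m)) (g (s n)) < e" if "m \<ge> N" "n \<ge> N" for m n
        using bd[of m n] N[OF that] K(1) by (simp add: field_simps)
      then show "\<exists>M. \<forall>m\<ge>M. \<forall>n\<ge>M. dist (g (s m)) (g (s n)) < e" by blast
    qed
    moreover have "\<forall>n. g (s n) \<in> U" using s(1) bdd_linear_onD(1)[OF fg(2)] by blast
    ultimately obtain u where u: "u \<in> U" "(\<lambda>n. g (s n)) \<longlonglongrightarrow> u"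
      using assms(3) unfolding complete_def by metis
    have "(\<lambda>n. f (g (s n))) \<longlonglongrightarrow> f u"
      using continuous_on_tendsto_compose[OF bdd_linear_on_continuous[OF fg(1) assms(2)] u(2,1)]
        \<open>\<forall>n. g (s n) \<in> U\<close> by simp
    then have "s \<longlonglongrightarrow> f u" using fg(5) s(1) by simp
    then show "\<exists>l\<in>V. s \<longlonglongrightarrow> l" using u(1) bdd_linear_onD(1)[OF fg(1)] by blast
  qed
qed

lemma isomorphic_closed:
  fixes U :: "'a::banach set" and V :: "'b::banach set"
  assumes "U \<simeq> V" "subspace U" "closed U"
  shows "closed V"
  using isomorphic_complete[OF assms(1,2)] assms(3) by (simp add: complete_eq_closed)

subsection \<open>Topological direct sums\<close>

lemma closed_subspace_UNIV [simp]: "closed_subspace F UNIV \<longleftrightarrow> subspace F \<and> closed F"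
  by (simp add: closed_subspace_def)

text \<open>
  The open mapping theorem for the addition map on \<open>A \<times> B\<close>: Baire category gives an approximate
  bounded decomposition, which is iterated.
\<close>

lemma space_decomposition_approx:
  fixes X :: "'a::banach set"
  assumes X: "subspace X" "closed X" and dec: "space_decomposition X A B"
  shows "\<exists>M. \<forall>x\<in>X. \<exists>a\<in>A. \<exists>b\<in>B. norm a \<le> M * norm x \<and> norm (x - (a + b)) \<le> norm x / 2"
proof -
  have A: "subspace A" and B: "subspace B" and XAB: "X = {a + b | a b. a \<in> A \<and> b \<in> B}"
    using dec by (auto simp: space_decomposition_def closed_subspace_def)
  \<comment> \<open>Bounding only the first component suffices, since the second one is recovered by
    subtraction.\<close>
  define S where "S k = {a + b | a b. a \<in> A \<and> b \<in> B \<and> norm a \<le> real k}" for k :: nat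
  have SX: "S k \<subseteq> X" for k by (auto simp: S_def XAB)
  define T where "T k = X \<inter> closure (S k)" for k
  have "X = \<Union>(range T)"
  proof
    show "X \<subseteq> \<Union>(range T)"
    proof
      fix x assume x: "x \<in> X"
      then obtain a b where ab: "x = a + b" "a \<in> A" "b \<in> B" using XAB by blast
      obtain k :: nat where "norm a \<le> real k" using real_arch_simple by blast
      then have "x \<in> S k" using ab by (auto simp: S_def)
      then show "x \<in> \<Union>(range T)" using x closure_subset by (auto simp: T_def)
    qed
  qed (auto simp: T_def)
  have cm: "completely_metrizable_space (top_of_set X)"
    by (rule completely_metrizable_space_closedin[OF completely_metrizable_space_euclidean])
      (simp add: X)
  have "\<exists>k. top_of_set X interior_of T k \<noteq> {}"
  proof (rule ccontr)
    assume "\<not> ?thesis"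
    then have "top_of_set X interior_of \<Union>(range T) = {}"
      by (intro Baire_category_alt disjI1 cm) (auto simp: T_def closedin_closed_Int)
    moreover have "top_of_set X interior_of X = X"
      using interior_of_topspace[of "top_of_set X"] by simp
    ultimately show False using \<open>X = \<Union>(range T)\<close> subspace_0[OF X(1)] by auto
  qed
  then obtain k x0 where x0: "x0 \<in> top_of_set X interior_of T k" by blast
  then obtain W where W: "openin (top_of_set X) W" "x0 \<in> W" "W \<subseteq> T k"
    by (auto simp: interior_of_def)
  have x0X: "x0 \<in> X" using W by (auto simp: T_def)
  obtain r where r: "r > 0" "\<And>y. y \<in> X \<Longrightarrow> dist y x0 < r \<Longrightarrow> y \<in> closure (S k)"
  proof -
    from W(1,2) obtain r where r: "r > 0" "\<And>y. y \<in> X \<Longrightarrow> dist y x0 < r \<Longrightarrow> y \<in> W"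
      unfolding openin_euclidean_subtopology_iff by blast
    show thesis by (rule that[OF r(1)]) (use r(2) W(3) in \<open>auto simp: T_def\<close>)
  qed
  \<comment> \<open>Approximants of \<open>x0 + x\<close> and of \<open>x0\<close> are subtracted.
    This moves the centre of the ball to 0 and doubles the bound on the first component.\<close>
  have near: "\<exists>a\<in>A. \<exists>b\<in>B. norm a \<le> 2 * real k \<and> norm (x - (a + b)) < e"
    if x: "x \<in> X" "norm x < r" and e: "e > 0" for x e
  proof -
    have "x0 + x \<in> closure (S k)" "x0 \<in> closure (S k)"
      using r x x0X X(1) by (auto simp: dist_norm subspace_add)
    then obtain s1 s2 where s: "s1 \<in> S k" "dist s1 (x0 + x) < e / 2" "s2 \<in> S k" "dist s2 x0 < e / 2"
      using e unfolding closure_approachable by (meson half_gt_zero)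
    obtain a1 b1 a2 b2 where ab: "s1 = a1 + b1" "s2 = a2 + b2" "a1 \<in> A" "a2 \<in> A" "b1 \<in> B" "b2 \<in> B"
      "norm a1 \<le> real k" "norm a2 \<le> real k"
      using s by (auto simp: S_def)
    have "norm (a1 - a2) \<le> 2 * real k" using ab norm_triangle_ineq4[of a1 a2] by linarith
    moreover have "norm (x - ((a1 - a2) + (b1 - b2))) < e"
    proof -
      have "x - ((a1 - a2) + (b1 - b2)) = (s2 - x0) - (s1 - (x0 + x))" using ab by simp
      then have "norm (x - ((a1 - a2) + (b1 - b2))) \<le> dist s2 x0 + dist s1 (x0 + x)"
        by (simp only: dist_norm norm_triangle_ineq4)
      then show ?thesis using s by linarith
    qed
    ultimately show ?thesis using ab A B subspace_diff by metis
  qed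
  have "\<exists>a\<in>A. \<exists>b\<in>B. norm a \<le> (4 * real k / r) * norm x \<and> norm (x - (a + b)) \<le> norm x / 2" if x: "x \<in> X" for x
  proof (cases "x = 0")
    case True
    then show ?thesis using A B by (intro bexI[of _ 0]) (auto simp: subspace_0)
  next
    case False
    define c where "c = r / 2 / norm x"
    have c: "c > 0" using False r(1) by (simp add: c_def)
    have "c *\<^sub>R x \<in> X" "norm (c *\<^sub>R x) < r" "c * norm x / 2 > 0"
      using x X(1) False r(1) c by (auto simp: c_def subspace_scale)
    then obtain a b where ab: "a \<in> A" "b \<in> B" "norm a \<le> 2 * real k"
      "norm (c *\<^sub>R x - (a + b)) < c * norm x / 2" using near by blast
    have "norm ((1 / c) *\<^sub>R a) \<le> (4 * real k / r) * norm x"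
    proof -
      have "norm ((1 / c) *\<^sub>R a) = norm a / c" using c by simp
      also have "\<dots> \<le> 2 * real k / c" using ab c by (simp add: divide_right_mono)
      also have "\<dots> = (4 * real k / r) * norm x" using r(1) False by (simp add: c_def)
      finally show ?thesis .
    qed
    moreover have "norm (x - ((1 / c) *\<^sub>R a + (1 / c) *\<^sub>R b)) \<le> norm x / 2"
    proof -
      have "x - ((1 / c) *\<^sub>R a + (1 / c) *\<^sub>R b) = (1 / c) *\<^sub>R (c *\<^sub>R x - (a + b))"
        using c by (simp add: algebra_simps)
      then have "norm (x - ((1 / c) *\<^sub>R a + (1 / c) *\<^sub>R b)) = norm (c *\<^sub>R x - (a + b)) / c"
        using c by simp
      also have "\<dots> \<le> (c * norm x / 2) / c" using ab c by (intro divide_right_mono) auto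
      finally show ?thesis using c by simp
    qed
    ultimately show ?thesis using ab A B subspace_scale by metis
  qed
  then show ?thesis by blast
qed

text \<open>The approximate decomposition is applied again to each remainder. The remainders halve,
  so the first components sum to at most \<open>2 * M\<close> times the norm; linearity comes from
  uniqueness of the decomposition.\<close>

lemma space_decomposition_projection:
  fixes X :: "'a::banach set"
  assumes X: "subspace X" "closed X" and dec: "space_decomposition X A B"
  obtains p where "bdd_linear_on X A p" "\<And>x. x \<in> X \<Longrightarrow> x - p x \<in> B"
    "\<And>a. a \<in> A \<Longrightarrow> p a = a" "\<And>b. b \<in> B \<Longrightarrow> p b = 0"
proof -
  have A: "subspace A" "closed A" "A \<subseteq> X" and B: "subspace B" "closed B" "B \<subseteq> X"
    and XAB: "X = {a + b | a b. a \<in> A \<and> b \<in> B}" and int: "A \<inter> B = {0}"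
    using dec by (auto simp: space_decomposition_def closed_subspace_def)
  obtain M where M: "\<forall>x\<in>X. \<exists>a\<in>A. \<exists>b\<in>B. norm a \<le> M * norm x \<and> norm (x - (a + b)) \<le> norm x / 2"
    using space_decomposition_approx[OF assms] by blast
  then obtain fa fb where fab: "\<And>x. x \<in> X \<Longrightarrow> fa x \<in> A" "\<And>x. x \<in> X \<Longrightarrow> fb x \<in> B"
    "\<And>x. x \<in> X \<Longrightarrow> norm (fa x) \<le> M * norm x"
    "\<And>x. x \<in> X \<Longrightarrow> norm (x - (fa x + fb x)) \<le> norm x / 2" by metis
  have unique: "a = a'" if "a + b = a' + b'" "a \<in> A" "a' \<in> A" "b \<in> B" "b' \<in> B" for a a' b b'
  proof -
    have "a - a' = b' - b" using that(1) by (simp add: algebra_simps)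
    moreover have "a - a' \<in> A" "b' - b \<in> B" using that A B by (auto simp: subspace_diff)
    ultimately have "a - a' \<in> A \<inter> B" by auto
    then show ?thesis using int by simp
  qed
  have ex: "\<exists>a\<in>A. x - a \<in> B \<and> norm a \<le> (2 * M) * norm x" if x: "x \<in> X" for x
  proof -
    define s where "s n = ((\<lambda>y. y - (fa y + fb y)) ^^ n) x" for n
    have s0: "s 0 = x" and s_Suc: "s (Suc n) = s n - (fa (s n) + fb (s n))" for n
      by (simp_all add: s_def)
    have sX: "s n \<in> X" for n
    proof (induction n)
      case (Suc n)
      then have "fa (s n) \<in> X" "fb (s n) \<in> X" using fab(1,2)[of "s n"] A(3) B(3) by auto
      with Suc X(1) show ?case by (simp add: s_Suc subspace_diff subspace_add)
    qed (simp add: s0 x)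
    have sn: "norm (s n) \<le> norm x * (1 / 2) ^ n" for n
    proof (induction n)
      case (Suc n)
      have "norm (s (Suc n)) \<le> norm (s n) / 2" using fab(4)[OF sX] by (simp add: s_Suc)
      with Suc show ?case by simp
    qed (simp add: s0)
    have "(\<lambda>n. norm x * (1 / 2) ^ n) \<longlonglongrightarrow> norm x * 0"
      by (intro tendsto_mult tendsto_const LIMSEQ_power_zero) auto
    then have "(\<lambda>n. norm x * (1 / 2) ^ n) \<longlonglongrightarrow> 0" by simp
    then have s_lim: "s \<longlonglongrightarrow> 0"
      using sn by (intro Lim_null_comparison[of s]) auto
    have M0: "0 \<le> M * norm y" if "y \<in> X" for y
      using fab(3)[OF that] norm_ge_zero order_trans by blast
    have an: "norm (fa (s n)) \<le> (M * norm x) * (1 / 2) ^ n" for n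
    proof (cases "x = 0")
      case True
      then show ?thesis using sn[of n] fab(3)[OF sX[of n]] by simp
    next
      case False
      then have "M \<ge> 0" using M0[OF x] by (simp add: zero_le_mult_iff)
      then have "M * norm (s n) \<le> M * (norm x * (1 / 2) ^ n)" using sn by (intro mult_left_mono)
      then show ?thesis using fab(3)[OF sX[of n]] by (simp add: mult.assoc)
    qed
    have geo: "(\<lambda>n. (M * norm x) * (1 / 2) ^ n) sums ((M * norm x) * 2)"
      using geometric_sums[of "1 / 2 :: real"] by (intro sums_mult) auto
    have sum: "summable (\<lambda>n. fa (s n))"
      using sums_summable[OF geo] an by (rule summable_comparison_test'[where N = 0])
    define a where "a = (\<Sum>n. fa (s n))"
    have a_lim: "(\<lambda>n. \<Sum>i<n. fa (s i)) \<longlonglongrightarrow> a" using summable_LIMSEQ[OF sum] by (simp add: a_def)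
    have aA: "a \<in> A"
      by (rule closed_sequentially[OF A(2) _ a_lim]) (intro subspace_sum A(1) fab sX)
    \<comment> \<open>This identity makes the second components converge: the remainders tend to 0
      and the first components are summable.\<close>
    have part: "(\<Sum>i<n. fb (s i)) = x - s n - (\<Sum>i<n. fa (s i))" for n
      by (induction n) (auto simp: s0 s_Suc algebra_simps)
    have "(\<lambda>n. \<Sum>i<n. fb (s i)) \<longlonglongrightarrow> x - 0 - a"
      unfolding part by (intro tendsto_diff tendsto_const s_lim a_lim)
    then have "x - 0 - a \<in> B"
      by (rule closed_sequentially[OF B(2), rotated]) (intro subspace_sum B(1) fab sX)
    moreover have "norm a \<le> (2 * M) * norm x"
    proof -
      have "norm a \<le> (\<Sum>n. (M * norm x) * (1 / 2) ^ n)"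
        unfolding a_def using an sums_summable[OF geo] by (rule norm_suminf_le)
      also have "\<dots> = (M * norm x) * 2" using geo by (simp add: sums_iff)
      finally show ?thesis by simp
    qed
    ultimately show ?thesis using aA by (auto intro!: bexI[of _ a])
  qed
  then obtain p where p: "\<And>x. x \<in> X \<Longrightarrow> p x \<in> A" "\<And>x. x \<in> X \<Longrightarrow> x - p x \<in> B"
    "\<And>x. x \<in> X \<Longrightarrow> norm (p x) \<le> (2 * M) * norm x" by metis
  have p_eq: "p (a + b) = a" if "a \<in> A" "b \<in> B" for a b
  proof (rule unique)
    have "a + b \<in> X" using that XAB by blast
    then show "p (a + b) + (a + b - p (a + b)) = a + b" "p (a + b) \<in> A" "a + b - p (a + b) \<in> B"
      using p by auto
  qed (use that in auto)
  have add: "p (x + y) = p x + p y" if "x \<in> X" "y \<in> X" for x y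
  proof -
    have "p ((p x + p y) + ((x - p x) + (y - p y))) = p x + p y"
      using that p A B by (intro p_eq) (auto simp: subspace_add)
    then show ?thesis by (simp add: algebra_simps)
  qed
  have scale: "p (c *\<^sub>R x) = c *\<^sub>R p x" if "x \<in> X" for x c
  proof -
    have "p (c *\<^sub>R p x + c *\<^sub>R (x - p x)) = c *\<^sub>R p x"
      using that p A B by (intro p_eq) (auto simp: subspace_scale)
    then show ?thesis by (simp add: algebra_simps)
  qed
  have "bdd_linear_on X A p" using p add scale by (intro bdd_linear_onI)
  then show thesis
    using that[of p] p(2) p_eq[of _ 0] p_eq[of 0] subspace_0[OF A(1)] subspace_0[OF B(1)] by simp
qed

lemma bdd_linear_on_Pair:
  assumes f: "bdd_linear_on U V f" and g: "bdd_linear_on U W g"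
  shows "bdd_linear_on U (V \<times> W) (\<lambda>x. (f x, g x))"
proof -
  obtain K where K: "\<And>x. x \<in> U \<Longrightarrow> norm (f x) \<le> K * norm x"
    using bdd_linear_on_bound[OF f] by blast
  obtain L where L: "\<And>x. x \<in> U \<Longrightarrow> norm (g x) \<le> L * norm x"
    using bdd_linear_on_bound[OF g] by blast
  have "norm (f x, g x) \<le> (K + L) * norm x" if "x \<in> U" for x
    using norm_Pair_le[of "f x" "g x"] K[OF that] L[OF that] by (simp add: distrib_right)
  then show ?thesis
    using bdd_linear_onD[OF f] bdd_linear_onD[OF g]
    by (intro bdd_linear_onI[where K = "K + L"]) auto
qed

lemma bdd_linear_on_fst: "bdd_linear_on (U \<times> V) U fst"
  by (intro bdd_linear_onI[where K = 1]) (auto simp: norm_fst_le)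

lemma bdd_linear_on_snd: "bdd_linear_on (U \<times> V) V snd"
  by (intro bdd_linear_onI[where K = 1]) (auto simp: norm_snd_le)

lemma bdd_linear_on_id: "U \<subseteq> V \<Longrightarrow> bdd_linear_on U V (\<lambda>x. x)"
  by (intro bdd_linear_onI[where K = 1]) auto

lemma bdd_linear_on_const_zero: "0 \<in> V \<Longrightarrow> bdd_linear_on U V (\<lambda>x. 0)"
  by (intro bdd_linear_onI[where K = 0]) auto

lemma bdd_linear_on_add:
  assumes f: "bdd_linear_on U V f" and g: "bdd_linear_on U V g" and V: "subspace V"
  shows "bdd_linear_on U V (\<lambda>x. f x + g x)"
proof -
  obtain K where K: "\<And>x. x \<in> U \<Longrightarrow> norm (f x) \<le> K * norm x"
    using bdd_linear_on_bound[OF f] by blast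
  obtain L where L: "\<And>x. x \<in> U \<Longrightarrow> norm (g x) \<le> L * norm x"
    using bdd_linear_on_bound[OF g] by blast
  have "norm (f x + g x) \<le> (K + L) * norm x" if "x \<in> U" for x
    using norm_triangle_ineq[of "f x" "g x"] K[OF that] L[OF that] by (simp add: distrib_right)
  then show ?thesis
    using bdd_linear_onD[OF f] bdd_linear_onD[OF g] V
    by (intro bdd_linear_onI[where K = "K + L"]) (auto simp: subspace_add scaleR_add_right)
qed

lemma bdd_linear_on_scaleR:
  assumes f: "bdd_linear_on U V f" and V: "subspace V"
  shows "bdd_linear_on U V (\<lambda>x. c *\<^sub>R f x)"
proof -
  obtain K where K: "\<And>x. x \<in> U \<Longrightarrow> norm (f x) \<le> K * norm x"
    using bdd_linear_on_bound[OF f] by blast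
  have "norm (c *\<^sub>R f x) \<le> (\<bar>c\<bar> * K) * norm x" if "x \<in> U" for x
    using K[OF that] by (simp add: mult.assoc mult_left_mono)
  then show ?thesis
    using bdd_linear_onD[OF f] V
    by (intro bdd_linear_onI[where K = "\<bar>c\<bar> * K"]) (auto simp: subspace_scale scaleR_add_right)
qed

lemma bdd_linear_on_minus:
  assumes f: "bdd_linear_on U V f" and g: "bdd_linear_on U V g" and V: "subspace V"
  shows "bdd_linear_on U V (\<lambda>x. f x - g x)"
  using bdd_linear_on_add[OF f bdd_linear_on_scaleR[OF g V, of "-1"] V] by simp

lemma isomorphic_direct_sum:
  assumes X: "subspace X" and p: "bdd_linear_on X A p" and B: "\<And>x. x \<in> X \<Longrightarrow> x - p x \<in> B"
    and pA: "\<And>a. a \<in> A \<Longrightarrow> p a = a" and pB: "\<And>b. b \<in> B \<Longrightarrow> p b = 0"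
    and sub: "subspace A" "A \<subseteq> X" "subspace B" "B \<subseteq> X"
  shows "X \<simeq> A \<times> B"
proof (rule isomorphic_spacesI[where f = "\<lambda>x. (p x, x - p x)" and g = "\<lambda>y. fst y + snd y"])
  have "bdd_linear_on X X (\<lambda>x. x - p x)"
    using p sub X by (intro bdd_linear_on_minus bdd_linear_on_id bdd_linear_on_mono[OF p])
      (auto dest: bdd_linear_onD(1))
  then have "bdd_linear_on X B (\<lambda>x. x - p x)" using B by (rule_tac bdd_linear_on_mono) auto
  then show "bdd_linear_on X (A \<times> B) (\<lambda>x. (p x, x - p x))" using p by (intro bdd_linear_on_Pair)
  show "bdd_linear_on (A \<times> B) X (\<lambda>y. fst y + snd y)"
    using sub X bdd_linear_on_compose[OF bdd_linear_on_fst bdd_linear_on_id]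
      bdd_linear_on_compose[OF bdd_linear_on_snd bdd_linear_on_id]
    by (intro bdd_linear_on_add) auto
  fix y assume y: "y \<in> A \<times> B"
  then have "fst y \<in> A" "snd y \<in> B" "fst y \<in> X" "snd y \<in> X" using sub by auto
  then have "p (fst y + snd y) = fst y"
    using bdd_linear_onD(2)[OF p, of "fst y" "snd y"] pA pB by simp
  then show "(p (fst y + snd y), fst y + snd y - p (fst y + snd y)) = y" by simp
qed (use X sub in \<open>auto intro: subspace_Times\<close>)

lemma space_decomposition_isomorphic:
  fixes X :: "'a::banach set"
  assumes X: "subspace X" "closed X" and dec: "space_decomposition X A B"
  shows "X \<simeq> A \<times> B"
proof -
  obtain p where "bdd_linear_on X A p" "\<And>x. x \<in> X \<Longrightarrow> x - p x \<in> B"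
    "\<And>a. a \<in> A \<Longrightarrow> p a = a" "\<And>b. b \<in> B \<Longrightarrow> p b = 0"
    using space_decomposition_projection[OF assms] by metis
  then show ?thesis using X dec
    by (intro isomorphic_direct_sum[where p = p]) (auto simp: space_decomposition_def closed_subspace_def)
qed

subsection \<open>Finite-dimensional extensions\<close>

text \<open>The coefficient of \<open>b\<close> is a bounded functional of norm at most
  \<open>1 / d\<close>, where \<open>d\<close> is the distance from \<open>b\<close> to
  \<open>F\<close>, positive because \<open>F\<close> is closed.\<close>

lemma closed_insert_isomorphic:
  fixes F :: "'a::banach set"
  assumes F: "subspace F" "closed F" and b: "b \<notin> F"
  shows "F \<times> (UNIV :: real set) \<simeq> span (insert b F)"
proof -
  define V where "V = span (insert b F)"
  have V_iff: "y \<in> V \<longleftrightarrow> (\<exists>k. y - k *\<^sub>R b \<in> F)" for y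
    unfolding V_def span_insert span_eq_iff[THEN iffD2, OF F(1)] by simp
  have V: "subspace V" by (simp add: V_def)
  define d where "d = infdist b F"
  have d: "d > 0" unfolding d_def using F b subspace_0[OF F(1)] infdist_pos_not_in_closed by blast
  have low: "\<bar>k\<bar> * d \<le> norm y" if "y - k *\<^sub>R b \<in> F" for y k
  proof (cases "k = 0")
    case False
    have "(- 1 / k) *\<^sub>R (y - k *\<^sub>R b) \<in> F" using that F(1) subspace_scale by blast
    then have "d \<le> dist b ((- 1 / k) *\<^sub>R (y - k *\<^sub>R b))" unfolding d_def by (rule infdist_le)
    also have "b - (- 1 / k) *\<^sub>R (y - k *\<^sub>R b) = (1 / k) *\<^sub>R y" using False by (simp add: algebra_simps)
    then have "dist b ((- 1 / k) *\<^sub>R (y - k *\<^sub>R b)) = norm y / \<bar>k\<bar>" by (simp add: dist_norm)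
    finally show ?thesis using False by (simp add: field_simps)
  qed simp
  define t where "t y = (SOME k. y - k *\<^sub>R b \<in> F)" for y
  have t: "y - t y *\<^sub>R b \<in> F" if "y \<in> V" for y
    using that V_iff unfolding t_def by (auto intro: someI_ex)
  have t_eq: "t y = k" if "y - k *\<^sub>R b \<in> F" for y k
  proof -
    have "y - t y *\<^sub>R b \<in> F" using that V_iff t by blast
    then have "(y - k *\<^sub>R b) - (y - t y *\<^sub>R b) \<in> F" using that F(1) subspace_diff by blast
    then have "0 - (k - t y) *\<^sub>R b \<in> F" by (simp add: algebra_simps)
    from low[OF this] d show ?thesis by (simp add: mult_le_0_iff)
  qed
  have tb: "bdd_linear_on V UNIV t"
  proof (rule bdd_linear_onI[where K = "1 / d"])
    fix x y assume xy: "x \<in> V" "y \<in> V"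
    have "(x - t x *\<^sub>R b) + (y - t y *\<^sub>R b) \<in> F" using xy t F(1) subspace_add by blast
    then show "t (x + y) = t x + t y" by (intro t_eq) (simp add: algebra_simps)
  next
    fix c x assume x: "x \<in> V"
    have "c *\<^sub>R (x - t x *\<^sub>R b) \<in> F" using x t F(1) subspace_scale by blast
    then show "t (c *\<^sub>R x) = c *\<^sub>R t x" by (intro t_eq) (simp add: algebra_simps)
  next
    fix x assume "x \<in> V"
    then show "norm (t x) \<le> (1 / d) * norm x" using low[OF t] d by (simp add: field_simps)
  qed auto
  have mul: "bdd_linear_on UNIV UNIV (\<lambda>k. k *\<^sub>R b)"
    by (rule bdd_linear_onI[where K = "norm b"]) (auto simp: algebra_simps)
  show ?thesis
    unfolding V_def[symmetric]
  proof (rule isomorphic_spacesI[where f = "\<lambda>p. fst p + snd p *\<^sub>R b" and g = "\<lambda>y. (y - t y *\<^sub>R b, t y)"])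
    have "bdd_linear_on (F \<times> UNIV) UNIV (\<lambda>p. fst p + snd p *\<^sub>R b)"
      by (rule bdd_linear_on_add[OF bdd_linear_on_compose[OF bdd_linear_on_fst bdd_linear_on_id[OF subset_UNIV]]
            bdd_linear_on_compose[OF bdd_linear_on_snd mul]]) auto
    then show "bdd_linear_on (F \<times> UNIV) V (\<lambda>p. fst p + snd p *\<^sub>R b)"
    proof (rule bdd_linear_on_mono)
      show "(\<lambda>p. fst p + snd p *\<^sub>R b) ` (F \<times> UNIV) \<subseteq> V"
      proof (rule image_subsetI)
        fix p assume "p \<in> F \<times> (UNIV :: real set)"
        then have "(fst p + snd p *\<^sub>R b) - snd p *\<^sub>R b \<in> F" by auto
        then show "fst p + snd p *\<^sub>R b \<in> V" using V_iff by blast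
      qed
    qed auto
    have "bdd_linear_on V UNIV (\<lambda>y. y - t y *\<^sub>R b)"
      using bdd_linear_on_compose[OF tb mul] by (intro bdd_linear_on_minus bdd_linear_on_id) auto
    then have "bdd_linear_on V F (\<lambda>y. y - t y *\<^sub>R b)" using t by (rule_tac bdd_linear_on_mono) auto
    then show "bdd_linear_on V (F \<times> UNIV) (\<lambda>y. (y - t y *\<^sub>R b, t y))"
      using tb by (intro bdd_linear_on_Pair)
    fix x assume "x \<in> F \<times> (UNIV :: real set)"
    then have "t (fst x + snd x *\<^sub>R b) = snd x" by (intro t_eq) auto
    then show "(fst x + snd x *\<^sub>R b - t (fst x + snd x *\<^sub>R b) *\<^sub>R b, t (fst x + snd x *\<^sub>R b)) = x" by simp
  qed (use V F in \<open>auto intro: subspace_Times\<close>)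
qed

text \<open>\<open>D\<close> is an abstract model of the spaces of dimension \<open>i\<close>, since
  a type cannot depend on \<open>i\<close>. The vectors of \<open>B\<close> are adjoined one by one;
  one that already lies in the span changes nothing, and closedness is carried along for the next
  step.\<close>

lemma finite_extension_isomorphic:
  fixes F :: "'a::banach set" and D :: "nat \<Rightarrow> 'd::real_normed_vector set"
  assumes F: "subspace F" "closed F" and B: "finite B"
    and D: "D 0 = {0}" "\<And>i. D (Suc i) \<simeq> D i \<times> (UNIV :: real set)" "\<And>i. subspace (D i)"
  shows "closed (span (F \<union> B)) \<and> (\<exists>i. span (F \<union> B) \<simeq> F \<times> D i)"
  using B
proof (induction B)
  case empty
  have "F \<simeq> F \<times> D 0"
    using isomorphic_Times_zero[of F] F by (auto simp: D(1) intro!: isomorphic_sym[OF isomorphic_Times_zero] subspace_Times)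
  then show ?case using F by (auto simp: span_eq_iff[THEN iffD2])
next
  case (insert b B)
  let ?V = "span (F \<union> B)"
  show ?case
  proof (cases "b \<in> ?V")
    case True
    then show ?thesis using insert by (simp add: span_redundant)
  next
    case False
    have eq: "span (insert b ?V) = span (F \<union> insert b B)"
      by (simp only: Un_insert_right span_insert span_span)
    obtain i where i: "?V \<simeq> F \<times> D i" and cl: "closed ?V" using insert by blast
    have iso: "?V \<times> (UNIV :: real set) \<simeq> span (F \<union> insert b B)"
      using closed_insert_isomorphic[OF subspace_span cl False] by (simp only: eq)
    have "span (F \<union> insert b B) \<simeq> ?V \<times> (UNIV :: real set)"
      using iso by (rule isomorphic_sym) (auto intro: subspace_Times)
    also have "\<dots> \<simeq> (F \<times> D i) \<times> (UNIV :: real set)"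
      by (intro isomorphic_Times i isomorphic_refl)
    also have "\<dots> \<simeq> F \<times> (D i \<times> (UNIV :: real set))" by (rule isomorphic_Times_assoc)
    also have "\<dots> \<simeq> F \<times> D (Suc i)"
      using D by (intro isomorphic_Times isomorphic_refl isomorphic_sym[OF D(2)])
    finally show ?thesis
      using isomorphic_closed[OF iso subspace_Times[OF subspace_span subspace_UNIV]
          closed_Times[OF cl closed_UNIV]] by blast
  qed
qed

section \<open>Cancelling a one-dimensional summand\<close>

lemma isomorphic_cancel_line_aux:
  assumes T: "bdd_linear_on (U \<times> (UNIV :: real set)) (V \<times> (UNIV :: real set)) T"
    and T': "bdd_linear_on (V \<times> (UNIV :: real set)) (U \<times> (UNIV :: real set)) T'"
    and U: "subspace U" and V: "subspace V"
    and inv: "\<And>x. x \<in> U \<times> UNIV \<Longrightarrow> T' (T x) = x" "\<And>y. y \<in> V \<times> UNIV \<Longrightarrow> T (T' y) = y"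
    and c: "snd (T (0, 1)) \<noteq> 0"
  shows "U \<simeq> V"
proof -
  define c where "c = snd (T (0, 1))"
  define \<phi> where "\<phi> u = snd (T (u, 0))" for u
  have emb: "bdd_linear_on W (W \<times> (UNIV :: real set)) (\<lambda>u. (u, 0))" for W :: "'z::real_normed_vector set"
    by (intro bdd_linear_on_Pair bdd_linear_on_id bdd_linear_on_const_zero) auto
  have \<phi>: "bdd_linear_on U UNIV \<phi>"
    unfolding \<phi>_def
    by (rule bdd_linear_on_compose[OF bdd_linear_on_compose[OF emb T] bdd_linear_on_snd])
  have c0: "c \<noteq> 0" using assms(7) by (simp add: c_def)
  have snd_T: "snd (T (u, t)) = \<phi> u + t * c" if "u \<in> U" for u t
  proof -
    have "T ((u, 0) + t *\<^sub>R (0, 1)) = T (u, 0) + t *\<^sub>R T (0, 1)"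
      using that U bdd_linear_onD(2)[OF T, of "(u, 0)" "t *\<^sub>R (0, 1)"] bdd_linear_onD(3)[OF T, of "(0, 1)" t]
      by (simp add: subspace_0)
    then show ?thesis by (simp add: \<phi>_def c_def)
  qed
  \<comment> \<open>The hyperplane on which \<open>T\<close> has second coordinate 0 is the graph of
    \<open>- \<phi> / c\<close> over \<open>U\<close>, and \<open>T\<close> carries it onto
    \<open>V\<close>.\<close>
  define f where "f u = fst (T (u, (- 1 / c) *\<^sub>R \<phi> u))" for u
  define g where "g v = fst (T' (v, 0))" for v
  show ?thesis
  proof (rule isomorphic_spacesI[where f = f and g = g])
    have "bdd_linear_on U (U \<times> UNIV) (\<lambda>u. (u, (- 1 / c) *\<^sub>R \<phi> u))"
      using \<phi> by (intro bdd_linear_on_Pair bdd_linear_on_id bdd_linear_on_scaleR) auto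
    then show "bdd_linear_on U V f"
      unfolding f_def by (rule bdd_linear_on_compose[OF bdd_linear_on_compose[OF _ T] bdd_linear_on_fst])
    show "bdd_linear_on V U g"
      unfolding g_def by (rule bdd_linear_on_compose[OF bdd_linear_on_compose[OF emb T'] bdd_linear_on_fst])
    show "g (f u) = u" if u: "u \<in> U" for u
    proof -
      have "snd (T (u, (- 1 / c) *\<^sub>R \<phi> u)) = 0" using snd_T[OF u] c0 by simp
      then have "T (u, (- 1 / c) *\<^sub>R \<phi> u) = (f u, 0)" by (simp add: f_def prod_eq_iff)
      then show ?thesis using inv(1)[of "(u, (- 1 / c) *\<^sub>R \<phi> u)"] u by (simp add: g_def)
    qed
    show "f (g v) = v" if v: "v \<in> V" for v
    proof -
      obtain u t where ut: "T' (v, 0) = (u, t)" by fastforce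
      have u: "u \<in> U" using bdd_linear_onD(1)[OF T', of "(v, 0)"] v ut by simp
      have *: "T (u, t) = (v, 0)" using inv(2)[of "(v, 0)"] v ut by simp
      then have "\<phi> u + t * c = 0" using snd_T[OF u, of t] by simp
      then have "t = (- 1 / c) *\<^sub>R \<phi> u" using c0 by (simp add: field_simps)
      then show ?thesis using * ut by (simp add: f_def g_def)
    qed
  qed (fact U V)+
qed

text \<open>This says that all closed hyperplanes of a space are isomorphic. It allows
  finite-dimensional summands to be removed from both sides.\<close>

lemma isomorphic_cancel_line:
  assumes iso: "U \<times> (UNIV :: real set) \<simeq> V \<times> (UNIV :: real set)"
    and U: "subspace U" and V: "subspace V"
  shows "U \<simeq> V"
proof -
  obtain T T' where T: "bdd_linear_on (U \<times> (UNIV :: real set)) (V \<times> (UNIV :: real set)) T"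
    and T': "bdd_linear_on (V \<times> (UNIV :: real set)) (U \<times> (UNIV :: real set)) T'"
    and inv: "\<And>x. x \<in> U \<times> UNIV \<Longrightarrow> T' (T x) = x" "\<And>y. y \<in> V \<times> UNIV \<Longrightarrow> T (T' y) = y"
    using isomorphic_spacesE[OF iso] U subspace_Times[OF U subspace_UNIV] by metis
  show ?thesis
  proof (cases "snd (T (0, 1)) = 0")
    case False
    with T T' U V inv show ?thesis by (rule isomorphic_cancel_line_aux)
  next
    case True
    text \<open>Precompose with a shear that sends the line onto a vector with nonzero second coordinate.\<close>
    obtain u0 d where ud: "T' (0, 1) = (u0, d)" by fastforce
    have V1: "(0, 1) \<in> V \<times> (UNIV :: real set)" using V by (simp add: subspace_0)
    have u0: "u0 \<in> U" using bdd_linear_onD(1)[OF T' V1] ud by simp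
    have U1: "(0, 1) \<in> U \<times> (UNIV :: real set)" using U by (simp add: subspace_0)
    have "T ((u0, 0) + d *\<^sub>R (0, 1)) = T (u0, 0) + d *\<^sub>R T (0, 1)"
      using u0 U bdd_linear_onD(2)[OF T, of "(u0, 0)" "d *\<^sub>R (0, 1)"] bdd_linear_onD(3)[OF T U1, of d]
      by (simp add: subspace_0)
    moreover have "T (u0, d) = (0, 1)" using inv(2)[OF V1] ud by simp
    ultimately have 1: "snd (T (u0, 0)) = 1" using True by (auto simp: prod_eq_iff)
    have "T ((u0, 0) + (0, 1)) = T (u0, 0) + T (0, 1)"
      using u0 U bdd_linear_onD(2)[OF T, of "(u0, 0)" "(0, 1)"] by (simp add: subspace_0)
    then have ne: "snd (T (0 + 1 *\<^sub>R u0, 1)) \<noteq> 0" using 1 True by simp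
    have mul: "bdd_linear_on UNIV U (\<lambda>k. k *\<^sub>R u0)"
      using u0 U by (intro bdd_linear_onI[where K = "norm u0"]) (auto simp: algebra_simps subspace_scale)
    have m2: "bdd_linear_on (U \<times> UNIV) U (\<lambda>p. snd p *\<^sub>R u0)"
      by (rule bdd_linear_on_compose[OF bdd_linear_on_snd mul])
    have S: "bdd_linear_on (U \<times> UNIV) (U \<times> UNIV) (\<lambda>p. (fst p + snd p *\<^sub>R u0, snd p))"
      "bdd_linear_on (U \<times> UNIV) (U \<times> UNIV) (\<lambda>p. (fst p - snd p *\<^sub>R u0, snd p))"
      using U m2 by (auto intro!: bdd_linear_on_Pair bdd_linear_on_add bdd_linear_on_minus
          bdd_linear_on_fst bdd_linear_on_snd)
    define R R' where "R p = T (fst p + snd p *\<^sub>R u0, snd p)"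
      and "R' y = (fst (T' y) - snd (T' y) *\<^sub>R u0, snd (T' y))" for p y
    show ?thesis
    proof (rule isomorphic_cancel_line_aux[where T = R and T' = R'])
      show "bdd_linear_on (U \<times> UNIV) (V \<times> UNIV) R"
        unfolding R_def by (rule bdd_linear_on_compose[OF S(1) T])
      show "bdd_linear_on (V \<times> UNIV) (U \<times> UNIV) R'"
        unfolding R'_def by (rule bdd_linear_on_compose[OF T' S(2)])
      show "R' (R x) = x" if "x \<in> U \<times> UNIV" for x
        using inv(1)[of "(fst x + snd x *\<^sub>R u0, snd x)"] that u0 U
        by (auto simp: R_def R'_def subspace_add subspace_scale)
      show "R (R' y) = y" if "y \<in> V \<times> UNIV" for y
        using inv(2)[OF that] by (simp add: R_def R'_def)
      show "snd (R (0, 1)) \<noteq> 0" using ne by (simp add: R_def)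
    qed (fact U V)+
  qed
qed

subsection \<open>Projections along an unconditional decomposition\<close>

text \<open>
  The projections \<open>x \<mapsto> \<Sum>n\<in>I. x\<^sub>n\<close> of an unconditional decomposition. A complemented subspace with
  an unconditional decomposition also gives an instance on the ambient space; then \<open>q UNIV\<close> is a
  projection onto the subspace.
\<close>

locale projection_algebra =
  fixes X :: "'a::banach set" and q :: "nat set \<Rightarrow> 'a \<Rightarrow> 'a" and C :: real
  assumes X: "subspace X" "closed X"
    and q_mem: "x \<in> X \<Longrightarrow> q I x \<in> X"
    and q_add: "x \<in> X \<Longrightarrow> y \<in> X \<Longrightarrow> q I (x + y) = q I x + q I y"
    and q_scale: "x \<in> X \<Longrightarrow> q I (c *\<^sub>R x) = c *\<^sub>R q I x"
    and q_norm: "x \<in> X \<Longrightarrow> norm (q I x) \<le> C * norm x"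
    and q_Int: "x \<in> X \<Longrightarrow> q I (q J x) = q (I \<inter> J) x"
    and q_Un: "x \<in> X \<Longrightarrow> I \<inter> J = {} \<Longrightarrow> q (I \<union> J) x = q I x + q J x"
    and q_lim: "x \<in> X \<Longrightarrow> (\<lambda>n. q {..<n} x) \<longlonglongrightarrow> q UNIV x"
begin

definition part :: "nat set \<Rightarrow> 'a set" where
  "part I = q I ` X"

text \<open>The kernel of the projection. \<open>copart UNIV\<close> is 0 for a decomposition of
  \<open>X\<close> itself and is the complement when only a complemented subspace is
  decomposed.\<close>

definition copart :: "nat set \<Rightarrow> 'a set" where
  "copart I = {x \<in> X. q I x = 0}"

lemma q_bdd_linear: "bdd_linear_on X X (q I)"
  using q_mem q_add q_scale q_norm by (intro bdd_linear_onI)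

lemma q_diff: "x \<in> X \<Longrightarrow> y \<in> X \<Longrightarrow> q I (x - y) = q I x - q I y"
  by (rule bdd_linear_on_diff[OF q_bdd_linear X(1)])

lemma q_empty: "x \<in> X \<Longrightarrow> q {} x = 0"
  using q_Un[of x "{}" "{}"] by simp

lemma q_zero: "q I 0 = 0"
  by (rule bdd_linear_on_zero[OF q_bdd_linear X(1)])

lemma q_idem: "x \<in> X \<Longrightarrow> q I (q I x) = q I x"
  by (simp add: q_Int)

lemma mem_part: "x \<in> part I \<longleftrightarrow> x \<in> X \<and> q I x = x"
  by (auto simp: part_def q_mem q_idem intro: image_eqI[OF sym])

lemma part_subset: "part I \<subseteq> X"
  by (auto simp: mem_part)

lemma copart_subset: "copart I \<subseteq> X"
  by (auto simp: copart_def)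

lemma part_subspace: "subspace (part I)"
  using X by (auto simp: subspace_def mem_part q_zero q_add q_scale)

lemma copart_subspace: "subspace (copart I)"
  using X by (auto simp: subspace_def copart_def q_zero q_add q_scale)

lemma q_continuous: "continuous_on X (q I)"
  by (rule bdd_linear_on_continuous[OF q_bdd_linear X(1)])

lemma copart_closed: "closed (copart I)"
proof -
  have "copart I = X \<inter> q I -` {0}" by (auto simp: copart_def)
  then show ?thesis using continuous_closed_preimage[OF q_continuous X(2), of "{0}" I] by simp
qed

lemma part_closed: "closed (part I)"
proof -
  have "continuous_on X (\<lambda>x. q I x - x)" by (intro continuous_intros q_continuous)
  then have "closed (X \<inter> (\<lambda>x. q I x - x) -` {0})" using continuous_closed_preimage X(2) by blast
  also have "X \<inter> (\<lambda>x. q I x - x) -` {0} = part I" by (auto simp: mem_part)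
  finally show ?thesis .
qed

lemma part_mono: "I \<subseteq> J \<Longrightarrow> part I \<subseteq> part J"
proof
  fix x assume "I \<subseteq> J" "x \<in> part I"
  then have "x \<in> X" "q I x = x" by (auto simp: mem_part)
  then have "q J x = x" using q_Int[of x J I] \<open>I \<subseteq> J\<close> by (simp add: inf.absorb2)
  then show "x \<in> part J" using \<open>x \<in> X\<close> by (simp add: mem_part)
qed

lemma space_decomposition_part: "space_decomposition X (part I) (copart I)"
proof -
  have "x = q I x + (x - q I x)" "q I x \<in> part I" "x - q I x \<in> copart I" if "x \<in> X" for x
    using that X by (auto simp: mem_part copart_def q_mem q_idem q_diff subspace_diff)
  then have "X \<subseteq> {a + b | a b. a \<in> part I \<and> b \<in> copart I}" by blast
  moreover have "{a + b | a b. a \<in> part I \<and> b \<in> copart I} \<subseteq> X"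
    using part_subset copart_subset X(1) subspace_add by blast
  moreover have "part I \<inter> copart I = {0}"
    using X(1) by (auto simp: mem_part copart_def q_zero subspace_0)
  ultimately have "X = {a + b | a b. a \<in> part I \<and> b \<in> copart I} \<and> part I \<inter> copart I = {0}" by blast
  then show ?thesis
    unfolding space_decomposition_def closed_subspace_def
    using part_subspace[of I] part_closed[of I] part_subset[of I]
      copart_subspace[of I] copart_closed[of I] copart_subset[of I] by simp
qed

lemma part_copart_isomorphic: "X \<simeq> part I \<times> copart I"
  by (rule space_decomposition_isomorphic[OF X space_decomposition_part])

lemma part_Un_isomorphic:
  assumes "I \<inter> J = {}"
  shows "part (I \<union> J) \<simeq> part I \<times> part J"
proof (rule isomorphic_direct_sum[where p = "q I"])
  show "bdd_linear_on (part (I \<union> J)) (part I) (q I)"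
    using q_bdd_linear by (rule bdd_linear_on_mono) (auto simp: mem_part q_idem q_mem)
  show "x - q I x \<in> part J" if "x \<in> part (I \<union> J)" for x
  proof -
    have x: "x \<in> X" "q I x + q J x = x" using that q_Un[OF _ assms] by (auto simp: mem_part)
    then have "x - q I x = q J x" by (metis add_diff_cancel_left')
    then show ?thesis using x by (simp add: part_def)
  qed
  show "q I a = a" if "a \<in> part I" for a using that by (simp add: mem_part)
  show "q I b = 0" if b: "b \<in> part J" for b
  proof -
    have "q I b = q I (q J b)" "b \<in> X" using b by (simp_all add: mem_part)
    then show ?thesis using assms by (simp add: q_Int q_empty)
  qed
qed (use part_subspace part_mono in auto)

text \<open>On the kernel of \<open>q I\<close> the projections \<open>q UNIV\<close> and
  \<open>q (- I)\<close> agree, so subtracting \<open>q (- I) x\<close> leaves an element of the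
  kernel of \<open>q UNIV\<close>.\<close>

lemma copart_isomorphic: "copart I \<simeq> part (- I) \<times> copart UNIV"
proof (rule isomorphic_direct_sum[where p = "q (- I)"])
  show "bdd_linear_on (copart I) (part (- I)) (q (- I))"
    using q_bdd_linear by (rule bdd_linear_on_mono) (auto simp: mem_part copart_def q_idem q_mem)
  show "x - q (- I) x \<in> copart UNIV" if "x \<in> copart I" for x
  proof -
    have x: "x \<in> X" "q I x = 0" using that by (auto simp: copart_def)
    have "q UNIV x = q (- I) x" using q_Un[of x I "- I"] x by simp
    then show ?thesis using x X(1) by (simp add: copart_def q_diff q_mem q_Int subspace_diff)
  qed
  show "q (- I) a = a" if "a \<in> part (- I)" for a using that by (simp add: mem_part)
  have sub: "q J b = 0" if "b \<in> copart UNIV" for b J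
    using that q_Int[of b J UNIV] by (auto simp: copart_def q_zero)
  then show "q (- I) b = 0" if "b \<in> copart UNIV" for b using that .
  show "copart UNIV \<subseteq> copart I" using sub by (auto simp: copart_def)
  show "part (- I) \<subseteq> copart I"
  proof
    fix x assume "x \<in> part (- I)"
    then have x: "x \<in> X" "q (- I) x = x" by (auto simp: mem_part)
    then have "q I x = q (I \<inter> - I) x" using q_Int[of x I "- I"] by simp
    then show "x \<in> copart I" using x by (simp add: copart_def q_empty)
  qed
qed (use part_subspace copart_subspace in auto)

lemma q_Diff: "x \<in> X \<Longrightarrow> q (I - J) x = q I x - q (I \<inter> J) x"
proof -
  assume "x \<in> X"
  moreover have "(I - J) \<inter> (I \<inter> J) = {}" by auto
  ultimately show ?thesis using q_Un[of x "I - J" "I \<inter> J"] by (simp add: Un_Diff_Int)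
qed

lemma C_nonneg: "x \<in> X \<Longrightarrow> x \<noteq> 0 \<Longrightarrow> 0 \<le> C"
proof -
  assume "x \<in> X" "x \<noteq> 0"
  then have "0 \<le> C * norm x" using q_norm[of x UNIV] norm_ge_zero order_trans by blast
  then show "0 \<le> C" using \<open>x \<noteq> 0\<close> by (simp add: zero_le_mult_iff)
qed

text \<open>Continuity of the projections in the index set, uniformly over all index sets. If
  \<open>I\<close> and \<open>J\<close> agree below \<open>n\<close>, only the tail \<open>y\<close>
  of \<open>x\<close> contributes, and it is small for large \<open>n\<close>.\<close>

lemma q_uniform:
  assumes x: "x \<in> X" and e: "e > 0"
  shows "\<exists>n. \<forall>I J. I \<inter> {..<n} = J \<inter> {..<n} \<longrightarrow> norm (q I x - q J x) < e"
proof (cases "x = 0")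
  case True
  then show ?thesis using e by (simp add: q_zero)
next
  case False
  have C: "C \<ge> 0" using C_nonneg x False .
  have "(\<lambda>n. q UNIV x - q {..<n} x) \<longlonglongrightarrow> q UNIV x - q UNIV x"
    by (intro tendsto_diff tendsto_const q_lim x)
  then have lim: "(\<lambda>n. q UNIV x - q {..<n} x) \<longlonglongrightarrow> 0" by simp
  \<comment> \<open>\<open>C\<close> may be 0, hence \<open>C + 1\<close> in the denominator; the
    factor 2 accounts for the two terms \<open>q I y\<close> and \<open>q J y\<close>.\<close>
  have "e / (2 * (C + 1)) > 0" using C e by simp
  from LIMSEQ_D[OF lim this] obtain n where n: "norm (q UNIV x - q {..<n} x) < e / (2 * (C + 1))"
    by auto
  define y where "y = q UNIV x - q {..<n} x"
  have y: "y \<in> X" using x X(1) by (simp add: y_def q_mem subspace_diff)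
  have qy: "q I y = q (I - {..<n}) x" for I
    using x by (simp add: y_def q_diff q_mem q_Int q_Diff)
  have "norm (q I x - q J x) < e" if "I \<inter> {..<n} = J \<inter> {..<n}" for I J
  proof -
    have "q I x - q J x = q I y - q J y" using that x by (simp add: qy q_Diff)
    then have "norm (q I x - q J x) \<le> C * norm y + C * norm y"
      using norm_triangle_ineq4[of "q I y" "q J y"] q_norm[OF y, of I] q_norm[OF y, of J] by simp
    also have "\<dots> \<le> 2 * (C + 1) * norm y" by (simp add: algebra_simps)
    also have "\<dots> < e" using n C by (simp add: y_def field_simps)
    finally show ?thesis .
  qed
  then show ?thesis by blast
qed

lemma q_Int_lessThan_lim:
  assumes "x \<in> X"
  shows "(\<lambda>n. q (I \<inter> {..<n}) x) \<longlonglongrightarrow> q I x"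
proof (rule LIMSEQ_I)
  fix e :: real assume "e > 0"
  then obtain n where n: "\<forall>I J. I \<inter> {..<n} = J \<inter> {..<n} \<longrightarrow> norm (q I x - q J x) < e"
    using q_uniform[OF assms] by blast
  have "norm (q (I \<inter> {..<m}) x - q I x) < e" if "m \<ge> n" for m
  proof -
    have "(I \<inter> {..<m}) \<inter> {..<n} = I \<inter> {..<n}" using that by auto
    with n show ?thesis by blast
  qed
  then show "\<exists>n0. \<forall>n\<ge>n0. norm (q (I \<inter> {..<n}) x - q I x) < e" by blast
qed

lemma part_finite_isomorphic:
  fixes D :: "nat \<Rightarrow> 'd::real_normed_vector set"
  assumes fin: "\<And>n. finite_dimensional (part {n})"
    and D: "D 0 = {0}" "\<And>i. D (Suc i) \<simeq> D i \<times> (UNIV :: real set)" "\<And>i. subspace (D i)"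
  shows "\<exists>i. part {..<l} \<simeq> D i"
proof (induction l)
  case 0
  have "part {} = {0}" using subspace_0[OF X(1)] q_zero by (auto simp: mem_part q_empty)
  then show ?case using isomorphic_zero D(1) by (auto intro!: exI[of _ 0])
next
  case (Suc l)
  then obtain i where i: "part {..<l} \<simeq> D i" by blast
  obtain B where B: "finite B" "part {l} = span B" using fin unfolding finite_dimensional_def by blast
  \<comment> \<open>The span is seen as an extension of the zero space; this is the origin of the
    zero factor that is removed below.\<close>
  obtain j where j: "part {l} \<simeq> {0::'a} \<times> D j"
    using finite_extension_isomorphic[of "{0::'a}" B D] B D
    by (auto simp: subspace_single_0 span_insert_0)
  have DD: "\<exists>k. D i \<times> D j \<simeq> D k"
  proof (induction j)
    case 0
    then show ?case using isomorphic_Times_zero D(1) by auto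
  next
    case (Suc j)
    then obtain k where k: "D i \<times> D j \<simeq> D k" by blast
    have "D i \<times> D (Suc j) \<simeq> D i \<times> (D j \<times> (UNIV :: real set))"
      by (intro isomorphic_Times isomorphic_refl D)
    also have "\<dots> \<simeq> (D i \<times> D j) \<times> (UNIV :: real set)" by (rule isomorphic_Times_assoc')
    also have "\<dots> \<simeq> D k \<times> (UNIV :: real set)"
      by (intro isomorphic_Times isomorphic_refl k)
    also have "\<dots> \<simeq> D (Suc k)" using D by (intro isomorphic_sym[OF D(2)])
    finally show ?case by blast
  qed
  then obtain k where k: "D i \<times> D j \<simeq> D k" by blast
  have "part {..<Suc l} \<simeq> part {..<l} \<times> part {l}"
    using part_Un_isomorphic[of "{..<l}" "{l}"] by (simp add: lessThan_Suc)
  also have "\<dots> \<simeq> D i \<times> ({0::'a} \<times> D j)" by (intro isomorphic_Times i j)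
  also have "\<dots> \<simeq> D i \<times> (D j \<times> {0::'a})"
    by (intro isomorphic_Times isomorphic_refl isomorphic_Times_commute)
  also have "\<dots> \<simeq> D i \<times> D j"
    by (intro isomorphic_Times isomorphic_refl isomorphic_Times_zero)
  also have "\<dots> \<simeq> D k" by (rule k)
  finally show ?case by blast
qed

end

text \<open>The projections are conjugated to the copy of \<open>Y\<close> in \<open>X\<close>.
  Since \<open>S\<close> undoes \<open>T\<close>, the conjugates multiply as before. If
  \<open>p UNIV\<close> is the identity on \<open>Y\<close>, the conjugate of index
  \<open>UNIV\<close> is a projection onto that copy.\<close>

lemma projection_algebra_retract:
  fixes X :: "'a::banach set" and Y :: "'b::banach set"
  assumes "projection_algebra Y p C" and X: "subspace X" "closed X"
    and T: "bdd_linear_on Y X T" and S: "bdd_linear_on X Y S" and ST: "\<And>y. y \<in> Y \<Longrightarrow> S (T y) = y"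
  shows "\<exists>C'. projection_algebra X (\<lambda>I x. T (p I (S x))) C'"
proof -
  interpret p: projection_algebra Y p C by fact
  obtain K where K: "K > 0" "\<And>y. y \<in> Y \<Longrightarrow> norm (T y) \<le> K * norm y" using bdd_linear_on_bound[OF T] by blast
  obtain L where L: "L > 0" "\<And>x. x \<in> X \<Longrightarrow> norm (S x) \<le> L * norm x" using bdd_linear_on_bound[OF S] by blast
  note TD = bdd_linear_onD[OF T] and SD = bdd_linear_onD[OF S]
  \<comment> \<open>The absolute value is taken because \<open>C\<close> may be negative when
    \<open>Y\<close> is the zero space.\<close>
  have "projection_algebra X (\<lambda>I x. T (p I (S x))) (K * (\<bar>C\<bar> * L))"
  proof
    fix x I J assume x: "x \<in> X"
    have Sx: "S x \<in> Y" using SD x by blast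
    show "T (p I (S x)) \<in> X" using TD p.q_mem Sx by blast
    show "T (p I (S (T (p J (S x))))) = T (p (I \<inter> J) (S x))" using ST p.q_mem p.q_Int Sx by simp
    show "norm (T (p I (S x))) \<le> K * (\<bar>C\<bar> * L) * norm x"
    proof -
      have "norm (T (p I (S x))) \<le> K * norm (p I (S x))" using K p.q_mem Sx by blast
      also have "\<dots> \<le> K * (\<bar>C\<bar> * norm (S x))"
      proof -
        have "C * norm (S x) \<le> \<bar>C\<bar> * norm (S x)" by (rule mult_right_mono) auto
        then show ?thesis using K(1) p.q_norm[OF Sx, of I] by simp
      qed
      also have "\<dots> \<le> K * (\<bar>C\<bar> * (L * norm x))"
        using K(1) L(2)[OF x] by (intro mult_left_mono) auto
      finally show ?thesis by (simp add: mult.assoc)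
    qed
    show "T (p (I \<union> J) (S x)) = T (p I (S x)) + T (p J (S x))" if "I \<inter> J = {}"
      using TD p.q_mem Sx p.q_Un[OF Sx that] by simp
    show "(\<lambda>n. T (p {..<n} (S x))) \<longlonglongrightarrow> T (p UNIV (S x))"
      using continuous_on_tendsto_compose[OF bdd_linear_on_continuous[OF T p.X(1)] p.q_lim[OF Sx]] Sx p.q_mem
      by simp
    show "T (p I (S (c *\<^sub>R x))) = c *\<^sub>R T (p I (S x))" for c
      using SD TD p.q_scale p.q_mem x by simp
    show "T (p I (S (x + y))) = T (p I (S x)) + T (p I (S y))" if "y \<in> X" for y
      using SD TD p.q_add p.q_mem x that by simp
  qed (fact X)+
  then show ?thesis by blast
qed

text \<open>Uniqueness of the expansion gives all algebraic laws: the coordinates of sums, multiples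
  and partial sums are identified by exhibiting a series. The unconditionality constant bounds the
  projections.\<close>

lemma projection_algebra_of_unconditional_decomposition:
  fixes Y :: "'a::banach set"
  assumes Y: "subspace Y" "closed Y" and dec: "unconditional_decomposition Y E"
  shows "\<exists>p C. projection_algebra Y p C \<and> (\<forall>x\<in>Y. p UNIV x = x) \<and> (\<forall>n. p {n} ` Y = E n)"
proof -
  have E: "subspace (E n)" "E n \<subseteq> Y" for n
    using dec by (auto simp: unconditional_decomposition_def schauder_decomposition_def closed_subspace_def)
  have ex1: "\<exists>!y. (\<forall>n. y n \<in> E n) \<and> y sums x" if "x \<in> Y" for x
    using dec that by (auto simp: unconditional_decomposition_def schauder_decomposition_def)
  obtain C where C: "\<And>x y. x \<in> Y \<Longrightarrow> (\<forall>n. y n \<in> E n) \<Longrightarrow> y sums x \<Longrightarrow> subseries_bounded_by (C * norm x) y"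
    using dec unfolding unconditional_decomposition_def by blast
  define c where "c x = (THE y. (\<forall>n. y n \<in> E n) \<and> y sums x)" for x
  have c: "c x n \<in> E n" "c x sums x" if "x \<in> Y" for x n
    using theI'[OF ex1[OF that]] by (auto simp: c_def)
  have c_eq: "c x = y" if "x \<in> Y" "\<And>n. y n \<in> E n" "y sums x" for x y
    using ex1[OF that(1)] c[OF that(1)] that by blast
  define p where "p I x = (\<Sum>n. if n \<in> I then c x n else 0)" for I x
  have bd: "summable (\<lambda>n. if n \<in> I then c x n else 0)" "norm (p I x) \<le> C * norm x" if "x \<in> Y" for x I
    using C[OF that] c[OF that] by (auto simp: subseries_bounded_by_def p_def)
  have p_sums: "(\<lambda>n. if n \<in> I then c x n else 0) sums p I x" if "x \<in> Y" for x I
    unfolding p_def using bd(1)[OF that] by (rule summable_sums)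
  have p_mem: "p I x \<in> Y" if x: "x \<in> Y" for x I
  proof (rule closed_sequentially[OF Y(2)])
    show "(\<lambda>n. \<Sum>i<n. if i \<in> I then c x i else 0) \<longlonglongrightarrow> p I x"
      using p_sums[OF x] by (simp add: sums_def)
    show "(\<Sum>i<n. if i \<in> I then c x i else 0) \<in> Y" for n
      using c(1)[OF x] E(2) Y(1) by (intro subspace_sum) (auto simp: subspace_0)
  qed
  have c_p: "c (p I x) = (\<lambda>n. if n \<in> I then c x n else 0)" if x: "x \<in> Y" for x I
    using c(1)[OF x] E(1) by (intro c_eq p_mem p_sums x) (auto simp: subspace_0)
  have c_add: "c (x + y) = (\<lambda>n. c x n + c y n)" if "x \<in> Y" "y \<in> Y" for x y
    using that c E Y by (intro c_eq sums_add) (auto simp: subspace_add)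
  have c_scale: "c (r *\<^sub>R x) = (\<lambda>n. r *\<^sub>R c x n)" if "x \<in> Y" for x r
    using that c E Y by (intro c_eq sums_scaleR_right) (auto simp: subspace_scale)
  have p_UNIV: "p UNIV x = x" if "x \<in> Y" for x
    using c(2)[OF that] by (simp add: p_def sums_iff)
  have "projection_algebra Y p C"
  proof
    fix x I J assume x: "x \<in> Y"
    show "p I x \<in> Y" "norm (p I x) \<le> C * norm x" using p_mem bd x by auto
    have "(\<lambda>n. if n \<in> I then if n \<in> J then c x n else 0 else 0) = (\<lambda>n. if n \<in> I \<inter> J then c x n else 0)" by auto
    then show "p I (p J x) = p (I \<inter> J) x" unfolding p_def[of I] p_def[of "I \<inter> J"] c_p[OF x] by simp
    show "p (I \<union> J) x = p I x + p J x" if "I \<inter> J = {}"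
    proof -
      have "(\<lambda>n. (if n \<in> I then c x n else 0) + (if n \<in> J then c x n else 0)) sums (p I x + p J x)"
        by (intro sums_add p_sums x)
      moreover have "(\<lambda>n. (if n \<in> I then c x n else 0) + (if n \<in> J then c x n else 0)) =
          (\<lambda>n. if n \<in> I \<union> J then c x n else 0)" by (rule ext) (use that in auto)
      ultimately show ?thesis using p_sums[OF x, of "I \<union> J"] sums_unique2 by metis
    qed
    have "p {..<n} x = (\<Sum>i<n. c x i)" for n
      using suminf_finite[of "{..<n}" "\<lambda>i. if i \<in> {..<n} then c x i else 0"] by (simp add: p_def)
    then show "(\<lambda>n. p {..<n} x) \<longlonglongrightarrow> p UNIV x" using c(2)[OF x] p_UNIV[OF x] by (simp add: sums_def)
    show "p I (r *\<^sub>R x) = r *\<^sub>R p I x" for r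
    proof -
      have "(\<lambda>n. r *\<^sub>R (if n \<in> I then c x n else 0)) sums (r *\<^sub>R p I x)"
        by (intro sums_scaleR_right p_sums x)
      moreover have "(\<lambda>n. r *\<^sub>R (if n \<in> I then c x n else 0)) = (\<lambda>n. if n \<in> I then c (r *\<^sub>R x) n else 0)"
        using c_scale[OF x] by auto
      ultimately show ?thesis by (simp add: p_def sums_iff)
    qed
    show "p I (x + y) = p I x + p I y" if y: "y \<in> Y" for y
    proof -
      have "(\<lambda>n. (if n \<in> I then c x n else 0) + (if n \<in> I then c y n else 0)) sums (p I x + p I y)"
        by (intro sums_add p_sums x y)
      moreover have "(\<lambda>n. (if n \<in> I then c x n else 0) + (if n \<in> I then c y n else 0)) =
          (\<lambda>n. if n \<in> I then c (x + y) n else 0)" using c_add[OF x y] by auto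
      ultimately show ?thesis by (simp add: p_def sums_iff)
    qed
  qed (fact Y)+
  moreover have "p {n} ` Y = E n" for n
  proof
    have p1: "p {n} x = c x n" for x
      using suminf_finite[of "{n}" "\<lambda>i. if i \<in> {n} then c x i else 0"] by (simp add: p_def)
    show "p {n} ` Y \<subseteq> E n" using c p1 by auto
    show "E n \<subseteq> p {n} ` Y"
    proof
      fix x assume x: "x \<in> E n"
      then have xY: "x \<in> Y" using E by blast
      have "(\<lambda>m. if m = n then x else 0) sums x" by (rule sums_single)
      then have "c x = (\<lambda>m. if m = n then x else 0)"
        using x E(1) by (intro c_eq xY) (auto simp: subspace_0)
      then have "p {n} x = x" using p1 by simp
      then show "x \<in> p {n} ` Y" using xY by (metis image_eqI)
    qed
  qed
  ultimately show ?thesis using p_UNIV by blast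
qed

lemma finite_dimensional_image:
  assumes "finite_dimensional E" "E \<subseteq> Y" "bdd_linear_on Y X T" "subspace Y"
  shows "finite_dimensional (T ` E)"
proof -
  obtain B where B: "finite B" "E = span B" using assms(1) unfolding finite_dimensional_def by blast
  note TD = bdd_linear_onD[OF assms(3)]
  have sub: "subspace (T ` E)"
    using assms(2-4) B(2) by (intro bdd_linear_on_image_subspace) auto
  have "x \<in> span B \<and> T x \<in> span (T ` B)" if "x \<in> span B" for x
    using that
  proof (induction rule: span_induct_alt)
    case base
    show ?case using bdd_linear_on_zero[OF assms(3,4)] by (simp add: span_zero)
  next
    case (step c x y)
    have "x \<in> E" "c *\<^sub>R x \<in> E" "y \<in> E"
      using step B(2) by (simp_all add: span_base span_scale)
    then have "x \<in> Y" "c *\<^sub>R x \<in> Y" "y \<in> Y" using assms(2) by auto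
    then have "T (c *\<^sub>R x + y) = c *\<^sub>R T x + T y" using TD by simp
    then show ?case using step by (simp add: span_add span_scale span_base)
  qed
  then have "T ` E \<subseteq> span (T ` B)" using B by blast
  moreover have "span (T ` B) \<subseteq> T ` E"
    using B span_superset by (intro span_minimal sub image_mono) auto
  ultimately show ?thesis using B(1) unfolding finite_dimensional_def by blast
qed

lemma unconditional_basis_decomposition:
  fixes X :: "'a::banach set"
  assumes X: "subspace X" and basis: "unconditional_basis X e"
  shows "unconditional_decomposition X (\<lambda>n. span {e n})" "\<And>n. e n \<noteq> 0"
proof -
  have eX: "e n \<in> X" for n using basis by (auto simp: unconditional_basis_def schauder_basis_def)
  have ex1: "\<exists>!a. (\<lambda>n. a n *\<^sub>R e n) sums x" if "x \<in> X" for x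
    using basis that by (auto simp: unconditional_basis_def schauder_basis_def)
  have coef_unique: "a = b" if "x \<in> X" "(\<lambda>n. a n *\<^sub>R e n) sums x" "(\<lambda>n. b n *\<^sub>R e n) sums x" for x a b
    using ex1[OF that(1)] that(2,3) by (elim ex1E) metis
  obtain C where C: "\<And>x a. x \<in> X \<Longrightarrow> (\<lambda>n. a n *\<^sub>R e n) sums x \<Longrightarrow>
      subseries_bounded_by (C * norm x) (\<lambda>n. a n *\<^sub>R e n)"
    using basis unfolding unconditional_basis_def by blast
  have mem: "y \<in> span {e n} \<longleftrightarrow> (\<exists>a. y = a *\<^sub>R e n)" for y n
    by (auto simp: span_singleton)
  have ne: "e n \<noteq> 0" for n
  proof
    assume "e n = 0"
    \<comment> \<open>A zero basis vector would give 0 two different expansions.\<close>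
    then have "(\<lambda>m. (if m = n then 1 else 0) *\<^sub>R e m) = (\<lambda>m. 0)" by auto
    then have 1: "(\<lambda>m. (if m = n then 1 else 0) *\<^sub>R e m) sums 0" by simp
    have 2: "(\<lambda>m. 0 *\<^sub>R e m) sums 0" by simp
    have "(\<lambda>m. (if m = n then 1 else 0 :: real)) = (\<lambda>m. 0)"
      by (rule coef_unique[OF subspace_0[OF X] 1 2])
    from fun_cong[OF this, of n] show False by simp
  qed
  have coef: "\<exists>a. y = (\<lambda>n. a n *\<^sub>R e n)" if "\<forall>n. y n \<in> span {e n}" for y
    using that unfolding mem by metis
  have "closed_subspace (span {e n}) X" for n
  proof -
    have ins: "span (insert (e n) {0}) = span {e n}"
      by (metis insert_commute span_insert_0)
    have "{0::'a} \<times> (UNIV :: real set) \<simeq> span {e n}"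
      using closed_insert_isomorphic[of "{0::'a}" "e n"] ne
      by (simp add: ins subspace_single_0)
    then have "closed (span {e n})"
      by (rule isomorphic_closed) (auto intro: subspace_Times closed_Times subspace_single_0)
    then show ?thesis using eX X by (simp add: closed_subspace_def span_minimal)
  qed
  moreover have "\<exists>!y. (\<forall>n. y n \<in> span {e n}) \<and> y sums x" if x: "x \<in> X" for x
  proof -
    obtain a where a: "(\<lambda>n. a n *\<^sub>R e n) sums x" using ex1[OF x] by blast
    show ?thesis
    proof (rule ex1I)
      show "(\<forall>n. a n *\<^sub>R e n \<in> span {e n}) \<and> (\<lambda>n. a n *\<^sub>R e n) sums x"
        using a mem by blast
      fix y assume y: "(\<forall>n. y n \<in> span {e n}) \<and> y sums x"
      then obtain b where b: "y = (\<lambda>n. b n *\<^sub>R e n)" using coef by blast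
      then have "b = a" using y a ex1[OF x] by blast
      then show "y = (\<lambda>n. a n *\<^sub>R e n)" using b by simp
    qed
  qed
  moreover have "subseries_bounded_by (C * norm x) y"
    if xy: "x \<in> X" "\<forall>n. y n \<in> span {e n}" "y sums x" for x y
  proof -
    obtain b where b: "y = (\<lambda>n. b n *\<^sub>R e n)" using coef xy by blast
    then show ?thesis using C xy by blast
  qed
  ultimately show "unconditional_decomposition X (\<lambda>n. span {e n})"
    unfolding unconditional_decomposition_def schauder_decomposition_def by blast
  show "\<And>n. e n \<noteq> 0" by (rule ne)
qed

subsection \<open>The isomorphism relation between ranges of projections\<close>

text \<open>Separability in enumerated form: the indices serve as labels of operators.\<close>

definition dense_sequence :: "'a::metric_space set \<Rightarrow> (nat \<Rightarrow> 'a) \<Rightarrow> bool" where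
  "dense_sequence S d \<longleftrightarrow> range d \<subseteq> S \<and> S \<subseteq> closure (range d)"

lemma dense_sequenceD:
  assumes "dense_sequence S d" "x \<in> S" "e > 0"
  shows "\<exists>k. dist x (d k) < e"
proof -
  have "x \<in> closure (range d)" using assms by (auto simp: dense_sequence_def)
  then show ?thesis using assms(3) by (auto simp: closure_approachable dist_commute)
qed

lemma dense_sequence_mem: "dense_sequence S d \<Longrightarrow> d k \<in> S"
  by (auto simp: dense_sequence_def)

lemma dense_sequenceI:
  assumes "\<And>k. d k \<in> S" "\<And>x e. x \<in> S \<Longrightarrow> e > 0 \<Longrightarrow> \<exists>k. dist x (d k) < e"
  shows "dense_sequence S d"
  using assms by (auto simp: dense_sequence_def closure_approachable dist_commute)

text \<open>The sequence \<open>d\<close> may miss \<open>T\<close> altogether. For each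
  \<open>k\<close> and \<open>m\<close> a point of \<open>T\<close> within \<open>1 / Suc m\<close>
  of \<open>d k\<close> is chosen if there is one.\<close>

lemma dense_sequence_subset:
  assumes d: "dense_sequence S d" and T: "T \<subseteq> S" "T \<noteq> {}"
  shows "\<exists>d'. dense_sequence T d'"
proof -
  obtain t0 where t0: "t0 \<in> T" using T by blast
  define P where "P k m y \<longleftrightarrow> y \<in> T \<and> dist (d k) y < 1 / real (Suc m)" for k m y
  have PT: "P k m y \<Longrightarrow> y \<in> T" for k m y by (simp add: P_def)
  define d' where "d' n = (case prod_decode n of (k, m) \<Rightarrow> if \<exists>y. P k m y then (SOME y. P k m y) else t0)" for n
  have "dense_sequence T d'"
  proof (rule dense_sequenceI)
    show "d' n \<in> T" for n
    proof -
      obtain k m where km: "prod_decode n = (k, m)" by fastforce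
      show ?thesis
      proof (cases "\<exists>y. P k m y")
        case True
        then have "P k m (SOME y. P k m y)" by (rule someI_ex)
        then have "(SOME y. P k m y) \<in> T" by (rule PT)
        then show ?thesis using True km by (simp add: d'_def)
      next
        case False
        then have "d' n = t0" unfolding d'_def km by (simp only: prod.case if_False)
        then show ?thesis using t0 by simp
      qed
    qed
    show "\<exists>n. dist x (d' n) < e" if x: "x \<in> T" "e > 0" for x e
    proof -
      obtain m where m: "1 / real (Suc m) < e / 2" using nat_approx_posE[of "e / 2"] x(2) by auto
      obtain k where k: "dist x (d k) < 1 / real (Suc m)"
        using dense_sequenceD[OF d, of x "1 / real (Suc m)"] x T by auto
      have "P k m x" using x k by (simp add: P_def dist_commute)
      then have "P k m (SOME y. P k m y)" by (rule someI)
      moreover have "d' (prod_encode (k, m)) = (SOME y. P k m y)"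
        using \<open>P k m x\<close> by (auto simp: d'_def)
      ultimately have "dist (d k) (d' (prod_encode (k, m))) < 1 / real (Suc m)" by (simp add: P_def)
      then have "dist x (d' (prod_encode (k, m))) < e"
        using k m dist_triangle[of x "d' (prod_encode (k, m))" "d k"] by linarith
      then show ?thesis by blast
    qed
  qed
  then show ?thesis by blast
qed

lemma dense_sequence_Times:
  assumes d: "dense_sequence S d" and h: "dense_sequence T h"
  shows "\<exists>f. dense_sequence (S \<times> T) f"
proof -
  have "dense_sequence (S \<times> T) (\<lambda>n. (d (fst (prod_decode n)), h (snd (prod_decode n))))"
  proof (rule dense_sequenceI)
    fix p e assume p: "p \<in> S \<times> T" and e: "(e::real) > 0"
    obtain k where k: "dist (fst p) (d k) < e / 2" using dense_sequenceD[OF d, of "fst p" "e / 2"] p e by auto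
    obtain m where m: "dist (snd p) (h m) < e / 2" using dense_sequenceD[OF h, of "snd p" "e / 2"] p e by auto
    have "dist p (d k, h m) \<le> dist (fst p) (d k) + dist (snd p) (h m)"
      by (cases p) (simp add: dist_Pair_Pair sqrt_sum_squares_le_sum)
    then have "dist p (d k, h m) < e" using k m by linarith
    then show "\<exists>n. dist p (d (fst (prod_decode n)), h (snd (prod_decode n))) < e"
      by (intro exI[of _ "prod_encode (k, m)"]) simp
  qed (use dense_sequence_mem[OF d] dense_sequence_mem[OF h] in auto)
  then show ?thesis by blast
qed

section \<open>Strong limits of uniformly bounded operators\<close>

definition linear_on_le :: "'a::real_normed_vector set \<Rightarrow> 'b::real_normed_vector set \<Rightarrow> real \<Rightarrow> ('a \<Rightarrow> 'b) \<Rightarrow> bool" where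
  "linear_on_le U V K f \<longleftrightarrow> f ` U \<subseteq> V \<and> (\<forall>x\<in>U. \<forall>y\<in>U. f (x + y) = f x + f y) \<and>
     (\<forall>c. \<forall>x\<in>U. f (c *\<^sub>R x) = c *\<^sub>R f x) \<and> (\<forall>x\<in>U. norm (f x) \<le> K * norm x)"

lemma linear_on_le_bdd: "linear_on_le U V K f \<Longrightarrow> bdd_linear_on U V f"
  by (auto simp: linear_on_le_def bdd_linear_on_def)

lemma linear_on_le_norm: "linear_on_le U V K f \<Longrightarrow> x \<in> U \<Longrightarrow> norm (f x) \<le> K * norm x"
  by (auto simp: linear_on_le_def)

lemma bdd_linear_on_le_nat:
  assumes "bdd_linear_on U V f"
  shows "\<exists>n0. \<forall>n\<ge>n0. linear_on_le U V (real n) f"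
proof -
  obtain K where K: "\<And>x. x \<in> U \<Longrightarrow> norm (f x) \<le> K * norm x" using bdd_linear_on_bound[OF assms] by blast
  obtain n0 where n0: "K \<le> real n0" using real_arch_simple by blast
  have "norm (f x) \<le> real n * norm x" if "x \<in> U" "n \<ge> n0" for x n
    using K[OF that(1)] mult_right_mono[of K "real n" "norm x"] n0 that(2) by simp
  then show ?thesis using assms unfolding linear_on_le_def bdd_linear_on_def by blast
qed

text \<open>The common bound makes the operators equicontinuous, so convergence on a dense sequence
  spreads to \<open>U\<close> and the bound survives in the limit.\<close>

lemma linear_on_le_pointwise_limit:
  fixes f :: "nat \<Rightarrow> 'a::real_normed_vector \<Rightarrow> 'b::banach"
  assumes U: "subspace U" and V: "closed V" and d: "dense_sequence U d"
    and f: "\<And>n. linear_on_le U V K (f n)" and K: "K \<ge> 0" and cau: "\<And>k. Cauchy (\<lambda>n. f n (d k))"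
  shows "\<exists>g. linear_on_le U V K g \<and> (\<forall>x\<in>U. (\<lambda>n. f n x) \<longlonglongrightarrow> g x)"
proof -
  have conv: "convergent (\<lambda>n. f n x)" if x: "x \<in> U" for x
  proof -
    have "Cauchy (\<lambda>n. f n x)"
    proof (rule metric_CauchyI)
      fix e :: real assume e: "e > 0"
      then have "e / (3 * (K + 1)) > 0" using K by simp
      then obtain k where k: "dist x (d k) < e / (3 * (K + 1))" using dense_sequenceD[OF d x] by blast
      have dk: "d k \<in> U" using d by (rule dense_sequence_mem)
      have *: "dist (f n x) (f n (d k)) < e / 3" for n
      proof -
        have "dist (f n x) (f n (d k)) = norm (f n (x - d k))"
          using bdd_linear_on_diff[OF linear_on_le_bdd[OF f] U x dk] by (simp add: dist_norm)
        also have "\<dots> \<le> K * norm (x - d k)"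
          using linear_on_le_norm[OF f] x dk U by (simp add: subspace_diff)
        also have "\<dots> \<le> (K + 1) * norm (x - d k)" by (simp add: algebra_simps)
        also have "\<dots> < e / 3" using k K by (simp add: dist_norm field_simps)
        finally show ?thesis .
      qed
      obtain M where M: "\<And>m n. m \<ge> M \<Longrightarrow> n \<ge> M \<Longrightarrow> dist (f m (d k)) (f n (d k)) < e / 3"
        using metric_CauchyD[OF cau[of k], of "e / 3"] e by auto
      have "dist (f m x) (f n x) < e" if "m \<ge> M" "n \<ge> M" for m n
      proof -
        have "dist (f m x) (f n x) \<le> dist (f m x) (f m (d k)) + dist (f m (d k)) (f n (d k)) + dist (f n (d k)) (f n x)"
          using dist_triangle[of "f m x" "f n x" "f m (d k)"] dist_triangle[of "f m (d k)" "f n x" "f n (d k)"]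
          by linarith
        then show ?thesis using *[of m] *[of n] M[OF that] by (simp add: dist_commute)
      qed
      then show "\<exists>M. \<forall>m\<ge>M. \<forall>n\<ge>M. dist (f m x) (f n x) < e" by blast
    qed
    then show ?thesis by (rule Cauchy_convergent)
  qed
  define g where "g x = lim (\<lambda>n. f n x)" for x
  have g: "(\<lambda>n. f n x) \<longlonglongrightarrow> g x" if "x \<in> U" for x
    using conv[OF that] by (simp add: g_def convergent_LIMSEQ_iff)
  have "g x \<in> V" if "x \<in> U" for x
    by (rule closed_sequentially[OF V _ g[OF that]]) (rule bdd_linear_onD(1)[OF linear_on_le_bdd[OF f] that])
  moreover have "g (x + y) = g x + g y" if "x \<in> U" "y \<in> U" for x y
  proof (rule LIMSEQ_unique)
    show "(\<lambda>n. f n (x + y)) \<longlonglongrightarrow> g (x + y)" using that U by (intro g subspace_add)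
    have "(\<lambda>n. f n x + f n y) \<longlonglongrightarrow> g x + g y" by (intro tendsto_add g that)
    then show "(\<lambda>n. f n (x + y)) \<longlonglongrightarrow> g x + g y"
      using bdd_linear_onD(2)[OF linear_on_le_bdd[OF f] that] by simp
  qed
  moreover have "g (c *\<^sub>R x) = c *\<^sub>R g x" if "x \<in> U" for x c
  proof (rule LIMSEQ_unique)
    show "(\<lambda>n. f n (c *\<^sub>R x)) \<longlonglongrightarrow> g (c *\<^sub>R x)" using that U by (intro g subspace_scale)
    have "(\<lambda>n. c *\<^sub>R f n x) \<longlonglongrightarrow> c *\<^sub>R g x" by (intro tendsto_scaleR tendsto_const g that)
    then show "(\<lambda>n. f n (c *\<^sub>R x)) \<longlonglongrightarrow> c *\<^sub>R g x"
      using bdd_linear_onD(3)[OF linear_on_le_bdd[OF f] that] by simp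
  qed
  moreover have "norm (g x) \<le> K * norm x" if "x \<in> U" for x
    by (rule LIMSEQ_le_const2[OF tendsto_norm[OF g[OF that]]]) (use linear_on_le_norm[OF f that] in blast)
  ultimately show ?thesis using g unfolding linear_on_le_def by blast
qed

text \<open>The form in which stabilised labels are used: a label eventually constant confines the
  values to one ball of radius \<open>1 / Suc j\<close>.\<close>

lemma Cauchy_if_eventually_near:
  fixes f :: "nat \<Rightarrow> 'a::metric_space"
  assumes "\<And>j. \<exists>M y. \<forall>n\<ge>M. dist (f n) y < 1 / real (Suc j)"
  shows "Cauchy f"
proof (rule metric_CauchyI)
  fix e :: real assume "e > 0"
  then obtain j where j: "1 / real (Suc j) < e / 2" using nat_approx_posE[of "e / 2"] by auto
  obtain M y where M: "\<forall>n\<ge>M. dist (f n) y < 1 / real (Suc j)" using assms by blast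
  have "dist (f m) (f n) < e" if "m \<ge> M" "n \<ge> M" for m n
    using M[rule_format, OF that(1)] M[rule_format, OF that(2)] j dist_triangle2[of "f m" "f n" y]
    by linarith
  then show "\<exists>M. \<forall>m\<ge>M. \<forall>n\<ge>M. dist (f m) (f n) < e" by blast
qed

text \<open>
  The operators act on the whole spaces and not only on the ranges of \<open>P\<close> and \<open>Q\<close>, because
  pointwise limits will be taken while these ranges vary.
\<close>

definition isomorphism_witness ::
    "'c::banach set \<Rightarrow> 'd::banach set \<Rightarrow> ('c \<Rightarrow> 'c) \<Rightarrow> ('d \<Rightarrow> 'd) \<Rightarrow> ('c \<Rightarrow> 'd) \<times> ('d \<Rightarrow> 'c) \<times> nat \<Rightarrow> bool" where
  "isomorphism_witness U V P Q = (\<lambda>(S, S', K). linear_on_le U V (real K) S \<and> linear_on_le V U (real K) S' \<and>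
     (\<forall>x\<in>U. S' (S x) = P x) \<and> (\<forall>y\<in>V. S (S' y) = Q y))"

text \<open>An isomorphism of the ranges is precomposed with the projections. Conversely
  \<open>Q (S x) = S (S' (S x)) = S (P x)\<close>, so \<open>S\<close> maps the range of
  \<open>P\<close> into that of \<open>Q\<close>, and \<open>S'\<close> inverts it there.\<close>

lemma isomorphic_iff_witness:
  fixes U :: "'c::banach set" and V :: "'d::banach set"
  assumes U: "subspace U" and V: "subspace V"
    and P: "bdd_linear_on U U P" "\<And>x. x \<in> U \<Longrightarrow> P (P x) = P x"
    and Q: "bdd_linear_on V V Q" "\<And>x. x \<in> V \<Longrightarrow> Q (Q x) = Q x"
  shows "P ` U \<simeq> Q ` V \<longleftrightarrow> (\<exists>w. isomorphism_witness U V P Q w)"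
proof
  have PU: "P ` U \<subseteq> U" "\<And>x. x \<in> P ` U \<Longrightarrow> P x = x" and QV: "Q ` V \<subseteq> V" "\<And>x. x \<in> Q ` V \<Longrightarrow> Q x = x"
    using P Q by (auto simp: bdd_linear_on_def)
  have range_sub: "subspace (p ` W)" if "bdd_linear_on W W p" "subspace W" for p and W :: "'z::banach set"
    using that by (intro bdd_linear_on_image_subspace) auto
  show "\<exists>w. isomorphism_witness U V P Q w" if iso: "P ` U \<simeq> Q ` V"
  proof -
    obtain T T' where T: "bdd_linear_on (P ` U) (Q ` V) T" "bdd_linear_on (Q ` V) (P ` U) T'"
      "\<And>x. x \<in> P ` U \<Longrightarrow> T' (T x) = x" "\<And>y. y \<in> Q ` V \<Longrightarrow> T (T' y) = y"
      using isomorphic_spacesE[OF iso range_sub[OF P(1) U]] by metis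
    define S S' where "S x = T (P x)" and "S' y = T' (Q y)" for x y
    have P': "bdd_linear_on U (P ` U) P" and Q': "bdd_linear_on V (Q ` V) Q"
      using P(1) Q(1) by (auto intro: bdd_linear_on_mono)
    have S: "bdd_linear_on U (Q ` V) S" and S': "bdd_linear_on V (P ` U) S'"
      unfolding S_def S'_def
      by (rule bdd_linear_on_compose[OF P' T(1)], rule bdd_linear_on_compose[OF Q' T(2)])
    have "bdd_linear_on U V S" "bdd_linear_on V U S'"
      using bdd_linear_on_compose[OF S bdd_linear_on_id[OF QV(1)]]
        bdd_linear_on_compose[OF S' bdd_linear_on_id[OF PU(1)]] by auto
    then obtain m n where mn: "\<forall>k\<ge>m. linear_on_le U V (real k) S" "\<forall>k\<ge>n. linear_on_le V U (real k) S'"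
      using bdd_linear_on_le_nat by metis
    have "S' (S x) = P x" if "x \<in> U" for x
      using that T(1,3) QV(2)[of "T (P x)"] bdd_linear_onD(1)[OF T(1), of "P x"] by (simp add: S_def S'_def)
    moreover have "S (S' y) = Q y" if "y \<in> V" for y
      using that T(2,4) PU(2)[of "T' (Q y)"] bdd_linear_onD(1)[OF T(2), of "Q y"] by (simp add: S_def S'_def)
    ultimately have "isomorphism_witness U V P Q (S, S', max m n)"
      using mn by (simp add: isomorphism_witness_def)
    then show ?thesis by blast
  qed
  show "P ` U \<simeq> Q ` V" if wit: "\<exists>w. isomorphism_witness U V P Q w"
  proof -
    obtain S S' and K :: nat where W: "linear_on_le U V (real K) S" "linear_on_le V U (real K) S'"
      "\<And>x. x \<in> U \<Longrightarrow> S' (S x) = P x" "\<And>y. y \<in> V \<Longrightarrow> S (S' y) = Q y"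
      using wit by (auto simp: isomorphism_witness_def)
    have SU: "S x \<in> V" if "x \<in> U" for x using W(1) that by (auto simp: linear_on_le_def)
    have SV: "S' x \<in> U" if "x \<in> V" for x using W(2) that by (auto simp: linear_on_le_def)
    have SQ: "S x \<in> Q ` V" if "x \<in> P ` U" for x
    proof -
      have x: "x \<in> U" "P x = x" using subsetD[OF PU(1) that] PU(2)[OF that] .
      have "Q (S x) = S (S' (S x))" using W(4) SU x by simp
      also have "\<dots> = S x" using W(3) x by simp
      finally show ?thesis using SU[OF x(1)] by (metis imageI)
    qed
    have SP: "S' y \<in> P ` U" if "y \<in> Q ` V" for y
    proof -
      have y: "y \<in> V" "Q y = y" using subsetD[OF QV(1) that] QV(2)[OF that] .
      have "P (S' y) = S' (S (S' y))" using W(3) SV y by simp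
      also have "\<dots> = S' y" using W(4) y by simp
      finally show ?thesis using SV[OF y(1)] by (metis imageI)
    qed
    have S: "bdd_linear_on (P ` U) (Q ` V) S"
      by (rule bdd_linear_on_mono[OF linear_on_le_bdd[OF W(1)] PU(1)]) (rule image_subsetI, rule SQ)
    have S': "bdd_linear_on (Q ` V) (P ` U) S'"
      by (rule bdd_linear_on_mono[OF linear_on_le_bdd[OF W(2)] QV(1)]) (rule image_subsetI, rule SP)
    show ?thesis
    proof (rule isomorphic_spacesI[OF S S' range_sub[OF P(1) U] range_sub[OF Q(1) V]])
      show "S' (S x) = x" if "x \<in> P ` U" for x
        using W(3)[of x] subsetD[OF PU(1) that] PU(2)[OF that] by simp
      show "S (S' y) = y" if "y \<in> Q ` V" for y
        using W(4)[of y] subsetD[OF QV(1) that] QV(2)[OF that] by simp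
    qed
  qed
qed

text \<open>
  The labels of a witness are a norm bound and the indices of approximations to the values of the
  two operators on dense sequences; they determine the operators.
\<close>

definition witness_label :: "(nat \<Rightarrow> 'c::banach) \<Rightarrow> (nat \<Rightarrow> 'd::banach) \<Rightarrow> nat \<Rightarrow>
    ('c \<Rightarrow> 'd) \<times> ('d \<Rightarrow> 'c) \<times> nat \<Rightarrow> nat" where
  "witness_label d h i = (\<lambda>(S, S', K).
     (case prod_decode i of (t, u) \<Rightarrow> case prod_decode u of (k, j) \<Rightarrow>
        if t = 0 then K
        else if t = 1 then (LEAST m. dist (S (d k)) (h m) < 1 / real (Suc j))
        else (LEAST m. dist (S' (h k)) (d m) < 1 / real (Suc j))))"

text \<open>Composition is jointly continuous for strong convergence on bounded sets of operators,
  because \<open>g n\<close> magnifies the error \<open>f n x - f' x\<close> by at most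
  \<open>K\<close>.\<close>

lemma linear_on_le_compose_limit:
  assumes x: "x \<in> Y" and f: "\<And>n. linear_on_le Y Z K (f n)" and g: "\<And>n. linear_on_le Z W K (g n)"
    and f': "linear_on_le Y Z K f'" and fl: "(\<lambda>n. f n x) \<longlonglongrightarrow> f' x"
    and gl: "(\<lambda>n. g n (f' x)) \<longlonglongrightarrow> g' (f' x)" and Z: "subspace Z"
  shows "(\<lambda>n. g n (f n x)) \<longlonglongrightarrow> g' (f' x)"
proof -
  have mem: "f n x \<in> Z" "f' x \<in> Z" for n
    using bdd_linear_onD(1)[OF linear_on_le_bdd[OF f] x] bdd_linear_onD(1)[OF linear_on_le_bdd[OF f'] x] .
  have le: "\<forall>n. norm (g n (f n x) - g n (f' x)) \<le> K * norm (f n x - f' x)"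
  proof
    fix n
    show "norm (g n (f n x) - g n (f' x)) \<le> K * norm (f n x - f' x)"
    using linear_on_le_norm[OF g[of n], of "f n x - f' x"] mem Z
      bdd_linear_on_diff[OF linear_on_le_bdd[OF g[of n]] Z mem(1)[of n] mem(2)] by (simp add: subspace_diff)
  qed
  have "(\<lambda>n. f n x - f' x) \<longlonglongrightarrow> 0" using fl by (rule LIM_zero)
  then have "(\<lambda>n. K * norm (f n x - f' x)) \<longlonglongrightarrow> 0"
    by (intro tendsto_mult_right_zero tendsto_norm_zero)
  then have lim0: "(\<lambda>n. g n (f n x) - g n (f' x)) \<longlonglongrightarrow> 0"
    by (rule Lim_null_comparison[OF always_eventually[OF le]])
  have "(\<lambda>n. (g n (f n x) - g n (f' x)) + g n (f' x)) \<longlonglongrightarrow> 0 + g' (f' x)"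
    by (rule tendsto_add[OF lim0 gl])
  then show ?thesis by simp
qed

text \<open>Stabilised labels fix the norm bound and make both operators converge on the dense
  sequences, hence strongly. The two witness equations pass to the limit.\<close>

lemma isomorphism_witness_limit:
  fixes U :: "'c::banach set" and V :: "'d::banach set"
  assumes U: "subspace U" "closed U" "dense_sequence U d" and V: "subspace V" "closed V" "dense_sequence V h"
    and W: "\<And>n. isomorphism_witness U V (P n) (Q n) (w n)"
    and lab: "\<And>n i. i < n \<Longrightarrow> witness_label d h i (w n) = v i"
    and P: "\<And>x. x \<in> U \<Longrightarrow> (\<lambda>n. P n x) \<longlonglongrightarrow> P' x" and Q: "\<And>x. x \<in> V \<Longrightarrow> (\<lambda>n. Q n x) \<longlonglongrightarrow> Q' x"
  shows "\<exists>w. isomorphism_witness U V P' Q' w"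
proof -
  define S0 S0' K0 where "S0 n = fst (w n)" and "S0' n = fst (snd (w n))" and "K0 n = snd (snd (w n))" for n
  then have w: "w n = (S0 n, S0' n, K0 n)" for n by simp
  define K where "K = v 0"
  have K0: "K0 n = K" if "n > 0" for n
  proof -
    \<comment> \<open>Index 0 codes the label of type 0, the norm bound. It is known from
      \<open>n = 1\<close> on, so the sequence is shifted by one below.\<close>
    have "prod_encode (0, 0) = 0" by (simp add: prod_encode_def)
    then have "prod_decode 0 = (0, 0)" by (metis prod_encode_inverse)
    then show ?thesis using lab[OF that] by (simp add: w witness_label_def K_def)
  qed
  define S S' where "S n = S0 (Suc n)" and "S' n = S0' (Suc n)" for n
  have SW: "linear_on_le U V (real K) (S n)" "linear_on_le V U (real K) (S' n)"
    "\<And>x. x \<in> U \<Longrightarrow> S' n (S n x) = P (Suc n) x" "\<And>y. y \<in> V \<Longrightarrow> S n (S' n y) = Q (Suc n) y" for n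
    using W[of "Suc n"] K0[of "Suc n"] by (auto simp: w isomorphism_witness_def S_def S'_def)
  have SU: "S n x \<in> V" if "x \<in> U" for x n using SW(1)[of n] that by (auto simp: linear_on_le_def)
  have SV: "S' n x \<in> U" if "x \<in> V" for x n using SW(2)[of n] that by (auto simp: linear_on_le_def)
  have "Cauchy (\<lambda>n. S n (d k))" for k
  proof (rule Cauchy_if_eventually_near)
    fix j
    define i where "i = prod_encode (1, prod_encode (k, j))"
    have "dist (S n (d k)) (h (v i)) < 1 / real (Suc j)" if "n \<ge> i" for n
    proof -
      have "\<exists>m. dist (S n (d k)) (h m) < 1 / real (Suc j)"
        using dense_sequenceD[OF V(3) SU[OF dense_sequence_mem[OF U(3)]]] by simp
      then have "dist (S n (d k)) (h (LEAST m. dist (S n (d k)) (h m) < 1 / real (Suc j))) < 1 / real (Suc j)"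
        by (rule LeastI_ex)
      moreover have "v i = (LEAST m. dist (S n (d k)) (h m) < 1 / real (Suc j))"
        using lab[of i "Suc n"] that by (simp add: w witness_label_def i_def S_def)
      ultimately show ?thesis by simp
    qed
    then show "\<exists>M y. \<forall>n\<ge>M. dist (S n (d k)) y < 1 / real (Suc j)" by blast
  qed
  then obtain T where T: "linear_on_le U V (real K) T" "\<And>x. x \<in> U \<Longrightarrow> (\<lambda>n. S n x) \<longlonglongrightarrow> T x"
    using linear_on_le_pointwise_limit[OF U(1) V(2) U(3), of "real K" S] SW(1) by auto
  have "Cauchy (\<lambda>n. S' n (h k))" for k
  proof (rule Cauchy_if_eventually_near)
    fix j
    define i where "i = prod_encode (2, prod_encode (k, j))"
    have "dist (S' n (h k)) (d (v i)) < 1 / real (Suc j)" if "n \<ge> i" for n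
    proof -
      have "\<exists>m. dist (S' n (h k)) (d m) < 1 / real (Suc j)"
        using dense_sequenceD[OF U(3) SV[OF dense_sequence_mem[OF V(3)]]] by simp
      then have "dist (S' n (h k)) (d (LEAST m. dist (S' n (h k)) (d m) < 1 / real (Suc j))) < 1 / real (Suc j)"
        by (rule LeastI_ex)
      moreover have "v i = (LEAST m. dist (S' n (h k)) (d m) < 1 / real (Suc j))"
        using lab[of i "Suc n"] that by (simp add: w witness_label_def i_def S'_def)
      ultimately show ?thesis by simp
    qed
    then show "\<exists>M y. \<forall>n\<ge>M. dist (S' n (h k)) y < 1 / real (Suc j)" by blast
  qed
  then obtain T' where T': "linear_on_le V U (real K) T'" "\<And>x. x \<in> V \<Longrightarrow> (\<lambda>n. S' n x) \<longlonglongrightarrow> T' x"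
    using linear_on_le_pointwise_limit[OF V(1) U(2) V(3), of "real K" S'] SW(2) by auto
  have "T' (T x) = P' x" if x: "x \<in> U" for x
  proof (rule LIMSEQ_unique)
    have "T x \<in> V" using T(1) x by (auto simp: linear_on_le_def)
    then show "(\<lambda>n. S' n (S n x)) \<longlonglongrightarrow> T' (T x)"
      by (intro linear_on_le_compose_limit[where Y = U and Z = V and W = U and K = "real K" and f = S and g = S' and f' = T and g' = T']
          x SW(1,2) T T'(2) V(1))
    show "(\<lambda>n. S' n (S n x)) \<longlonglongrightarrow> P' x" using LIMSEQ_Suc[OF P[OF x]] SW(3)[OF x] by simp
  qed
  moreover have "T (T' y) = Q' y" if y: "y \<in> V" for y
  proof (rule LIMSEQ_unique)
    have "T' y \<in> U" using T'(1) y by (auto simp: linear_on_le_def)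
    then show "(\<lambda>n. S n (S' n y)) \<longlonglongrightarrow> T (T' y)"
      by (intro linear_on_le_compose_limit[where Y = V and Z = U and W = V and K = "real K" and f = S' and g = S and f' = T' and g' = T]
          y SW(1,2) T(2) T' U(1))
    show "(\<lambda>n. S n (S' n y)) \<longlonglongrightarrow> Q' y" using LIMSEQ_Suc[OF Q[OF y]] SW(4)[OF y] by simp
  qed
  ultimately have "isomorphism_witness U V P' Q' (T, T', K)"
    using T(1) T'(1) by (simp add: isomorphism_witness_def)
  then show ?thesis by blast
qed

text \<open>Agreement below \<open>l 0\<close> keeps a point in the cylinder where the relation is
  comeager; agreement on infinitely many blocks keeps it off the meager exceptional set.\<close>

definition matches :: "(nat \<Rightarrow> nat) \<Rightarrow> nat set \<Rightarrow> nat set \<Rightarrow> bool" where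
  "matches l A I \<longleftrightarrow> I \<inter> {..<l 0} = A \<inter> {..<l 0} \<and>
     (\<exists>\<^sub>\<infinity>n. I \<inter> {l n..<l (Suc n)} = A \<inter> {l n..<l (Suc n)})"

text \<open>A pair of index sets is one sequence over a four-letter alphabet, so category in the
  product needs no separate treatment.\<close>

abbreviation left_set :: "(nat \<Rightarrow> bool \<times> bool) \<Rightarrow> nat set" where
  "left_set x \<equiv> {i. fst (x i)}"

abbreviation right_set :: "(nat \<Rightarrow> bool \<times> bool) \<Rightarrow> nat set" where
  "right_set x \<equiv> {i. snd (x i)}"

text \<open>By the Baire property the relation holds in a cylinder off a meager set, which a block
  pattern avoids. With the right set following the pattern everywhere, a left set needs to follow it
  only on infinitely many blocks.\<close>

lemma pattern_of_nonmeager_isomorphism: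
  fixes U :: "'c::banach set" and V :: "'d::banach set"
  assumes U: "subspace U" "closed U" "dense_sequence U d" and V: "subspace V" "closed V" "dense_sequence V h"
    and P: "\<And>I. bdd_linear_on U U (P I)" "\<And>I x. x \<in> U \<Longrightarrow> P I (P I x) = P I x"
    and Q: "\<And>I. bdd_linear_on V V (Q I)" "\<And>I x. x \<in> V \<Longrightarrow> Q I (Q I x) = Q I x"
    and P_cont: "\<And>x e. x \<in> U \<Longrightarrow> e > 0 \<Longrightarrow>
      \<exists>n. \<forall>I J. I \<inter> {..<n} = J \<inter> {..<n} \<longrightarrow> norm (P I x - P J x) < e"
    and Q_cont: "\<And>x e. x \<in> V \<Longrightarrow> e > 0 \<Longrightarrow>
      \<exists>n. \<forall>I J. I \<inter> {..<n} = J \<inter> {..<n} \<longrightarrow> norm (Q I x - Q J x) < e"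
    and nonmeager: "\<not> meager_seqs {x. P (left_set x) ` U \<simeq> Q (right_set x) ` V}"
  shows "\<exists>A B l. strict_mono l \<and> (\<forall>I. matches l A I \<longrightarrow> P I ` U \<simeq> Q B ` V)"
proof -
  define W where "W x = isomorphism_witness U V (P (left_set x)) (Q (right_set x))" for x
  have iff: "P (left_set x) ` U \<simeq> Q (right_set x) ` V \<longleftrightarrow> (\<exists>w. W x w)" for x
    unfolding W_def using U V P Q by (intro isomorphic_iff_witness)
  have lim: "(\<lambda>n. R (J n) x) \<longlonglongrightarrow> R I x"
    if cont: "\<And>e. e > 0 \<Longrightarrow> \<exists>n. \<forall>I J. I \<inter> {..<n} = J \<inter> {..<n} \<longrightarrow> norm (R I x - R J x) < e"
      and J: "\<And>n. J n \<inter> {..<n} = I \<inter> {..<n}"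
    for R :: "nat set \<Rightarrow> 'z::banach \<Rightarrow> 'z" and J I x
  proof (rule LIMSEQ_I)
    fix e :: real assume "e > 0"
    then obtain n where n: "\<forall>I J. I \<inter> {..<n} = J \<inter> {..<n} \<longrightarrow> norm (R I x - R J x) < e" using cont by blast
    have "norm (R (J m) x - R I x) < e" if "m \<ge> n" for m
    proof -
      have "J m \<inter> {..<n} = (J m \<inter> {..<m}) \<inter> {..<n}" using that by auto
      also have "\<dots> = I \<inter> {..<n}" using that by (auto simp: J)
      finally show ?thesis using n by blast
    qed
    then show "\<exists>n. \<forall>m\<ge>n. norm (R (J m) x - R I x) < e" by blast
  qed
  have "\<exists>s. meager_seqs {x \<in> cylinder s. \<nexists>w. W x w}"
  proof (rule nonmeager_labelled_relation[where lab = "witness_label d h"])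
    fix x xs ws v
    assume ws: "\<And>n. W (xs n) (ws n)" and xs: "\<And>n i. i < n \<Longrightarrow> xs n i = x i"
      and v: "\<And>n i. i < n \<Longrightarrow> witness_label d h i (ws n) = v i"
    have J: "left_set (xs n) \<inter> {..<n} = left_set x \<inter> {..<n}"
      "right_set (xs n) \<inter> {..<n} = right_set x \<inter> {..<n}" for n using xs[of _ n] by auto
    show "\<exists>w. W x w"
      unfolding W_def
      by (rule isomorphism_witness_limit[OF U V ws[unfolded W_def] v])
        (auto intro!: lim[of P] lim[of Q] P_cont Q_cont J)
    next
    show "\<not> meager_seqs {x. \<exists>w. W x w}" using nonmeager unfolding iff .
  qed
  then obtain s where s: "meager_seqs {x \<in> cylinder s. \<nexists>w. W x w}" by blast
  obtain a and l :: "nat \<Rightarrow> nat" where l: "strict_mono l"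
    "\<And>x. (\<exists>\<^sub>\<infinity>n. \<forall>i\<in>{l n..<l (Suc n)}. x i = a i) \<Longrightarrow> x \<notin> {x \<in> cylinder s. \<nexists>w. W x w}"
    using meager_avoided_by_pattern[OF s] by blast
  define m where "m = length s"
  \<comment> \<open>The stem \<open>s\<close> of the cylinder overrides the pattern below
    \<open>m\<close>. Dropping the first \<open>m\<close> blocks makes all remaining ones start at
    \<open>m\<close> or later, as \<open>l m\<close> is at least \<open>m\<close>.\<close>
  define a' where "a' i = (if i < m then s ! i else a i)" for i
  define l' where "l' n = l (n + m)" for n
  define A B where "A = left_set a'" and "B = right_set a'"
  have sl: "strict_mono l'" using l(1) by (simp add: l'_def strict_mono_def)
  have l'm: "l' n \<ge> m" for n
    unfolding l'_def using strict_mono_imp_increasing[OF l(1), of "n + m"] by simp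
  have "P I ` U \<simeq> Q B ` V" if I: "matches l' A I" for I
  proof -
    define x where "x i = (i \<in> I, i \<in> B)" for i
    have "left_set x = I" "right_set x = B" by (auto simp: x_def)
    have x_eq: "x i = a' i \<longleftrightarrow> (i \<in> I \<longleftrightarrow> i \<in> A)" for i
      by (auto simp: x_def A_def B_def prod_eq_iff)
    have "x \<in> cylinder s"
      unfolding mem_cylinder
    proof (intro allI impI)
      fix i assume "i < length s"
      then have "i < l' 0" using l'm[of 0] by (simp add: m_def)
      then have "i \<in> I \<longleftrightarrow> i \<in> A" using I by (auto simp: matches_def)
      then have "x i = a' i" using x_eq by blast
      then show "x i = s ! i" using \<open>i < length s\<close> by (simp add: a'_def m_def)
    qed
    moreover have "\<exists>\<^sub>\<infinity>n. \<forall>i\<in>{l n..<l (Suc n)}. x i = a i"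
      unfolding INFM_nat
    proof
      fix k
      obtain n where n: "n > k" "I \<inter> {l' n..<l' (Suc n)} = A \<inter> {l' n..<l' (Suc n)}"
        using I unfolding matches_def INFM_nat by blast
      have "x i = a i" if i: "i \<in> {l (n + m)..<l (Suc (n + m))}" for i
      proof -
        have i': "i \<in> {l' n..<l' (Suc n)}" using i by (simp add: l'_def)
        then have "i \<in> I \<longleftrightarrow> i \<in> A" using n(2) by blast
        then have "x i = a' i" using x_eq by blast
        moreover have "i \<ge> m" using i' l'm[of n] by simp
        ultimately show ?thesis by (simp add: a'_def)
      qed
      then show "\<exists>n>k. \<forall>i\<in>{l n..<l (Suc n)}. x i = a i"
        using n(1) by (intro exI[of _ "n + m"]) auto
    qed
    ultimately have "\<exists>w. W x w" using l(2)[of x] by blast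
    then show ?thesis using iff[of x] \<open>left_set x = I\<close> \<open>right_set x = B\<close> by simp
  qed
  with sl show ?thesis by blast
qed

subsection \<open>Absorption from a pattern\<close>

lemma matches_uminus: "matches l (- A) I \<longleftrightarrow> matches l A (- I)"
proof -
  have "I \<inter> S = - A \<inter> S \<longleftrightarrow> - I \<inter> S = A \<inter> S" for S :: "nat set" by blast
  then show ?thesis by (simp add: matches_def)
qed

context projection_algebra
begin

text \<open>\<open>I\<close> and its enlargement by \<open>K\<close> yield the same space
  \<open>Z\<close>, and they differ by the summand \<open>part K\<close>.\<close>

lemma absorb_step:
  fixes D :: "'d::real_normed_vector set" and Z :: "'z::real_normed_vector set"
  assumes I: "part I \<times> D \<simeq> Z" "part (I \<union> K) \<times> D \<simeq> Z"
    and disj: "I \<inter> K = {}" and D: "subspace D"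
  shows "Z \<times> part K \<simeq> Z"
proof -
  have "Z \<times> part K \<simeq> (part I \<times> D) \<times> part K"
    using I(1) D part_subspace
    by (intro isomorphic_Times isomorphic_refl isomorphic_sym[OF I(1)] subspace_Times)
  also have "\<dots> \<simeq> (part I \<times> part K) \<times> D" by (rule isomorphic_Times_right_commute)
  also have "\<dots> \<simeq> part (I \<union> K) \<times> D"
    by (intro isomorphic_Times isomorphic_refl isomorphic_sym[OF part_Un_isomorphic[OF disj]] part_subspace)
  also have "\<dots> \<simeq> Z" by (rule I(2))
  finally show ?thesis .
qed

text \<open>
  The blocks are split into even and odd ones: each half of \<open>K\<close> can be added to a set that
  matches the pattern on the blocks of the other parity.
\<close>

lemma absorb_of_pattern:
  fixes D :: "'d::real_normed_vector set" and Z :: "'z::real_normed_vector set"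
  assumes l: "strict_mono l" and D: "subspace D"
    and Z: "\<And>I. matches l A I \<Longrightarrow> part I \<times> D \<simeq> Z"
    and K: "K \<subseteq> {l 0..}"
  shows "(part UNIV \<times> D) \<times> part K \<simeq> part UNIV \<times> D"
proof -
  define blocks where "blocks e = (\<Union>n\<in>{n. even n = e}. {l n..<l (Suc n)})" for e
  have disj_block: "{l n..<l (Suc n)} \<inter> {l k..<l (Suc k)} = {}" if "n < k" for n k
    using that l strict_mono_less_eq[OF l, of "Suc n" k] by auto
  have blocks_disj: "blocks e \<inter> {l n..<l (Suc n)} = {}" if "even n \<noteq> e" for e n
  proof -
    have "{l k..<l (Suc k)} \<inter> {l n..<l (Suc n)} = {}" if "even k = e" for k
      using disj_block[of n k] disj_block[of k n] that \<open>even n \<noteq> e\<close> by (cases n k rule: linorder_cases) auto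
    then show ?thesis unfolding blocks_def by blast
  qed
  have blocks_sup: "{l n..<l (Suc n)} \<subseteq> blocks e" if "even n = e" for e n
    using that by (auto simp: blocks_def)
  \<comment> \<open>The pattern on the initial segment and on the blocks of one parity; the other
    blocks are left empty as room for additions.\<close>
  define I where "I e = A \<inter> ({..<l 0} \<union> blocks e)" for e
  have m: "matches l A (I e \<union> L)" if L: "L \<subseteq> {l 0..}" "L \<inter> blocks e = {}" for e L
    unfolding matches_def
  proof
    have "l 0 \<le> i" if "l n \<le> i" for n i
      using strict_mono_less_eq[OF l, of 0 n] that by simp
    then have "blocks e \<inter> {..<l 0} = {}" by (fastforce simp: blocks_def)
    then show "(I e \<union> L) \<inter> {..<l 0} = A \<inter> {..<l 0}" using L(1) by (auto simp: I_def)
    have "(I e \<union> L) \<inter> {l n..<l (Suc n)} = A \<inter> {l n..<l (Suc n)}" if "even n = e" for n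
    proof -
      have "l 0 \<le> l n" using strict_mono_less_eq[OF l, of 0 n] by simp
      then have "{..<l 0} \<inter> {l n..<l (Suc n)} = {}" by auto
      then show ?thesis using blocks_sup[OF that] L(2) by (auto simp: I_def)
    qed
    moreover have "\<exists>n>k. even n = e" for k :: nat
      by (cases e) (auto intro: exI[of _ "2 * k + 2"] exI[of _ "2 * k + 1"])
    ultimately show "\<exists>\<^sub>\<infinity>n. (I e \<union> L) \<inter> {l n..<l (Suc n)} = A \<inter> {l n..<l (Suc n)}"
      unfolding INFM_nat by metis
  qed
  have Z_half: "Z \<times> part L \<simeq> Z" if L: "L \<subseteq> {l 0..}" "L \<inter> blocks e = {}" for L e
  proof (rule absorb_step[where I = "I e"])
    show "part (I e) \<times> D \<simeq> Z" using Z[OF m[of "{}"]] by simp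
    show "part (I e \<union> L) \<times> D \<simeq> Z" by (rule Z[OF m[OF L]])
    show "I e \<inter> L = {}" using L by (auto simp: I_def)
  qed (rule D)
  have subZ: "subspace Z"
    using isomorphic_subspace[OF Z[OF m[of "{}"]]] by (simp add: subspace_Times part_subspace D)
  have Z_absorb: "Z \<times> part L \<simeq> Z" if L: "L \<subseteq> {l 0..}" for L
  proof -
    \<comment> \<open>\<open>L1\<close> avoids the odd blocks and \<open>L2\<close> the even ones,
      so each can be added to the base set that lives on the blocks it avoids.\<close>
    define L1 L2 where "L1 = L \<inter> blocks True" and "L2 = L - blocks True"
    have "blocks True \<inter> {l n..<l (Suc n)} = {}" if "even n = False" for n
      using blocks_disj[of n True] that by simp
    then have "blocks True \<inter> blocks False = {}" unfolding blocks_def[of False] by blast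
    then have L12: "L1 \<inter> blocks False = {}" "L2 \<inter> blocks True = {}" "L1 \<inter> L2 = {}" "L = L1 \<union> L2"
      "L1 \<subseteq> {l 0..}" "L2 \<subseteq> {l 0..}" using L by (auto simp: L1_def L2_def)
    have "Z \<times> part L \<simeq> Z \<times> (part L1 \<times> part L2)"
      unfolding L12(4) by (intro isomorphic_Times isomorphic_refl part_Un_isomorphic L12)
    also have "\<dots> \<simeq> (Z \<times> part L1) \<times> part L2" by (rule isomorphic_Times_assoc')
    also have "\<dots> \<simeq> Z \<times> part L2"
      by (intro isomorphic_Times isomorphic_refl Z_half[of L1 False] L12)
    also have "\<dots> \<simeq> Z" by (rule Z_half[of L2 True]) (use L12 in auto)
    finally show ?thesis .
  qed
  \<comment> \<open>\<open>Z\<close> absorbs what \<open>I True\<close> misses from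
    \<open>l 0\<close> on. The finite set \<open>F\<close> of indices missed below
    \<open>l 0\<close> is out of reach, so \<open>part F\<close> is carried along as a further
    summand.\<close>
  define F K0 where "F = - I True \<inter> {..<l 0}" and "K0 = - I True \<inter> {l 0..}"
  have FK: "- I True = F \<union> K0" "F \<inter> K0 = {}" "I True \<inter> (F \<union> K0) = {}" "UNIV = I True \<union> (F \<union> K0)"
    by (auto simp: F_def K0_def)
  have top: "part UNIV \<times> D \<simeq> Z \<times> part F"
  proof -
    have "part UNIV \<simeq> part (I True) \<times> part (F \<union> K0)"
      using part_Un_isomorphic[OF FK(3)] FK(4) by simp
    also have "\<dots> \<simeq> part (I True) \<times> (part F \<times> part K0)"
      by (intro isomorphic_Times isomorphic_refl part_Un_isomorphic FK)
    finally have "part UNIV \<times> D \<simeq> (part (I True) \<times> (part F \<times> part K0)) \<times> D"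
      by (intro isomorphic_Times isomorphic_refl)
    also have "\<dots> \<simeq> (part (I True) \<times> D) \<times> (part F \<times> part K0)"
      by (rule isomorphic_Times_right_commute)
    also have "\<dots> \<simeq> Z \<times> (part F \<times> part K0)"
      using Z[OF m[of "{}" True]] by (intro isomorphic_Times isomorphic_refl) simp
    also have "\<dots> \<simeq> (Z \<times> part F) \<times> part K0" by (rule isomorphic_Times_assoc')
    also have "\<dots> \<simeq> (Z \<times> part K0) \<times> part F" by (rule isomorphic_Times_right_commute)
    also have "\<dots> \<simeq> Z \<times> part F"
      by (intro isomorphic_Times isomorphic_refl Z_absorb) (auto simp: K0_def)
    finally show ?thesis .
  qed
  have "(part UNIV \<times> D) \<times> part K \<simeq> (Z \<times> part F) \<times> part K"
    by (intro isomorphic_Times isomorphic_refl top)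
  also have "\<dots> \<simeq> (Z \<times> part K) \<times> part F" by (rule isomorphic_Times_right_commute)
  also have "\<dots> \<simeq> Z \<times> part F"
    by (intro isomorphic_Times isomorphic_refl Z_absorb K)
  also have "\<dots> \<simeq> part UNIV \<times> D"
    by (intro isomorphic_sym[OF top] subspace_Times part_subspace D)
  finally show ?thesis .
qed

definition half :: "bool \<Rightarrow> nat set \<Rightarrow> 'a set" where
  "half e I = (if e then copart I else part I)"

definition half_proj :: "bool \<Rightarrow> nat set \<Rightarrow> 'a \<Rightarrow> 'a" where
  "half_proj e I x = (if e then x - q I x else q I x)"

lemma half_proj_bdd_linear: "bdd_linear_on X X (half_proj e I)"
proof (cases e)
  case True
  then have "half_proj e I = (\<lambda>x. x - q I x)" by (auto simp: half_proj_def)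
  then show ?thesis using bdd_linear_on_minus[OF bdd_linear_on_id q_bdd_linear X(1)] by simp
next
  case False
  then have "half_proj e I = q I" by (auto simp: half_proj_def)
  then show ?thesis using q_bdd_linear by simp
qed

lemma half_proj_idem: "x \<in> X \<Longrightarrow> half_proj e I (half_proj e I x) = half_proj e I x"
  by (simp add: half_proj_def q_diff q_mem q_idem)

lemma half_proj_image: "half_proj e I ` X = half e I"
proof (cases e)
  case True
  have "(\<lambda>x. x - q I x) ` X = copart I"
  proof
    show "(\<lambda>x. x - q I x) ` X \<subseteq> copart I"
      using X(1) by (auto simp: copart_def q_diff q_mem q_idem subspace_diff)
    show "copart I \<subseteq> (\<lambda>x. x - q I x) ` X"
    proof
      fix x assume "x \<in> copart I"
      then have "x = x - q I x" "x \<in> X" by (auto simp: copart_def)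
      then show "x \<in> (\<lambda>x. x - q I x) ` X" by (rule image_eqI)
    qed
  qed
  then show ?thesis using True by (simp add: half_proj_def half_def)
qed (simp add: half_proj_def half_def part_def)

lemma half_proj_cont:
  assumes "x \<in> X" "e > 0"
  shows "\<exists>n. \<forall>I J. I \<inter> {..<n} = J \<inter> {..<n} \<longrightarrow> norm (half_proj c I x - half_proj c J x) < e"
proof -
  have "norm (half_proj c I x - half_proj c J x) = norm (q I x - q J x)" for I J
    by (auto simp: half_proj_def norm_minus_commute)
  then show ?thesis using q_uniform[OF assms] by simp
qed

text \<open>Here the fixed summand of the pattern argument is the complement
  \<open>copart UNIV\<close>. If the pattern is one for kernels, passing to complementary index sets
  turns it into one for parts with this summand.\<close>

lemma absorb_of_nonmeager_halves:
  assumes d: "dense_sequence X d"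
    and nonmeager: "\<not> meager_seqs {x. half e (left_set x) \<simeq> half c (right_set x)}"
  shows "\<exists>l. \<forall>K\<subseteq>{l..}. X \<times> part K \<simeq> X"
proof -
  obtain A B and l :: "nat \<Rightarrow> nat" where l: "strict_mono l"
    "\<And>I. matches l A I \<Longrightarrow> half e I \<simeq> half c B"
    using pattern_of_nonmeager_isomorphism[where U = X and V = X and P = "half_proj e" and Q = "half_proj c",
        OF X d X d half_proj_bdd_linear half_proj_idem half_proj_bdd_linear half_proj_idem
        half_proj_cont half_proj_cont] nonmeager
    by (auto simp: half_proj_image)
  have sub: "subspace (half e' I)" for e' I by (simp add: half_def part_subspace copart_subspace)
  have XX: "X \<simeq> part UNIV \<times> copart UNIV" by (rule part_copart_isomorphic)
  \<comment> \<open>The two cases have to deliver a space of the same type; this is why a zero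
    factor is attached in the first.\<close>
  have "\<exists>A' (Z :: ('a \<times> 'a) set). \<forall>I. matches l A' I \<longrightarrow> part I \<times> copart UNIV \<simeq> Z"
  proof (cases e)
    case True
    have "part I \<times> copart UNIV \<simeq> half c B \<times> {0::'a}" if "matches l (- A) I" for I
    proof -
      have "part I \<times> copart UNIV \<simeq> copart (- I)"
        using isomorphic_sym[OF copart_isomorphic[of "- I"] copart_subspace] by simp
      also have "\<dots> \<simeq> half c B"
        using l(2)[of "- I"] that True by (simp add: matches_uminus half_def)
      also have "\<dots> \<simeq> half c B \<times> {0::'a}"
        by (intro isomorphic_sym[OF isomorphic_Times_zero] subspace_Times sub subspace_single_0)
      finally show ?thesis .
    qed
    then show ?thesis by blast
  next
    case False
    have "part I \<times> copart UNIV \<simeq> half c B \<times> copart UNIV" if "matches l A I" for I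
      using l(2)[OF that] False by (intro isomorphic_Times isomorphic_refl) (simp add: half_def)
    then show ?thesis by blast
  qed
  then obtain A' and Z :: "('a \<times> 'a) set"
    where Z: "\<And>I. matches l A' I \<Longrightarrow> part I \<times> copart UNIV \<simeq> Z" by blast
  have "X \<times> part K \<simeq> X" if "K \<subseteq> {l 0..}" for K
  proof -
    have "X \<times> part K \<simeq> (part UNIV \<times> copart UNIV) \<times> part K"
      by (intro isomorphic_Times isomorphic_refl XX)
    also have "\<dots> \<simeq> part UNIV \<times> copart UNIV"
      by (rule absorb_of_pattern[OF l(1) copart_subspace Z that])
    also have "\<dots> \<simeq> X" by (rule isomorphic_sym[OF XX X(1)])
    finally show ?thesis .
  qed
  then show ?thesis by blast
qed

text \<open>Here the fixed summand is \<open>D\<close>; the projections act as \<open>q I\<close> on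
  the first coordinate and as the identity on the second. The complement \<open>copart UNIV\<close>
  is added only after the absorption.\<close>

lemma absorb_of_nonmeager_parts:
  fixes D D' :: "'d::banach set"
  assumes d: "dense_sequence X d"
    and D: "subspace D" "closed D" "dense_sequence D h" and D': "subspace D'" "closed D'" "dense_sequence D' h'"
    and nonmeager: "\<not> meager_seqs {x. part (left_set x) \<times> D \<simeq> part (right_set x) \<times> D'}"
  shows "\<exists>l. \<forall>K\<subseteq>{l..}. (X \<times> D) \<times> part K \<simeq> X \<times> D"
proof -
  define P where "P I p = (q I (fst p), snd p)" for I and p :: "'a \<times> 'd"
  have P_lin: "bdd_linear_on (X \<times> E) (X \<times> E) (P I)" for I and E :: "'d set"
    unfolding P_def by (intro bdd_linear_on_Pair bdd_linear_on_compose[OF bdd_linear_on_fst q_bdd_linear] bdd_linear_on_snd)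
  have P_idem: "P I (P I p) = P I p" if "p \<in> X \<times> E" for I p and E :: "'d set"
    using that by (auto simp: P_def q_idem)
  have P_image: "P I ` (X \<times> E) = part I \<times> E" for I and E :: "'d set"
    by (force simp: P_def part_def)
  have P_cont: "\<exists>n. \<forall>I J. I \<inter> {..<n} = J \<inter> {..<n} \<longrightarrow> norm (P I p - P J p) < e"
    if "p \<in> X \<times> E" "e > 0" for p e and E :: "'d set"
    using q_uniform[of "fst p" e] that by (simp add: P_def mem_Times_iff norm_Pair)
  obtain f where f: "dense_sequence (X \<times> D) f" using dense_sequence_Times[OF d D(3)] by blast
  obtain f' where f': "dense_sequence (X \<times> D') f'" using dense_sequence_Times[OF d D'(3)] by blast
  obtain A B and l :: "nat \<Rightarrow> nat" where l: "strict_mono l"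
    "\<And>I. matches l A I \<Longrightarrow> part I \<times> D \<simeq> part B \<times> D'"
    using pattern_of_nonmeager_isomorphism[where U = "X \<times> D" and V = "X \<times> D'" and P = P and Q = P,
        OF subspace_Times[OF X(1) D(1)] closed_Times[OF X(2) D(2)] f
        subspace_Times[OF X(1) D'(1)] closed_Times[OF X(2) D'(2)] f'
        P_lin P_idem[where E = D] P_lin P_idem[where E = D'] P_cont[where E = D] P_cont[where E = D']] nonmeager
    by (auto simp: P_image)
  have XX: "X \<simeq> part UNIV \<times> copart UNIV" by (rule part_copart_isomorphic)
  have XD: "X \<times> D \<simeq> (part UNIV \<times> D) \<times> copart UNIV"
  proof -
    have "X \<times> D \<simeq> (part UNIV \<times> copart UNIV) \<times> D"
      by (intro isomorphic_Times isomorphic_refl XX)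
    also have "\<dots> \<simeq> (part UNIV \<times> D) \<times> copart UNIV" by (rule isomorphic_Times_right_commute)
    finally show ?thesis .
  qed
  have "(X \<times> D) \<times> part K \<simeq> X \<times> D" if "K \<subseteq> {l 0..}" for K
  proof -
    have "(X \<times> D) \<times> part K \<simeq> ((part UNIV \<times> D) \<times> copart UNIV) \<times> part K"
      by (intro isomorphic_Times isomorphic_refl XD)
    also have "\<dots> \<simeq> ((part UNIV \<times> D) \<times> part K) \<times> copart UNIV"
      by (rule isomorphic_Times_right_commute)
    also have "\<dots> \<simeq> (part UNIV \<times> D) \<times> copart UNIV"
      by (intro isomorphic_Times isomorphic_refl absorb_of_pattern[OF l(1) D(1) l(2) that])
    also have "\<dots> \<simeq> X \<times> D" by (intro isomorphic_sym[OF XD] subspace_Times X D)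
    finally show ?thesis .
  qed
  then show ?thesis by blast
qed

end

subsection \<open>Reductions from meager relations\<close>

text \<open>\<open>m i\<close> is meant as the number of the block of \<open>i\<close>. Where
  \<open>\<alpha>\<close> has 1 and \<open>\<beta>\<close> has 0, the two codes together realise the
  pair \<open>a\<close>, \<open>b\<close> on that block.\<close>

definition code :: "(nat \<Rightarrow> nat) \<Rightarrow> nat set \<Rightarrow> nat set \<Rightarrow> (nat \<Rightarrow> bool) \<Rightarrow> nat set" where
  "code m a b \<alpha> = {i. if \<alpha> (m i) then i \<in> a else i \<in> b}"

text \<open>If two sequences differ infinitely often, one of the two orders of the bits recurs
  infinitely often. The codes taken in that order match the avoiding pattern, and symmetry of
  \<open>R\<close> covers the other order.\<close>

lemma code_of_meager_relation:
  assumes "meager_seqs {x. R (left_set x) (right_set x)}" and sym: "\<And>I J. R I J \<Longrightarrow> R J I"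
  shows "\<exists>m a b. (\<forall>n. finite {i. m i \<le> n}) \<and> (\<forall>\<alpha> \<beta>. \<not> E0 \<alpha> \<beta> \<longrightarrow> \<not> R (code m a b \<alpha>) (code m a b \<beta>))"
proof -
  obtain p and l :: "nat \<Rightarrow> nat" where l: "strict_mono l"
    "\<And>x. \<exists>\<^sub>\<infinity>n. \<forall>i\<in>{l n..<l (Suc n)}. x i = p i \<Longrightarrow> x \<notin> {x. R (left_set x) (right_set x)}"
    using meager_avoided_by_pattern[OF assms(1)] by blast
  \<comment> \<open>Indices below \<open>l 0\<close> are assigned to block 0, which keeps every
    block finite.\<close>
  define m where "m i = (LEAST n. i < l (Suc n))" for i
  have m_eq: "m i = n" if "i \<in> {l n..<l (Suc n)}" for i n
    unfolding m_def
  proof (rule Least_equality)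
    show "i < l (Suc n)" using that by simp
    fix k assume "i < l (Suc k)"
    then have "l n < l (Suc k)" using that by simp
    then show "n \<le> k" using l(1) by (simp add: strict_mono_less)
  qed
  have fin: "finite {i. m i \<le> n}" for n
  proof (rule finite_subset)
    show "{i. m i \<le> n} \<subseteq> {..<l (Suc n)}"
    proof
      fix i assume i: "i \<in> {i. m i \<le> n}"
      have "i < l (Suc i)" using strict_mono_imp_increasing[OF l(1), of "Suc i"] by simp
      then have "i < l (Suc (m i))" unfolding m_def by (rule LeastI)
      also have "\<dots> \<le> l (Suc n)" using i l(1) by (simp add: strict_mono_less_eq)
      finally show "i \<in> {..<l (Suc n)}" by simp
    qed
  qed simp
  define a b where "a = left_set p" and "b = right_set p"
  have neg: "\<not> R (code m a b \<alpha>) (code m a b \<beta>)" if "\<exists>\<^sub>\<infinity>n. \<alpha> n \<and> \<not> \<beta> n" for \<alpha> \<beta>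
  proof -
    define x where "x i = (i \<in> code m a b \<alpha>, i \<in> code m a b \<beta>)" for i
    have "\<forall>i\<in>{l n..<l (Suc n)}. x i = p i" if "\<alpha> n \<and> \<not> \<beta> n" for n
      using that by (auto simp: x_def code_def m_eq a_def b_def prod_eq_iff)
    then have "\<exists>\<^sub>\<infinity>n. \<forall>i\<in>{l n..<l (Suc n)}. x i = p i"
      using \<open>\<exists>\<^sub>\<infinity>n. \<alpha> n \<and> \<not> \<beta> n\<close> by (auto elim!: INFM_mono)
    then have "\<not> R (left_set x) (right_set x)" using l(2) by blast
    then show ?thesis by (simp add: x_def)
  qed
  have "\<not> R (code m a b \<alpha>) (code m a b \<beta>)" if "\<not> E0 \<alpha> \<beta>" for \<alpha> \<beta>
  proof -
    have "\<exists>\<^sub>\<infinity>n. \<alpha> n \<noteq> \<beta> n" using that by (auto simp: E0_def INFM_nat_le)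
    then have "\<exists>\<^sub>\<infinity>n. (\<alpha> n \<and> \<not> \<beta> n) \<or> (\<beta> n \<and> \<not> \<alpha> n)" by (rule INFM_mono) auto
    then show ?thesis using neg sym unfolding INFM_disj_distrib by blast
  qed
  with fin show ?thesis by blast
qed

lemma code_E0:
  assumes fin: "\<And>n. finite {i. m i \<le> n}" and "E0 \<alpha> \<beta>"
  shows "finite (code m a b \<alpha> - code m a b \<beta>)"
proof -
  obtain n where n: "\<forall>k\<ge>n. \<alpha> k = \<beta> k" using assms(2) by (auto simp: E0_def)
  have "code m a b \<alpha> - code m a b \<beta> \<subseteq> {i. m i \<le> n}"
  proof
    fix i assume i: "i \<in> code m a b \<alpha> - code m a b \<beta>"
    show "i \<in> {i. m i \<le> n}"
    proof (rule ccontr)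
      assume "i \<notin> {i. m i \<le> n}"
      then have "\<alpha> (m i) = \<beta> (m i)" using n by simp
      then show False using i by (simp add: code_def)
    qed
  qed
  then show ?thesis using fin finite_subset by blast
qed

subsection \<open>Measurability in the Effros-Borel structure\<close>

lemma effros_measurableI:
  assumes "\<And>w. w \<in> space M \<Longrightarrow> closed_subspace (f w) X"
    and "\<And>U. openin (top_of_set X) U \<Longrightarrow> {w \<in> space M. f w \<inter> U \<noteq> {}} \<in> sets M"
  shows "f \<in> M \<rightarrow>\<^sub>M effros X"
  unfolding effros_def
proof (rule measurable_measure_of)
  fix y assume "y \<in> {{F. closed_subspace F X \<and> F \<inter> U \<noteq> {}} | U. openin (top_of_set X) U}"
  then obtain U where U: "openin (top_of_set X) U" "y = {F. closed_subspace F X \<and> F \<inter> U \<noteq> {}}" by blast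
  have "f -` y \<inter> space M = {w \<in> space M. f w \<inter> U \<noteq> {}}" using assms(1) U(2) by auto
  then show "f -` y \<inter> space M \<in> sets M" using assms(2)[OF U(1)] by simp
qed (use assms(1) in auto)

lemma effros_hits_sets:
  assumes f: "f \<in> M \<rightarrow>\<^sub>M effros X" and U: "openin (top_of_set X) U"
  shows "{w \<in> space M. f w \<inter> U \<noteq> {}} \<in> sets M"
proof -
  have "{F. closed_subspace F X \<and> F \<inter> U \<noteq> {}} \<in> sets (effros X)"
    unfolding sets_effros using U by (intro sigma_sets.Basic) blast
  from measurable_sets[OF f this] have "f -` {F. closed_subspace F X \<and> F \<inter> U \<noteq> {}} \<inter> space M \<in> sets M" .
  also have "f -` {F. closed_subspace F X \<and> F \<inter> U \<noteq> {}} \<inter> space M = {w \<in> space M. f w \<inter> U \<noteq> {}}"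
    using measurable_space[OF f] by (auto simp: space_effros)
  finally show ?thesis .
qed

text \<open>By approximation and monotonicity, \<open>G (J w)\<close> meets an open set exactly if
  \<open>G S\<close> does for a finite subset \<open>S\<close> of \<open>J w\<close>. There are only
  countably many such \<open>S\<close>.\<close>

lemma effros_measurable_family:
  fixes G :: "nat set \<Rightarrow> 'a::real_normed_vector set"
  assumes G: "\<And>J. closed_subspace (G J) X" and mono: "\<And>I J. I \<subseteq> J \<Longrightarrow> G I \<subseteq> G J"
    and lim: "\<And>J x. x \<in> G J \<Longrightarrow> \<exists>y. (\<forall>n. y n \<in> G (J \<inter> {..<n})) \<and> y \<longlonglongrightarrow> x"
    and J: "\<And>i. {w \<in> space M. i \<in> J w} \<in> sets M"
  shows "(\<lambda>w. G (J w)) \<in> M \<rightarrow>\<^sub>M effros X"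
proof (rule effros_measurableI)
  fix U assume U: "openin (top_of_set X) U"
  define \<S> where "\<S> = {S. finite S \<and> G S \<inter> U \<noteq> {}}"
  have "countable \<S>"
    by (rule countable_subset[OF _ countable_Collect_finite]) (auto simp: \<S>_def)
  have "G I \<inter> U \<noteq> {} \<longleftrightarrow> (\<exists>S\<in>\<S>. S \<subseteq> I)" for I
  proof
    assume "G I \<inter> U \<noteq> {}"
    then obtain x where x: "x \<in> G I" "x \<in> U" by blast
    obtain T where T: "open T" "U = X \<inter> T" using U by (auto simp: openin_open)
    obtain y where y: "\<And>n. y n \<in> G (I \<inter> {..<n})" "y \<longlonglongrightarrow> x" using lim[OF x(1)] by blast
    have "\<forall>\<^sub>F n in sequentially. y n \<in> T" using topological_tendstoD[OF y(2) T(1)] x(2) T(2) by blast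
    then obtain n where "y n \<in> T" by (auto simp: eventually_sequentially)
    moreover have "y n \<in> X" using y(1)[of n] G by (auto simp: closed_subspace_def)
    ultimately have "I \<inter> {..<n} \<in> \<S>" using y(1)[of n] T(2) by (auto simp: \<S>_def)
    then show "\<exists>S\<in>\<S>. S \<subseteq> I" by blast
  next
    assume "\<exists>S\<in>\<S>. S \<subseteq> I"
    then obtain S where "G S \<inter> U \<noteq> {}" "S \<subseteq> I" by (auto simp: \<S>_def)
    then show "G I \<inter> U \<noteq> {}" using mono[of S I] by blast
  qed
  then have "{w \<in> space M. G (J w) \<inter> U \<noteq> {}} = (\<Union>S\<in>\<S>. {w \<in> space M. \<forall>i\<in>S. i \<in> J w})" by auto
  also have "\<dots> \<in> sets M"
  proof (rule sets.countable_UN''[OF \<open>countable \<S>\<close>])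
    fix S assume "S \<in> \<S>"
    then have "finite S" by (simp add: \<S>_def)
    show "{w \<in> space M. \<forall>i\<in>S. i \<in> J w} \<in> sets M"
      by (rule sets.sets_Collect_finite_All[OF J \<open>finite S\<close>])
  qed
  finally show "{w \<in> space M. G (J w) \<inter> U \<noteq> {}} \<in> sets M" .
qed (rule G)

lemma openin_Int_ball: "openin (top_of_set X) (X \<inter> ball x r)"
  by (rule openin_open_Int) simp

text \<open>A closed set contains \<open>S\<close> exactly if it meets all small balls around a
  dense sequence of \<open>S\<close>, which are countably many conditions.\<close>

lemma effros_subset_sets:
  fixes S :: "'a::real_normed_vector set"
  assumes f: "f \<in> M \<rightarrow>\<^sub>M effros X" and s: "dense_sequence S s" and S: "S \<subseteq> X"
  shows "{w \<in> space M. S \<subseteq> f w} \<in> sets M"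
proof -
  have "S \<subseteq> f w \<longleftrightarrow> (\<forall>k j. f w \<inter> (X \<inter> ball (s k) (1 / real (Suc j))) \<noteq> {})" if w: "w \<in> space M" for w
  proof -
    have F: "closed (f w)" "f w \<subseteq> X"
      using measurable_space[OF f w] by (auto simp: space_effros closed_subspace_def)
    show ?thesis
    proof
      assume "S \<subseteq> f w"
      then show "\<forall>k j. f w \<inter> (X \<inter> ball (s k) (1 / real (Suc j))) \<noteq> {}"
      proof (intro allI)
        fix k j
        have "s k \<in> f w \<inter> (X \<inter> ball (s k) (1 / real (Suc j)))"
          using dense_sequence_mem[OF s, of k] S \<open>S \<subseteq> f w\<close> by auto
        then show "f w \<inter> (X \<inter> ball (s k) (1 / real (Suc j))) \<noteq> {}" by blast
      qed
    next
      assume R: "\<forall>k j. f w \<inter> (X \<inter> ball (s k) (1 / real (Suc j))) \<noteq> {}"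
      show "S \<subseteq> f w"
      proof
        fix x assume x: "x \<in> S"
        have "x \<in> closure (f w)"
          unfolding closure_approachable
        proof (intro allI impI)
          fix e :: real assume "e > 0"
          then obtain j where j: "1 / real (Suc j) < e / 2" using nat_approx_posE[of "e / 2"] by auto
          obtain k where k: "dist x (s k) < e / 2" using dense_sequenceD[OF s x, of "e / 2"] \<open>e > 0\<close> by auto
          obtain y where y: "y \<in> f w" "dist (s k) y < 1 / real (Suc j)" using R by fastforce
          have "dist y x < e" using k y(2) j dist_triangle[of y x "s k"] by (simp add: dist_commute)
          then show "\<exists>y\<in>f w. dist y x < e" using y(1) by blast
        qed
        then show "x \<in> f w" using F(1) by simp
      qed
    qed
  qed
  then have "{w \<in> space M. S \<subseteq> f w} = {w \<in> space M. \<forall>k j. f w \<inter> (X \<inter> ball (s k) (1 / real (Suc j))) \<noteq> {}}"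
    by auto
  also have "\<dots> \<in> sets M"
    by (intro sets.sets_Collect_countable_All effros_hits_sets[OF f] openin_Int_ball)
  finally show ?thesis .
qed

text \<open>Closed sets that meet the same members of a countable family of balls coincide.\<close>

lemma effros_eq_sets:
  fixes X :: "'a::real_normed_vector set"
  assumes f: "f \<in> M \<rightarrow>\<^sub>M effros X" and g: "g \<in> M \<rightarrow>\<^sub>M effros X" and d: "dense_sequence X d"
  shows "{w \<in> space M. f w = g w} \<in> sets M"
proof -
  define B where "B k j = X \<inter> ball (d k) (1 / real (Suc j))" for k j :: nat
  have sub: "F \<subseteq> F'" if F: "closed_subspace F X" "closed_subspace F' X"
    and imp: "\<And>k j. F \<inter> B k j \<noteq> {} \<Longrightarrow> F' \<inter> B k j \<noteq> {}" for F F'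
  proof
    fix x assume x: "x \<in> F"
    then have xX: "x \<in> X" using F by (auto simp: closed_subspace_def)
    have "x \<in> closure F'"
      unfolding closure_approachable
    proof (intro allI impI)
      fix e :: real assume "e > 0"
      then obtain j where j: "1 / real (Suc j) < e / 2" using nat_approx_posE[of "e / 2"] by auto
      obtain k where k: "dist x (d k) < 1 / real (Suc j)" using dense_sequenceD[OF d xX, of "1 / real (Suc j)"] by auto
      then have "F \<inter> B k j \<noteq> {}" using x xX by (auto simp: B_def dist_commute)
      then obtain y where y: "y \<in> F'" "dist (d k) y < 1 / real (Suc j)" using imp[of k j] by (auto simp: B_def)
      have "dist y x < e" using k y(2) j dist_triangle[of y x "d k"] by (simp add: dist_commute)
      then show "\<exists>y\<in>F'. dist y x < e" using y(1) by blast
    qed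
    then show "x \<in> F'" using F(2) by (simp add: closed_subspace_def)
  qed
  have "f w = g w \<longleftrightarrow> (\<forall>k j. (f w \<inter> B k j \<noteq> {} \<longrightarrow> g w \<inter> B k j \<noteq> {}) \<and> (g w \<inter> B k j \<noteq> {} \<longrightarrow> f w \<inter> B k j \<noteq> {}))"
    if w: "w \<in> space M" for w
  proof -
    have "closed_subspace (f w) X" "closed_subspace (g w) X"
      using measurable_space[OF f w] measurable_space[OF g w] by (auto simp: space_effros)
    then show ?thesis using sub[of "f w" "g w"] sub[of "g w" "f w"] by blast
  qed
  then have "{w \<in> space M. f w = g w} = {w \<in> space M. \<forall>k j. (f w \<inter> B k j \<noteq> {} \<longrightarrow> g w \<inter> B k j \<noteq> {}) \<and>
      (g w \<inter> B k j \<noteq> {} \<longrightarrow> f w \<inter> B k j \<noteq> {})}" by auto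
  also have "\<dots> \<in> sets M"
    unfolding B_def
    by (intro sets.sets_Collect_countable_All sets.sets_Collect_conj sets.sets_Collect_imp
        effros_hits_sets[OF f] effros_hits_sets[OF g] openin_Int_ball)
  finally show ?thesis .
qed

lemma sets_Cantor_coordinate: "{\<alpha> :: nat \<Rightarrow> bool. \<alpha> n} \<in> sets borel"
proof -
  have "open ((\<lambda>\<alpha> :: nat \<Rightarrow> bool. \<alpha> n) -` {True})"
    by (intro open_vimage continuous_on_product_coordinates open_discrete)
  then show ?thesis by (simp add: vimage_def)
qed

context projection_algebra
begin

lemma part_closed_subspace: "closed_subspace (part I) X"
  by (simp add: closed_subspace_def part_subspace part_closed part_subset)

lemma copart_closed_subspace: "closed_subspace (copart I) X"
  by (simp add: closed_subspace_def copart_subspace copart_closed copart_subset)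

lemma part_approximation: "x \<in> part J \<Longrightarrow> \<exists>y. (\<forall>n. y n \<in> part (J \<inter> {..<n})) \<and> y \<longlonglongrightarrow> x"
  using q_Int_lessThan_lim[of x J]
  by (intro exI[of _ "\<lambda>n. q (J \<inter> {..<n}) x"]) (auto simp: mem_part q_mem q_idem)

text \<open>Kernels shrink as the index set grows; complementing the index set gives the increasing
  family that the measurability criterion expects.\<close>

lemma copart_mono: "I \<subseteq> J \<Longrightarrow> copart (- I) \<subseteq> copart (- J)"
proof
  fix x assume "I \<subseteq> J" "x \<in> copart (- I)"
  then have x: "x \<in> X" "q (- I) x = 0" and "- J \<inter> - I = - J" by (auto simp: copart_def)
  then have "q (- J) x = 0" using q_Int[of x "- J" "- I"] by (simp add: q_zero)
  then show "x \<in> copart (- J)" using x by (simp add: copart_def)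
qed

lemma copart_approximation:
  assumes "x \<in> copart (- J)"
  shows "\<exists>y. (\<forall>n. y n \<in> copart (- (J \<inter> {..<n}))) \<and> y \<longlonglongrightarrow> x"
proof -
  have x: "x \<in> X" "q (- J) x = 0" using assms by (auto simp: copart_def)
  \<comment> \<open>The complements of the truncations are cofinite, so the limit is reduced to
    truncations by writing \<open>q (- S)\<close> as \<open>q UNIV - q S\<close>.\<close>
  have qc: "q (- S) x = q UNIV x - q S x" for S
    using q_Diff[OF x(1), of UNIV S] by (simp add: Compl_eq_Diff_UNIV)
  have "(\<lambda>n. x - (q UNIV x - q (J \<inter> {..<n}) x)) \<longlonglongrightarrow> x - (q UNIV x - q J x)"
    by (intro tendsto_intros q_Int_lessThan_lim x)
  then have "(\<lambda>n. x - q (- (J \<inter> {..<n})) x) \<longlonglongrightarrow> x - q (- J) x" by (simp only: qc)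
  then have "(\<lambda>n. x - q (- (J \<inter> {..<n})) x) \<longlonglongrightarrow> x" by (simp only: x(2) diff_zero)
  moreover have "x - q (- (J \<inter> {..<n})) x \<in> copart (- (J \<inter> {..<n}))" for n
    using x X(1) by (simp add: copart_def q_mem q_diff q_idem subspace_diff)
  ultimately show ?thesis by (intro exI[of _ "\<lambda>n. x - q (- (J \<inter> {..<n})) x"]) auto
qed

lemma part_finite_span:
  assumes fin: "\<And>n. finite_dimensional (part {n})" and F: "finite F"
  shows "\<exists>B. finite B \<and> part F = span B"
  using F
proof (induction F)
  case empty
  have "part {} = span {}" using subspace_0[OF X(1)] by (auto simp: mem_part q_empty q_zero)
  then show ?case by blast
next
  case (insert n F)
  then obtain B where B: "finite B" "part F = span B" by blast
  obtain B' where B': "finite B'" "part {n} = span B'" using fin unfolding finite_dimensional_def by blast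
  have "part (insert n F) = span (B' \<union> B)"
  proof
    show "part (insert n F) \<subseteq> span (B' \<union> B)"
    proof
      fix x assume "x \<in> part (insert n F)"
      then have x: "x \<in> X" "q (insert n F) x = x" by (auto simp: mem_part)
      have "q {n} x \<in> part {n}" "q F x \<in> part F" using x by (auto simp: mem_part q_mem q_idem)
      then have "q {n} x \<in> span (B' \<union> B)" "q F x \<in> span (B' \<union> B)"
        using B B' span_mono[of B "B' \<union> B"] span_mono[of B' "B' \<union> B"] by auto
      moreover have "x = q {n} x + q F x" using q_Un[OF x(1), of "{n}" F] x insert.hyps by simp
      ultimately show "x \<in> span (B' \<union> B)" using span_add by metis
    qed
    have "B' \<subseteq> part {n}" "B \<subseteq> part F" using B B' span_superset by auto
    then have "B' \<union> B \<subseteq> part (insert n F)"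
      using part_mono[of "{n}" "insert n F"] part_mono[of F "insert n F"] by blast
    then show "span (B' \<union> B) \<subseteq> part (insert n F)" by (rule span_minimal[OF _ part_subspace])
  qed
  then show ?case using B B' by blast
qed

lemma part_finite_codimensional:
  assumes fin: "\<And>n. finite_dimensional (part {n})" and I: "I \<subseteq> J" and F: "finite (J - I)"
  shows "finite_codimensional_in (part I) (part J)"
proof -
  obtain B where B: "finite B" "part (J - I) = span B" using part_finite_span[OF fin F] by blast
  have "part J = span (part I \<union> B)"
  proof
    show "part J \<subseteq> span (part I \<union> B)"
    proof
      fix x assume "x \<in> part J"
      then have x: "x \<in> X" "q J x = x" by (auto simp: mem_part)
      have "q I x \<in> part I" "q (J - I) x \<in> part (J - I)" using x by (auto simp: mem_part q_mem q_idem)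
      then have "q I x \<in> span (part I \<union> B)" "q (J - I) x \<in> span (part I \<union> B)"
        using B span_mono[of B "part I \<union> B"] by (auto intro: span_base)
      moreover have "I \<union> (J - I) = J" using I by auto
      then have "x = q I x + q (J - I) x" using q_Un[OF x(1), of I "J - I"] x by simp
      ultimately show "x \<in> span (part I \<union> B)" using span_add by metis
    qed
    have "B \<subseteq> part J" using B span_superset part_mono[of "J - I" J] by blast
    then show "span (part I \<union> B) \<subseteq> part J"
      using part_mono[OF I] by (intro span_minimal part_subspace) auto
  qed
  moreover have "closed_subspace (part I) (part J)"
    by (simp add: closed_subspace_def part_subspace part_closed part_mono I)
  ultimately show ?thesis using B(1) by (auto simp: finite_codimensional_in_def)
qed

text \<open>\<open>E0\<close>-equivalent sequences have codes that differ in finitely many indices,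
  so the part over the intersection has finite codimension in both parts. For inequivalent ones the
  code avoids the relation.\<close>

lemma nearly_ergodic_of_meager:
  assumes fin: "\<And>n. finite_dimensional (part {n})"
    and meager: "meager_seqs {x. nearly_isomorphic (part (left_set x)) (part (right_set x))}"
  shows "nearly_ergodic X"
proof -
  have sym: "nearly_isomorphic (part J) (part I)" if "nearly_isomorphic (part I) (part J)" for I J
    using that isomorphic_sym
    by (fastforce simp: nearly_isomorphic_def finite_codimensional_in_def closed_subspace_def)
  obtain m a b where m: "\<And>n. finite {i. m i \<le> n}"
    "\<And>\<alpha> \<beta>. \<not> E0 \<alpha> \<beta> \<Longrightarrow> \<not> nearly_isomorphic (part (code m a b \<alpha>)) (part (code m a b \<beta>))"
    using code_of_meager_relation[where R = "\<lambda>I J. nearly_isomorphic (part I) (part J)", OF meager sym] by blast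
  have coord: "{\<alpha> \<in> space borel. i \<in> code m a b \<alpha>} \<in> sets borel" for i
  proof -
    have "- {\<alpha> :: nat \<Rightarrow> bool. \<alpha> (m i)} \<in> sets borel" using sets_Cantor_coordinate borel_comp by blast
    then have "{\<alpha> :: nat \<Rightarrow> bool. \<not> \<alpha> (m i)} \<in> sets borel" by (simp add: Collect_neg_eq)
    then show ?thesis
      using sets_Cantor_coordinate[of "m i"] by (cases "i \<in> a"; cases "i \<in> b") (simp_all add: code_def)
  qed
  have meas: "(\<lambda>\<alpha>. part (code m a b \<alpha>)) \<in> borel \<rightarrow>\<^sub>M effros X"
    by (rule effros_measurable_family[OF part_closed_subspace part_mono part_approximation coord])
  have "nearly_isomorphic (part (code m a b \<alpha>)) (part (code m a b \<beta>))" if "E0 \<alpha> \<beta>" for \<alpha> \<beta>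
  proof -
    let ?I = "code m a b \<alpha>" and ?J = "code m a b \<beta>"
    have "E0 \<beta> \<alpha>" using that by (auto simp: E0_def)
    then have "finite (?I - ?I \<inter> ?J)" "finite (?J - ?I \<inter> ?J)"
      using code_E0[OF m(1) that, of a b] code_E0[OF m(1), of \<beta> \<alpha> a b] by (simp_all add: Diff_Int)
    then have "finite_codimensional_in (part (?I \<inter> ?J)) (part ?I)"
      "finite_codimensional_in (part (?I \<inter> ?J)) (part ?J)"
      by (intro part_finite_codimensional fin; simp)+
    then show ?thesis unfolding nearly_isomorphic_def using isomorphic_refl by blast
  qed
  then have "\<forall>\<alpha> \<beta>. E0 \<alpha> \<beta> \<longleftrightarrow> nearly_isomorphic (part (code m a b \<alpha>)) (part (code m a b \<beta>))"
    using m(2) by metis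
  then show ?thesis
    unfolding nearly_ergodic_def by (intro bexI[where x = "\<lambda>\<alpha>. part (code m a b \<alpha>)"] meas)
qed

section \<open>Recovering an index set from its part\<close>

lemma q_null:
  assumes x: "x \<in> X" and null: "\<And>i. i \<in> J \<Longrightarrow> part {i} = {0}"
  shows "q J x = 0"
proof -
  have "q (J \<inter> {..<n}) x = 0" for n
  proof (induction n)
    case 0
    then show ?case using x by (simp add: q_empty)
  next
    case (Suc n)
    show ?case
    proof (cases "n \<in> J")
      case True
      have "q {n} x \<in> part {n}" using x by (simp add: mem_part q_mem q_idem)
      then have "q {n} x = 0" using null[OF True] by simp
      moreover have "J \<inter> {..<Suc n} = (J \<inter> {..<n}) \<union> {n}" using True by (auto simp: less_Suc_eq)
      moreover have "(J \<inter> {..<n}) \<inter> {n} = {}" by auto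
      ultimately show ?thesis using q_Un[OF x, of "J \<inter> {..<n}" "{n}"] Suc by simp
    next
      case False
      then have "J \<inter> {..<Suc n} = J \<inter> {..<n}" by (auto simp: less_Suc_eq)
      then show ?thesis using Suc by simp
    qed
  qed
  then have "(\<lambda>n. 0) \<longlonglongrightarrow> q J x" using q_Int_lessThan_lim[OF x, of J] by simp
  then show ?thesis by (simp add: LIMSEQ_const_iff)
qed

lemma q_Un_null:
  assumes x: "x \<in> X" and null: "\<And>i. i \<in> J \<Longrightarrow> part {i} = {0}"
  shows "q (I \<union> J) x = q I x"
proof -
  have "q (I \<union> (J - I)) x = q I x + q (J - I) x" by (rule q_Un[OF x]) auto
  moreover have "q (J - I) x = 0" by (rule q_null[OF x]) (use null in auto)
  ultimately show ?thesis by simp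
qed

text \<open>An unconditional decomposition may contain zero summands, and their indices leave no
  trace in \<open>part I\<close>.\<close>

lemma part_singleton_subset_part: "part {i} \<subseteq> part I \<longleftrightarrow> i \<in> I \<or> part {i} = {0}"
proof
  assume sub: "part {i} \<subseteq> part I"
  show "i \<in> I \<or> part {i} = {0}"
  proof (cases "i \<in> I")
    case False
    have "x = 0" if x: "x \<in> part {i}" for x
    proof -
      have "x \<in> X" "q {i} x = x" "q I x = x" using x sub by (auto simp: mem_part)
      then have "x = q ({i} \<inter> I) x" using q_Int[of x "{i}" I] by simp
      then show ?thesis using False \<open>x \<in> X\<close> by (simp add: q_empty)
    qed
    then show ?thesis using subspace_0[OF part_subspace[of "{i}"]] by blast
  qed simp
next
  assume "i \<in> I \<or> part {i} = {0}"
  then show "part {i} \<subseteq> part I"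
  proof
    assume "i \<in> I"
    then show ?thesis by (intro part_mono) simp
  next
    assume "part {i} = {0}"
    then show ?thesis using subspace_0[OF part_subspace[of I]] by simp
  qed
qed

text \<open>
  The index set of a part is recovered from it up to indices \<open>i\<close> with \<open>part {i} = {0}\<close>, so the range
  is described by countably many Borel conditions on the pair.
\<close>

lemma range_code_sets:
  assumes d: "dense_sequence X d"
  shows "range (\<lambda>\<alpha>. (part (code m a b \<alpha>), copart (code m a b \<alpha>))) \<in> sets (effros X \<Otimes>\<^sub>M effros X)"
proof -
  define N where "N = effros X \<Otimes>\<^sub>M effros X"
  define null where "null = {i. part {i} = {0}}"
  define idx where "idx P = {i. part {i} \<subseteq> P}" for P
  have fst_m: "fst \<in> N \<rightarrow>\<^sub>M effros X" and snd_m: "snd \<in> N \<rightarrow>\<^sub>M effros X" by (simp_all add: N_def)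
  have spaceN: "w \<in> space N \<longleftrightarrow> closed_subspace (fst w) X \<and> closed_subspace (snd w) X" for w
    by (cases w) (simp add: N_def space_pair_measure space_effros)
  have idx_m: "{w \<in> space N. i \<in> idx (fst w)} \<in> sets N" for i
  proof -
    have "part {i} \<noteq> {}" using subspace_0[OF part_subspace] by blast
    then obtain s where "dense_sequence (part {i}) s" using dense_sequence_subset[OF d part_subset] by blast
    from effros_subset_sets[OF fst_m this part_subset] show ?thesis by (simp add: idx_def)
  qed
  have part_m: "(\<lambda>w. part (idx (fst w))) \<in> N \<rightarrow>\<^sub>M effros X"
    by (rule effros_measurable_family[OF part_closed_subspace part_mono part_approximation idx_m])
  have idx_m': "{w \<in> space N. i \<in> - idx (fst w)} \<in> sets N" for i
  proof -
    have "{w \<in> space N. i \<in> - idx (fst w)} = space N - {w \<in> space N. i \<in> idx (fst w)}" by auto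
    then show ?thesis using idx_m by simp
  qed
  have "(\<lambda>w. copart (- (- idx (fst w)))) \<in> N \<rightarrow>\<^sub>M effros X"
    by (rule effros_measurable_family[where G = "\<lambda>J. copart (- J)",
          OF copart_closed_subspace copart_mono copart_approximation idx_m'])
  then have copart_m: "(\<lambda>w. copart (idx (fst w))) \<in> N \<rightarrow>\<^sub>M effros X" by simp
  \<comment> \<open>On each block one bit has to explain all recovered indices up to the invisible
    ones. The bits are numbers of blocks away from a full sequence, so no quantifier over sequences
    enters the Borel condition.\<close>
  define good where "good w \<longleftrightarrow> (\<forall>n. \<exists>c. \<forall>i. m i = n \<longrightarrow>
    (i \<in> idx (fst w) \<longleftrightarrow> (if c then i \<in> a else i \<in> b) \<or> i \<in> null))" for w :: "'a set \<times> 'a set"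
  have null_eq: "part (I \<union> null) = part I" "copart (I \<union> null) = copart I" for I
  proof -
    have "q (I \<union> null) x = q I x" if "x \<in> X" for x
      by (rule q_Un_null[OF that]) (simp add: null_def)
    then show "part (I \<union> null) = part I" "copart (I \<union> null) = copart I"
      by (auto simp: part_def copart_def)
  qed
  have "range (\<lambda>\<alpha>. (part (code m a b \<alpha>), copart (code m a b \<alpha>))) =
      {w \<in> space N. good w \<and> fst w = part (idx (fst w)) \<and> snd w = copart (idx (fst w))}" (is "?L = ?R")
  proof
    show "?L \<subseteq> ?R"
    proof
      fix w assume "w \<in> ?L"
      then obtain \<alpha> where w: "fst w = part (code m a b \<alpha>)" "snd w = copart (code m a b \<alpha>)" by auto
      have idx: "idx (fst w) = code m a b \<alpha> \<union> null"
        using w by (auto simp: idx_def null_def part_singleton_subset_part)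
      then have "good w" unfolding good_def
        by (intro allI exI[where x = "\<alpha> n" for n]) (auto simp: code_def)
      then show "w \<in> ?R"
        using w idx by (simp add: spaceN part_closed_subspace copart_closed_subspace null_eq)
    qed
    show "?R \<subseteq> ?L"
    proof
      fix w assume w: "w \<in> ?R"
      then have "\<forall>n. \<exists>c. \<forall>i. m i = n \<longrightarrow> (i \<in> idx (fst w) \<longleftrightarrow> (if c then i \<in> a else i \<in> b) \<or> i \<in> null)"
        by (simp add: good_def)
      from choice[OF this] obtain \<alpha> where \<alpha>:
        "\<forall>n i. m i = n \<longrightarrow> (i \<in> idx (fst w) \<longleftrightarrow> (if \<alpha> n then i \<in> a else i \<in> b) \<or> i \<in> null)" by blast
      have "i \<in> idx (fst w) \<longleftrightarrow> i \<in> code m a b \<alpha> \<union> null" for i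
        using \<alpha>[THEN spec, THEN spec, THEN mp, OF refl, of i] by (simp add: code_def)
      then have idx: "idx (fst w) = code m a b \<alpha> \<union> null" by blast
      have "fst w = part (idx (fst w))" "snd w = copart (idx (fst w))" using w by blast+
      then have "fst w = part (code m a b \<alpha>)" "snd w = copart (code m a b \<alpha>)"
        unfolding idx null_eq .
      then have "w = (part (code m a b \<alpha>), copart (code m a b \<alpha>))" by (cases w) simp
      then show "w \<in> ?L" by blast
    qed
  qed
  moreover have "?R \<in> sets N"
  proof -
    have "{w \<in> space N. m i = n \<longrightarrow> (i \<in> idx (fst w) \<longleftrightarrow> P)} \<in> sets N" for i n P
    proof -
      have "{w \<in> space N. m i = n \<longrightarrow> (i \<in> idx (fst w) \<longleftrightarrow> P)} =
          (if m i = n then if P then {w \<in> space N. i \<in> idx (fst w)} else {w \<in> space N. i \<in> - idx (fst w)} else space N)"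
        by auto
      then show ?thesis using idx_m[of i] idx_m'[of i] sets.top[of N] by (simp only: split: if_split) blast
    qed
    then have "{w \<in> space N. good w} \<in> sets N"
      unfolding good_def by (intro sets.sets_Collect_countable_All sets.sets_Collect_countable_Ex)
    then show ?thesis
      by (intro sets.sets_Collect_conj effros_eq_sets[OF fst_m part_m d] effros_eq_sets[OF snd_m copart_m d])
  qed
  ultimately show ?thesis by (simp add: N_def)
qed

text \<open>The relations for the four choices of halves have a meager and symmetric union, so one
  code separates all of them at once.\<close>

lemma perfectly_decomposable_of_meager:
  assumes d: "dense_sequence X d"
    and meager: "\<And>e c. meager_seqs {x. (if e then copart (left_set x) else part (left_set x)) \<simeq> (if c then copart (right_set x) else part (right_set x))}"
  shows "perfectly_decomposable X"
proof -
  define V where "V e I = (if e then copart I else part I)" for e I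
  define R where "R I J \<longleftrightarrow> (\<exists>e c. V e I \<simeq> V c J)" for I J
  have "subspace (V e I)" for e I by (simp add: V_def part_subspace copart_subspace)
  then have sym: "R J I" if "R I J" for I J using that isomorphic_sym unfolding R_def by blast
  have "meager_seqs (\<Union>p. {x. V (fst p) (left_set x) \<simeq> V (snd p) (right_set x)})"
    using meager by (intro meager_UN) (simp add: V_def)
  moreover have "(\<Union>p. {x. V (fst p) (left_set x) \<simeq> V (snd p) (right_set x)}) =
      {x. R (left_set x) (right_set x)}" by (simp add: R_def set_eq_iff)
  ultimately have "meager_seqs {x. R (left_set x) (right_set x)}" by simp
  then obtain m a b where m: "\<And>\<alpha> \<beta>. \<not> E0 \<alpha> \<beta> \<Longrightarrow> \<not> R (code m a b \<alpha>) (code m a b \<beta>)"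
    using code_of_meager_relation[where R = R] sym by blast
  \<comment> \<open>Each bit of the sequence is repeated on infinitely many blocks, so distinct
    sequences become \<open>E0\<close>-inequivalent.\<close>
  define m' where "m' i = fst (prod_decode (m i))" for i
  define A where "A \<alpha> e = V e (code m' a b \<alpha>)" for \<alpha> e
  have "\<not> A \<alpha> e \<simeq> A \<beta> c" if neq: "\<alpha> \<noteq> \<beta>" for \<alpha> \<beta> e c
  proof -
    obtain j where j: "\<alpha> j \<noteq> \<beta> j" using neq by blast
    have "\<exists>n\<ge>k. \<alpha> (fst (prod_decode n)) \<noteq> \<beta> (fst (prod_decode n))" for k
      using j by (intro exI[of _ "prod_encode (j, k)"]) (simp add: le_prod_encode_2)
    then have "\<not> E0 (\<lambda>n. \<alpha> (fst (prod_decode n))) (\<lambda>n. \<beta> (fst (prod_decode n)))" by (auto simp: E0_def)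
    then have "\<not> R (code m' a b \<alpha>) (code m' a b \<beta>)" using m by (force simp: code_def m'_def)
    then show ?thesis by (auto simp: R_def A_def)
  qed
  moreover have "space_decomposition X (A \<alpha> False) (A \<alpha> True)" for \<alpha>
    using space_decomposition_part by (simp add: A_def V_def)
  moreover have "range (\<lambda>\<alpha>. (A \<alpha> False, A \<alpha> True)) \<in> sets (effros X \<Otimes>\<^sub>M effros X)"
    using range_code_sets[OF d, of m' a b] by (simp add: A_def V_def)
  ultimately show ?thesis unfolding perfectly_decomposable_def by blast
qed

end

subsection \<open>Absorbing the complemented space\<close>

text \<open>Whichever hypothesis holds, one of countably many isomorphism relations is nonmeager.
  The finite-dimensional summand \<open>D j\<close> is 0 in the first case and records the finite
  codimension in the second.\<close>

lemma (in projection_algebra) absorb: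
  fixes D :: "nat \<Rightarrow> 'd::banach set"
  assumes fin: "\<And>n. finite_dimensional (part {n})" and d: "dense_sequence X d"
    and D: "D 0 = {0}" "\<And>i. D (Suc i) \<simeq> D i \<times> (UNIV :: real set)" "\<And>i. subspace (D i)"
    and D': "\<And>i. closed (D i)" "\<And>i. \<exists>h. dense_sequence (D i) h"
    and X_not: "\<not> perfectly_decomposable X \<or> \<not> nearly_ergodic X"
  shows "\<exists>j l. \<forall>K\<subseteq>{l..}. (X \<times> D j) \<times> part K \<simeq> X \<times> D j"
proof (cases "perfectly_decomposable X")
  case False
  then obtain e c where "\<not> meager_seqs {x. half e (left_set x) \<simeq> half c (right_set x)}"
    using perfectly_decomposable_of_meager[OF d] unfolding half_def by blast
  then obtain l where l: "\<And>K. K \<subseteq> {l..} \<Longrightarrow> X \<times> part K \<simeq> X"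
    using absorb_of_nonmeager_halves[OF d] by blast
  have "(X \<times> D 0) \<times> part K \<simeq> X \<times> D 0" if "K \<subseteq> {l..}" for K
  proof -
    have "(X \<times> D 0) \<times> part K \<simeq> X \<times> part K"
      unfolding D(1) by (intro isomorphic_Times isomorphic_refl isomorphic_Times_zero)
    also have "\<dots> \<simeq> X" by (rule l[OF that])
    also have "\<dots> \<simeq> X \<times> D 0"
      unfolding D(1) by (intro isomorphic_sym[OF isomorphic_Times_zero] subspace_Times X subspace_single_0)
    finally show ?thesis .
  qed
  then show ?thesis by blast
next
  case True
  \<comment> \<open>The indices are crossed: if the parts are \<open>F \<times> D i\<close> and
    \<open>G \<times> D j\<close> with \<open>F\<close> isomorphic to \<open>G\<close>, each has to
    receive the dimension of the other.\<close>
  define S where "S p = {x. part (left_set x) \<times> D (snd p) \<simeq> part (right_set x) \<times> D (fst p)}"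
    for p :: "nat \<times> nat"
  have "{x. nearly_isomorphic (part (left_set x)) (part (right_set x))} \<subseteq> (\<Union>p. S p)"
  proof
    fix x assume "x \<in> {x. nearly_isomorphic (part (left_set x)) (part (right_set x))}"
    then obtain F G B B' where FG: "F \<simeq> G"
      "closed_subspace F (part (left_set x))" "finite B" "part (left_set x) = span (F \<union> B)"
      "closed_subspace G (part (right_set x))" "finite B'" "part (right_set x) = span (G \<union> B')"
      by (auto simp: nearly_isomorphic_def finite_codimensional_in_def)
    obtain i where i: "part (left_set x) \<simeq> F \<times> D i"
      using finite_extension_isomorphic[of F B D] FG D unfolding closed_subspace_def by metis
    obtain j where j: "part (right_set x) \<simeq> G \<times> D j"
      using finite_extension_isomorphic[of G B' D] FG D unfolding closed_subspace_def by metis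
    have "part (left_set x) \<times> D j \<simeq> (F \<times> D i) \<times> D j"
      by (intro isomorphic_Times isomorphic_refl i)
    also have "\<dots> \<simeq> (G \<times> D i) \<times> D j"
      by (intro isomorphic_Times isomorphic_refl FG)
    also have "\<dots> \<simeq> (G \<times> D j) \<times> D i" by (rule isomorphic_Times_right_commute)
    also have "\<dots> \<simeq> part (right_set x) \<times> D i"
      by (intro isomorphic_Times isomorphic_refl isomorphic_sym[OF j] part_subspace)
    finally have "x \<in> S (i, j)" by (simp add: S_def)
    then show "x \<in> (\<Union>p. S p)" by blast
  qed
  moreover have "\<not> meager_seqs {x. nearly_isomorphic (part (left_set x)) (part (right_set x))}"
    using nearly_ergodic_of_meager[OF fin] X_not True by blast
  ultimately have "\<not> meager_seqs (\<Union>p. S p)" using meager_subset by blast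
  then obtain p where p: "\<not> meager_seqs (S p)" using meager_UN[of S] by blast
  obtain h h' where h: "dense_sequence (D (snd p)) h" and h': "dense_sequence (D (fst p)) h'" using D'(2) by metis
  have "\<exists>l. \<forall>K\<subseteq>{l..}. (X \<times> D (snd p)) \<times> part K \<simeq> X \<times> D (snd p)"
    by (rule absorb_of_nonmeager_parts[OF d D(3) D'(1) h D(3) D'(1) h' p[unfolded S_def]])
  then show ?thesis by blast
qed

text \<open>Finite rational combinations of the basis vectors are dense, and they are enumerated
  through lists of rationals.\<close>

lemma schauder_basis_dense_sequence:
  fixes e :: "nat \<Rightarrow> 'a::real_normed_vector"
  assumes X: "subspace X" and basis: "schauder_basis X e"
  shows "\<exists>d. dense_sequence X d"
proof -
  define comb where "comb rs = (\<Sum>i<length rs. of_rat (rs ! i) *\<^sub>R e i)" for rs :: "rat list"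
  have eX: "e i \<in> X" for i using basis by (auto simp: schauder_basis_def)
  have "dense_sequence X (\<lambda>n. comb (from_nat n))"
  proof (rule dense_sequenceI)
    show "comb (from_nat n) \<in> X" for n
      unfolding comb_def by (intro subspace_sum subspace_scale X eX)
    fix x and \<epsilon> :: real assume x: "x \<in> X" and \<epsilon>: "\<epsilon> > 0"
    obtain a where a: "(\<lambda>n. a n *\<^sub>R e n) sums x" using basis x by (auto simp: schauder_basis_def)
    then obtain N where N: "norm ((\<Sum>i<N. a i *\<^sub>R e i) - x) < \<epsilon> / 2"
      using LIMSEQ_D[of "\<lambda>n. \<Sum>i<n. a i *\<^sub>R e i" x "\<epsilon> / 2"] \<epsilon> by (auto simp: sums_def)
    \<comment> \<open>Each of the \<open>N\<close> terms may contribute its share of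
      \<open>\<epsilon> / 2\<close>; \<open>Suc N\<close> and the added 1 keep the denominators
      positive.\<close>
    define \<delta> where "\<delta> i = \<epsilon> / (2 * real (Suc N)) / (norm (e i) + 1)" for i
    have \<delta>: "\<delta> i > 0" for i using \<epsilon> by (simp add: \<delta>_def add_nonneg_pos)
    have "\<exists>q. \<bar>a i - of_rat q\<bar> < \<delta> i" for i
    proof -
      obtain q where "a i - \<delta> i < of_rat q" "of_rat q < a i + \<delta> i"
        using of_rat_dense[of "a i - \<delta> i" "a i + \<delta> i"] \<delta>[of i] by auto
      then have "\<bar>a i - of_rat q\<bar> < \<delta> i" by linarith
      then show ?thesis by blast
    qed
    then obtain r where r: "\<And>i. \<bar>a i - of_rat (r i)\<bar> < \<delta> i" by metis
    have term_le: "norm (a i *\<^sub>R e i - of_rat (r i) *\<^sub>R e i) \<le> \<epsilon> / (2 * real (Suc N))" for i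
    proof -
      have "norm (a i *\<^sub>R e i - of_rat (r i) *\<^sub>R e i) = \<bar>a i - of_rat (r i)\<bar> * norm (e i)"
        by (simp flip: scaleR_diff_left)
      also have "\<dots> \<le> \<delta> i * (norm (e i) + 1)"
        using r[of i] \<delta>[of i] by (intro mult_mono) auto
      also have "\<dots> = \<epsilon> / (2 * real (Suc N))"
      proof -
        have "norm (e i) + 1 \<noteq> 0" using norm_ge_zero[of "e i"] by linarith
        then show ?thesis by (simp add: \<delta>_def)
      qed
      finally show ?thesis .
    qed
    have "comb (map r [0..<N]) = (\<Sum>i<N. of_rat (r i) *\<^sub>R e i)" by (simp add: comb_def)
    then have "norm ((\<Sum>i<N. a i *\<^sub>R e i) - comb (map r [0..<N]))
        = norm (\<Sum>i<N. a i *\<^sub>R e i - of_rat (r i) *\<^sub>R e i)"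
      by (simp add: sum_subtractf)
    also have "\<dots> \<le> (\<Sum>i<N. \<epsilon> / (2 * real (Suc N)))" by (rule sum_norm_le) (rule term_le)
    also have "\<dots> = real N * (\<epsilon> / (2 * real (Suc N)))" by simp
    also have "\<dots> \<le> \<epsilon> / 2" using \<epsilon> by (simp add: field_simps)
    finally have "norm ((\<Sum>i<N. a i *\<^sub>R e i) - comb (map r [0..<N])) \<le> \<epsilon> / 2" .
    then have "dist x (comb (map r [0..<N])) < \<epsilon>"
      using N dist_triangle[of x "comb (map r [0..<N])" "\<Sum>i<N. a i *\<^sub>R e i"]
      by (simp add: dist_norm norm_minus_commute)
    then show "\<exists>n. dist x (comb (from_nat n)) < \<epsilon>"
      by (intro exI[of _ "to_nat (map r [0..<N])"]) simp
  qed
  then show ?thesis by blast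
qed

lemma isomorphic_cancel_finite:
  fixes D :: "nat \<Rightarrow> 'd::real_normed_vector set"
  assumes D: "D 0 = {0}" "\<And>i. D (Suc i) \<simeq> D i \<times> (UNIV :: real set)" "\<And>i. subspace (D i)"
    and U: "subspace U" and V: "subspace V"
    and iso: "U \<times> D j \<simeq> V \<times> D j"
  shows "U \<simeq> V"
  using iso
proof (induction j)
  case 0
  have "U \<simeq> U \<times> D 0"
    unfolding D(1) by (intro isomorphic_sym[OF isomorphic_Times_zero] subspace_Times U subspace_single_0)
  also note 0
  also have "V \<times> D 0 \<simeq> V" unfolding D(1) by (rule isomorphic_Times_zero)
  finally show ?case .
next
  case (Suc j)
  have split: "W \<times> D (Suc j) \<simeq> (W \<times> D j) \<times> (UNIV :: real set)"
    for W :: "'w::real_normed_vector set"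
  proof -
    have "W \<times> D (Suc j) \<simeq> W \<times> (D j \<times> (UNIV :: real set))"
      by (intro isomorphic_Times isomorphic_refl D)
    also have "\<dots> \<simeq> (W \<times> D j) \<times> (UNIV :: real set)" by (rule isomorphic_Times_assoc')
    finally show ?thesis .
  qed
  have "(U \<times> D j) \<times> (UNIV :: real set) \<simeq> U \<times> D (Suc j)"
    by (intro isomorphic_sym[OF split] subspace_Times U D)
  also note Suc.prems
  also have "V \<times> D (Suc j) \<simeq> (V \<times> D j) \<times> (UNIV :: real set)" by (rule split)
  finally have "U \<times> D j \<simeq> V \<times> D j"
    by (rule isomorphic_cancel_line) (intro subspace_Times U V D)+
  then show ?case by (rule Suc.IH)
qed

theorem theorem2p10:
  fixes X :: "'a::banach set"
  assumes "closed_subspace X UNIV"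
    and "\<exists>e. unconditional_basis X e"
    and "\<not> perfectly_decomposable X \<or> \<not> nearly_ergodic X"
  shows "schroeder_bernstein_UFDD TYPE('b::banach) X"
proof -
  have X: "subspace X" "closed X" using assms(1) by auto
  obtain e where e: "unconditional_basis X e" using assms(2) by blast
  have dec: "unconditional_decomposition X (\<lambda>n. span {e n})" and e_ne: "\<And>n. e n \<noteq> 0"
    using unconditional_basis_decomposition[OF X(1) e] by auto
  have span_fin: "finite_dimensional (span {e n})" for n
    unfolding finite_dimensional_def by blast
  have "schauder_basis X e" using e by (simp add: unconditional_basis_def)
  then obtain d where d: "dense_sequence X d" using schauder_basis_dense_sequence[OF X(1)] by blast
  obtain p C where p: "projection_algebra X p C" "\<forall>x\<in>X. p UNIV x = x" "\<forall>n. p {n} ` X = span {e n}"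
    using projection_algebra_of_unconditional_decomposition[OF X dec] by blast
  interpret p: projection_algebra X p C by (rule p(1))
  have p_single: "p.part {n} = span {e n}" and p_UNIV: "p.part UNIV = X" for n
    using p(2,3) by (auto simp: p.part_def)
  have line: "p.part {n} \<simeq> (UNIV :: real set)" for n
  proof -
    have "span (insert (e n) {0}) = p.part {n}" unfolding p_single by (metis insert_commute span_insert_0)
    then have "{0::'a} \<times> (UNIV :: real set) \<simeq> p.part {n}"
      using closed_insert_isomorphic[of "{0::'a}" "e n"] e_ne by simp
    then have "p.part {n} \<simeq> {0::'a} \<times> (UNIV :: real set)"
      by (rule isomorphic_sym) (intro subspace_Times subspace_single_0 subspace_UNIV)
    also have "\<dots> \<simeq> (UNIV :: real set) \<times> {0::'a}" by (rule isomorphic_Times_commute)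
    also have "\<dots> \<simeq> (UNIV :: real set)" by (rule isomorphic_Times_zero)
    finally show ?thesis .
  qed
  \<comment> \<open>The span of the first \<open>i\<close> basis vectors is the model of dimension
    \<open>i\<close> used throughout.\<close>
  define D where "D i = p.part {..<i}" for i
  have D: "D 0 = {0}" "\<And>i. D (Suc i) \<simeq> D i \<times> (UNIV :: real set)" "\<And>i. subspace (D i)"
    "\<And>i. closed (D i)" "\<And>i. \<exists>h. dense_sequence (D i) h"
  proof -
    show "D 0 = {0}" using subspace_0[OF X(1)] by (auto simp: D_def p.mem_part p.q_empty p.q_zero)
    show "D (Suc i) \<simeq> D i \<times> (UNIV :: real set)" for i
    proof -
      have "D (Suc i) \<simeq> D i \<times> p.part {i}"
        using p.part_Un_isomorphic[of "{..<i}" "{i}"] by (simp add: D_def lessThan_Suc)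
      also have "\<dots> \<simeq> D i \<times> (UNIV :: real set)"
        by (intro isomorphic_Times isomorphic_refl line)
      finally show ?thesis .
    qed
    show "subspace (D i)" "closed (D i)" for i by (simp_all add: D_def p.part_subspace p.part_closed)
    show "\<exists>h. dense_sequence (D i) h" for i
      unfolding D_def using subspace_0[OF p.part_subspace] by (intro dense_sequence_subset[OF d p.part_subset]) blast
  qed
  \<comment> \<open>One basis vector beyond \<open>l\<close> is absorbed in the presence of
    \<open>D j\<close>, and \<open>D j\<close> is then cancelled line by line.\<close>
  have X_line: "X \<times> (UNIV :: real set) \<simeq> X"
  proof -
    obtain j l where jl: "\<And>K. K \<subseteq> {l..} \<Longrightarrow> (X \<times> D j) \<times> p.part K \<simeq> X \<times> D j"
      using p.absorb[OF _ d D assms(3)] span_fin p_single by metis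
    have "(X \<times> (UNIV :: real set)) \<times> D j \<simeq> (X \<times> D j) \<times> (UNIV :: real set)"
      by (rule isomorphic_Times_right_commute)
    also have "\<dots> \<simeq> (X \<times> D j) \<times> p.part {l}"
      by (intro isomorphic_Times isomorphic_refl isomorphic_sym[OF line] p.part_subspace)
    also have "\<dots> \<simeq> X \<times> D j" by (rule jl) simp
    finally show ?thesis
      by (rule isomorphic_cancel_finite[OF D(1-3), rotated 2]) (intro subspace_Times X subspace_UNIV)+
  qed
  have X_fin: "X \<times> D i \<simeq> X" for i
  proof (induction i)
    case 0
    show ?case unfolding D(1) by (rule isomorphic_Times_zero)
  next
    case (Suc i)
    have "X \<times> D (Suc i) \<simeq> X \<times> (D i \<times> (UNIV :: real set))"
      by (intro isomorphic_Times isomorphic_refl D)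
    also have "\<dots> \<simeq> (X \<times> D i) \<times> (UNIV :: real set)" by (rule isomorphic_Times_assoc')
    also have "\<dots> \<simeq> X \<times> (UNIV :: real set)" by (intro isomorphic_Times isomorphic_refl Suc)
    also have "\<dots> \<simeq> X" by (rule X_line)
    finally show ?case .
  qed
  \<comment> \<open>The tail from \<open>l\<close> on is absorbed by the pattern argument and the
    head below \<open>l\<close> as a finite-dimensional summand. The dimension \<open>j\<close> is
    inserted and removed by \<open>X_fin\<close>.\<close>
  have absorbs: "X \<times> projection_algebra.part X q UNIV \<simeq> X"
    if q: "projection_algebra X q C'" and fin: "\<And>n. finite_dimensional (projection_algebra.part X q {n})" for q C'
  proof -
    interpret q: projection_algebra X q C' by (rule q)
    obtain j l where jl: "\<And>K. K \<subseteq> {l..} \<Longrightarrow> (X \<times> D j) \<times> q.part K \<simeq> X \<times> D j"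
      using q.absorb[OF fin d D assms(3)] by metis
    obtain i where i: "q.part {..<l} \<simeq> D i"
      using q.part_finite_isomorphic[OF fin D(1-3)] by blast
    have "{..<l} \<inter> {l..} = {}" "UNIV = {..<l} \<union> {l..}" by auto
    then have split: "q.part UNIV \<simeq> q.part {..<l} \<times> q.part {l..}"
      using q.part_Un_isomorphic by metis
    have "X \<times> q.part UNIV \<simeq> X \<times> (q.part {..<l} \<times> q.part {l..})"
      by (intro isomorphic_Times isomorphic_refl split)
    also have "\<dots> \<simeq> (X \<times> q.part {..<l}) \<times> q.part {l..}" by (rule isomorphic_Times_assoc')
    also have "\<dots> \<simeq> (X \<times> D i) \<times> q.part {l..}"
      by (intro isomorphic_Times isomorphic_refl i)
    also have "\<dots> \<simeq> X \<times> q.part {l..}"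
      by (intro isomorphic_Times isomorphic_refl X_fin)
    also have "\<dots> \<simeq> (X \<times> D j) \<times> q.part {l..}"
      by (intro isomorphic_Times isomorphic_refl isomorphic_sym[OF X_fin] subspace_Times X D)
    also have "\<dots> \<simeq> X \<times> D j" by (rule jl) simp
    also have "\<dots> \<simeq> X" by (rule X_fin)
    finally show ?thesis .
  qed
  have square: "X \<times> X \<simeq> X"
    using absorbs[OF p(1)] span_fin by (simp add: p_single p_UNIV)
  have "Y \<simeq> X"
    if Y: "subspace Y" "closed Y" and ufdd: "has_UFDD Y" and ce: "complementably_equivalent Y X" for Y :: "'b set"
  proof -
    obtain E where E: "unconditional_decomposition Y E" "\<And>n. finite_dimensional (E n)"
      using ufdd by (auto simp: has_UFDD_def)
    obtain A A' where A: "space_decomposition X A A'" "Y \<simeq> A"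
      using ce by (auto simp: complementably_equivalent_def complemented_in_def)
    obtain B B' where B: "space_decomposition Y B B'" "X \<simeq> B"
      using ce by (auto simp: complementably_equivalent_def complemented_in_def)
    obtain r D where r: "projection_algebra Y r D" "\<forall>y\<in>Y. r UNIV y = y" "\<forall>n. r {n} ` Y = E n"
      using projection_algebra_of_unconditional_decomposition[OF Y E(1)] by blast
    interpret r: projection_algebra Y r D by (rule r(1))
    obtain \<pi> where \<pi>: "bdd_linear_on X A \<pi>" "\<And>a. a \<in> A \<Longrightarrow> \<pi> a = a"
      using space_decomposition_projection[OF X A(1)] by metis
    have AX: "A \<subseteq> X" using A(1) by (auto simp: space_decomposition_def closed_subspace_def)
    obtain T T' where T: "bdd_linear_on Y A T" "bdd_linear_on A Y T'"
      "\<And>y. y \<in> Y \<Longrightarrow> T' (T y) = y" "\<And>a. a \<in> A \<Longrightarrow> T (T' a) = a"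
      using isomorphic_spacesE[OF A(2) Y(1)] by metis
    define S where "S x = T' (\<pi> x)" for x
    \<comment> \<open>The decomposition of \<open>Y\<close> is moved to the copy \<open>A\<close>
      inside \<open>X\<close>, where the hypothesis on \<open>X\<close> applies.\<close>
    define q where "q I x = T (r I (S x))" for I x
    have S: "bdd_linear_on X Y S" unfolding S_def by (rule bdd_linear_on_compose[OF \<pi>(1) T(2)])
    have TX: "bdd_linear_on Y X T" using bdd_linear_on_compose[OF T(1) bdd_linear_on_id[OF AX]] .
    have ST: "S (T y) = y" if "y \<in> Y" for y
      using that T(3) \<pi>(2) bdd_linear_onD(1)[OF T(1)] by (simp add: S_def)
    obtain C' where q: "projection_algebra X q C'"
      using projection_algebra_retract[OF r(1) X TX S ST] unfolding q_def[abs_def] by blast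
    interpret q: projection_algebra X q C' by (rule q)
    have S_image: "S ` X = Y"
    proof
      show "S ` X \<subseteq> Y" using bdd_linear_onD(1)[OF S] by blast
      show "Y \<subseteq> S ` X"
      proof
        fix y assume "y \<in> Y"
        then have "y = S (T y)" "T y \<in> X" using ST bdd_linear_onD(1)[OF TX] by auto
        then show "y \<in> S ` X" by (rule image_eqI)
      qed
    qed
    have q_part: "q.part I = T ` (r I ` Y)" for I
      unfolding q.part_def q_def S_image[symmetric] by (simp add: image_image)
    have "finite_dimensional (q.part {n})" for n
    proof -
      have "r {n} ` Y \<subseteq> Y" using r.q_mem by auto
      then have "E n \<subseteq> Y" using r(3) by simp
      then show ?thesis
        using finite_dimensional_image[OF E(2) _ TX Y(1)] r(3) by (simp add: q_part)
    qed
    then have absorb: "X \<times> q.part UNIV \<simeq> X" by (rule absorbs[OF q])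
    have "q.part UNIV = A"
    proof -
      have "r UNIV ` Y = Y" using r(2) by simp
      moreover have "T ` Y = A"
      proof
        show "T ` Y \<subseteq> A" using bdd_linear_onD(1)[OF T(1)] by blast
        show "A \<subseteq> T ` Y" using T(4) bdd_linear_onD(1)[OF T(2)] by (metis imageI subsetI)
      qed
      ultimately show ?thesis by (simp add: q_part)
    qed
    with absorb have XA: "X \<times> A \<simeq> X" by simp
    have BB: "subspace B" "subspace B'"
      using B(1) by (auto simp: space_decomposition_def closed_subspace_def)
    have YXB: "Y \<simeq> X \<times> B'"
    proof -
      have "Y \<simeq> B \<times> B'" by (rule space_decomposition_isomorphic[OF Y B(1)])
      also have "\<dots> \<simeq> X \<times> B'"
        by (intro isomorphic_Times isomorphic_refl isomorphic_sym[OF B(2) X(1)])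
      finally show ?thesis .
    qed
    note YXB
    also have "X \<times> B' \<simeq> (X \<times> X) \<times> B'"
      by (intro isomorphic_Times isomorphic_refl isomorphic_sym[OF square] subspace_Times X)
    also have "\<dots> \<simeq> X \<times> (X \<times> B')" by (rule isomorphic_Times_assoc)
    also have "\<dots> \<simeq> X \<times> Y"
      by (intro isomorphic_Times isomorphic_refl isomorphic_sym[OF YXB Y(1)])
    also have "\<dots> \<simeq> X \<times> A" by (intro isomorphic_Times isomorphic_refl A)
    also have "\<dots> \<simeq> X" by (rule XA)
    finally show ?thesis .
  qed
  moreover have "has_UFDD X" unfolding has_UFDD_def using dec span_fin by blast
  ultimately show ?thesis by (simp add: schroeder_bernstein_UFDD_def)
qed

end
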